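(* Let $m \geq 1$ be a fixed integer, and let $\xi_1, \ldots, \xi_m$ be complex-valued random variables such that, for each $1 \leq k \leq m$: the real and imaginary parts of $\xi_k$ are independent; $\xi_k$ has mean zero and finite fourth moment; and $\xi_k$ has nonzero variance $\sigma_k^2$. For each $n \geq 1$, let $X_{n,1}, \ldots, X_{n,m}$ be independent $n \times n$ iid random matrices with atom variables $\xi_1, \ldots, \xi_m$, respectively. Define $$ P_n := n^{-m/2} X_{n,1} \cdots X_{n,m}, \qquad \sigma := \sigma_1 \cdots \sigma_m . $$ Then, almost surely, the spectral radius of $P_n$ is bounded above by $\sigma + o(1)$ as $n \to \infty$. In particular, for any fixed $\varepsilon > 0$, almost surely, for $n$ sufficiently large, all eigenvalues of $P_n$ are contained in the disk $\{ z \in \mathbb{C} : |z| < \sigma + \varepsilon \}$.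
   Context: An $n\times n$ iid random matrix with atom variable $\xi$ is an $n \times n$ random matrix whose entries are independent and identically distributed copies of $\xi$. The spectral radius of a square matrix is the largest absolute value of its eigenvalues. The term $o(1)$ tends to zero as $n\to\infty$. $\sigma_k>0$ is the standard deviation of $\xi_k$. *)

theory Defs
  imports "HOL-Probability.Probability" "Jordan_Normal_Form.Spectral_Radius"
begin

definition complex_variance :: "'b measure \<Rightarrow> ('b \<Rightarrow> complex) \<Rightarrow> real" where
  "complex_variance N \<xi> = (\<integral>\<omega>. (cmod (\<xi> \<omega> - (\<integral>\<omega>'. \<xi> \<omega>' \<partial>N)))\<^sup>2 \<partial>N)"

definition std_dev :: "'b measure \<Rightarrow> ('b \<Rightarrow> complex) \<Rightarrow> real" where
  "std_dev N \<xi> = sqrt (complex_variance N \<xi>)"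

text \<open>Matrices of one fixed size carry the Borel sigma-algebra of their entries. It has to be
  introduced by hand because the type \<^typ>\<open>complex mat\<close> contains matrices of all sizes.\<close>

definition mat_borel :: "nat \<Rightarrow> complex mat measure" where
  "mat_borel n = vimage_algebra (carrier_mat n n)
     (\<lambda>A. \<lambda>p\<in>{..<n} \<times> {..<n}. A $$ p) (\<Pi>\<^sub>M p\<in>{..<n} \<times> {..<n}. borel)"

lemma space_mat_borel [simp]: "space (mat_borel n) = carrier_mat n n"
  by (simp add: mat_borel_def)

lemma measurable_mat_borel_iff:
  "X \<in> measurable M (mat_borel n) \<longleftrightarrow>
     (\<forall>\<omega>\<in>space M. X \<omega> \<in> carrier_mat n n) \<and>
     (\<forall>i<n. \<forall>j<n. (\<lambda>\<omega>. X \<omega> $$ (i, j)) \<in> borel_measurable M)"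
  (is "?L \<longleftrightarrow> ?R")
proof
  let ?I = "{..<n} \<times> {..<n}"
  let ?f = "\<lambda>A :: complex mat. \<lambda>p\<in>?I. A $$ p"
  have f: "?f \<in> carrier_mat n n \<rightarrow> space (\<Pi>\<^sub>M p\<in>?I. (borel :: complex measure))"
    by (auto simp: space_PiM)
  {
    assume L: ?L
    have m: "?f \<in> measurable (mat_borel n) (\<Pi>\<^sub>M p\<in>?I. borel)"
      unfolding mat_borel_def by (rule measurable_vimage_algebra1[OF f])
    have "(\<lambda>\<omega>. X \<omega> $$ (i, j)) \<in> borel_measurable M" if "i < n" "j < n" for i j
    proof -
      have "(\<lambda>\<omega>. ?f (X \<omega>) (i, j)) \<in> borel_measurable M"
        using measurable_compose[OF measurable_compose[OF L m] measurable_component_singleton] that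
        by blast
      then show ?thesis using that by simp
    qed
    then show ?R using measurable_space[OF L] by auto
  next
    assume R: ?R
    show ?L unfolding mat_borel_def
    proof (rule measurable_vimage_algebra2)
      show "X \<in> space M \<rightarrow> carrier_mat n n" using R by auto
      show "(\<lambda>\<omega>. ?f (X \<omega>)) \<in> measurable M (\<Pi>\<^sub>M p\<in>?I. borel)"
        using R by (intro measurable_restrict) auto
    qed
  }
qed

text \<open>The atom variable \<open>\<xi>\<close> may live on a probability space \<open>N\<close> different from the space \<open>M\<close>
  carrying the matrix: a copy of \<open>\<xi>\<close> is a random variable with the same law.\<close>

definition iid_random_matrix ::
    "'a measure \<Rightarrow> nat \<Rightarrow> 'b measure \<Rightarrow> ('b \<Rightarrow> complex) \<Rightarrow> ('a \<Rightarrow> complex mat) \<Rightarrow> bool" where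
  "iid_random_matrix M n N \<xi> X \<longleftrightarrow>
     X \<in> measurable M (mat_borel n) \<and>
     prob_space.indep_vars M (\<lambda>_. borel) (\<lambda>p \<omega>. X \<omega> $$ p) ({..<n} \<times> {..<n}) \<and>
     (\<forall>i<n. \<forall>j<n. distr M borel (\<lambda>\<omega>. X \<omega> $$ (i, j)) = distr N borel \<xi>)"

text \<open>The ordered product \<open>A 1 * (A 2 * (\<dots> * (A m * 1)))\<close>.\<close>

definition mat_product :: "nat \<Rightarrow> nat \<Rightarrow> (nat \<Rightarrow> complex mat) \<Rightarrow> complex mat" where
  "mat_product n m A = foldr (\<lambda>k B. A k * B) [1..<Suc m] (1\<^sub>m n)"

definition normalized_product :: "nat \<Rightarrow> nat \<Rightarrow> (nat \<Rightarrow> complex mat) \<Rightarrow> complex mat" where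
  "normalized_product n m A =
     complex_of_real (real n powr (- (real m / 2))) \<cdot>\<^sub>m mat_product n m A"

end

theory Submission
  imports Defs "HOL-Real_Asymp.Real_Asymp"
begin

text \<open>
  Let \<open>\<sigma>\<^sub>k\<close> be the standard deviations. If \<open>z\<close> is an eigenvalue of \<open>P\<^sub>n\<close> and \<open>w ^ m = z / \<sigma>\<close>, then
  \<open>w\<close> is an eigenvalue of the cyclic block matrix \<open>A\<close> of size \<open>m n\<close> whose only nonzero blocks
  \<open>X\<^sub>n\<^sub>,\<^sub>k / (\<sigma>\<^sub>k \<surd>n)\<close> lead from layer \<open>k\<close> to layer \<open>k + 1\<close> (\<open>eigenvector_lift\<close>). So it suffices that for
  each \<open>\<zeta> > 1\<close>, almost surely, \<open>A\<close> eventually has no eigenvalue of modulus at least \<open>\<zeta>\<close>. The entries of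
  \<open>A\<close> are independent and centered, with second moment at most \<open>1 / n\<close> and fourth moment \<open>O(1 / n\<^sup>2)\<close>.
  Matrices of different sizes may depend on each other in any way, so the only tool is the first
  Borel--Cantelli lemma, and the failure probabilities have to be summable in \<open>n\<close>.

  With four moments the norm of \<open>A\<close> is out of control on that scale: entries of constant modulus appear
  with probability that need not be summable. They do little harm to the spectral radius, because an
  entry matters only through the cycles that pass through it. Therefore \<open>A\<close> is split as \<open>B + S\<close>. The
  bulk \<open>B\<close> contains the entries of modulus at most \<open>\<tau>\<^sub>0 = n powr (-1/200)\<close>, and \<open>S\<close> the sparse rest; on
  the diagonal, which is nonzero only for \<open>m = 1\<close>, the threshold is instead a small constant \<open>\<delta>\<close>.

  The bulk. An entry of \<open>B ^ l\<close> is a sum over walks of length \<open>l\<close>, and a moment of it is a sum over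
  tuples of walks, in which every edge carries a mixed moment of one entry. Reading the walks step by
  step, the first visit to an edge has weight \<open>1 / n\<close>, the second weight 1, and later visits have weight
  \<open>\<tau>\<^sub>0\<close> or \<open>\<delta>\<close>. A walk can follow known edges only after it has returned to a vertex that it left before,
  and such a return is expensive. The potential of \<open>step_bound\<close> turns this remark into a one-step
  inequality; iterating it shows that the weight of all walks of length \<open>l = O(ln n)\<close> is at most a
  small power of \<open>n\<close> (\<open>walk_bound\<close>, \<open>moment_bound\<close>). High moments then give \<open>\<bar>(B ^ l)\<^sub>q\<^sub>y\<bar> \<le> n powr (1/200)\<close>
  for all entries at once (\<open>entry_moment\<close>). If one asks in addition that the walks enter \<open>y\<close> only at
  their end, then the fourth moment is almost \<open>1 / n\<^sup>2\<close> (\<open>first_passage_moment\<close>).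

  The perturbation. Let \<open>A v = z v\<close> with \<open>\<bar>z\<bar> \<ge> \<zeta>\<close> and put \<open>w = S v\<close>. Iterating \<open>v = (B v + w) / z\<close> about
  \<open>C ln n\<close> times expresses \<open>v\<close>, and hence \<open>w\<close>, by the products \<open>S B ^ l w\<close> with \<open>l < C ln n\<close> and a
  negligible term. These products involve a large entry and the bulk walks from its end to the start of
  another large entry. Outside an event of summable probability all of them are tiny for \<open>l \<ge> 1\<close>, and no
  walk follows three large entries in succession, which settles \<open>l = 0\<close>. Hence \<open>w\<close> is a contraction of
  itself and vanishes (\<open>no_large_eigenvalue\<close>). The events are estimated by fourth moments: a fixed set of \<open>j\<close>
  entries is large with probability about \<open>n powr (-2 j)\<close>, there are about \<open>n powr (2 j)\<close> such sets, and the
  fourth moment of the bulk walks contributes the remaining \<open>1 / n\<^sup>2\<close> (\<open>exceptional_event\<close>). Only the loops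
  use the fourth moment at full strength: the probability that one of them exceeds \<open>\<delta>\<close> is at most
  \<open>n P(\<bar>\<xi>\<bar> > \<delta> \<sigma> \<surd>n)\<close>, and this is summable exactly because \<open>\<xi>\<close> has a fourth moment.
\<close>

section \<open>Weighted walks\<close>

text \<open>
  The bound for a mixed moment of total order \<open>j\<close> of one entry. For \<open>j = 1\<close> the truncated subtraction
  makes it \<open>\<rho> e\<close>: truncated entries are not centered, but their means are far below \<open>\<rho> e\<close>.
\<close>

definition visit_weight :: "('v \<times> 'v \<Rightarrow> real) \<Rightarrow> ('v \<times> 'v \<Rightarrow> real) \<Rightarrow> 'v \<times> 'v \<Rightarrow> nat \<Rightarrow> real" where
  "visit_weight \<rho> \<tau> e j = (if j = 0 then 1 else \<rho> e * \<tau> e ^ (j - 2))"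

definition open_out :: "'v set \<Rightarrow> ('v \<times> 'v \<Rightarrow> nat) \<Rightarrow> 'v \<Rightarrow> 'v set" where
  "open_out V c u = {v \<in> V. c (u, v) = 1}"

text \<open>
  The choices of a walk that retraces its steps: an edge visited exactly once may be followed again
  free of charge, and at each vertex all but one of these edges count as excess.
\<close>

definition excess :: "'v set \<Rightarrow> ('v \<times> 'v \<Rightarrow> nat) \<Rightarrow> nat" where
  "excess V c = (\<Sum>u\<in>V. card (open_out V c u) - 1)"

definition departed :: "'v set \<Rightarrow> ('v \<times> 'v \<Rightarrow> nat) \<Rightarrow> 'v \<Rightarrow> bool" where
  "departed V c u \<longleftrightarrow> (\<exists>v\<in>V. c (u, v) \<noteq> 0)"

text \<open>
  A walk at a vertex that it has never left must open a new edge. At a vertex that it left before it may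
  also retrace old edges; being in such a position is expensive to reach, and the two extra units pay
  for the options that it opens.
\<close>

definition potential :: "'v set \<Rightarrow> ('v \<times> 'v \<Rightarrow> nat) \<Rightarrow> 'v \<Rightarrow> nat" where
  "potential V c u = excess V c + (if departed V c u then 2 else 0)"

abbreviation add_visit :: "('e \<Rightarrow> nat) \<Rightarrow> 'e \<Rightarrow> 'e \<Rightarrow> nat" where
  "add_visit c e \<equiv> c(e := Suc (c e))"

locale walk_weights =
  fixes V :: "'v set" and \<rho> \<tau> :: "'v \<times> 'v \<Rightarrow> real"
    and r\<^sub>0 \<tau>\<^sub>0 \<delta> K :: real and H :: nat
  assumes finite_V: "finite V"
    and \<rho>_nonneg: "\<And>e. 0 \<le> \<rho> e" and \<rho>_le: "\<And>e. \<rho> e \<le> r\<^sub>0"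
    and \<rho>_row: "\<And>u. u \<in> V \<Longrightarrow> (\<Sum>v\<in>V. \<rho> (u, v)) \<le> 1"
    and \<tau>_nonneg: "\<And>e. 0 \<le> \<tau> e"
    and \<tau>_off: "\<And>u v. u \<noteq> v \<Longrightarrow> \<tau> (u, v) \<le> \<tau>\<^sub>0"
    and \<tau>_loop: "\<And>u. \<tau> (u, u) \<le> \<delta>"
    and K_ge_1: "1 \<le> K" and \<tau>\<^sub>0_nonneg: "0 \<le> \<tau>\<^sub>0"
begin

definition weight :: "('v \<times> 'v \<Rightarrow> nat) \<Rightarrow> real" where
  "weight c = (\<Prod>e\<in>V \<times> V. visit_weight \<rho> \<tau> e (c e))"

text \<open>
  The contributions of the possible steps: the unique cheap step, the steps that lower the potential,
  first visits to edges that lead to a known vertex, later visits to edges, and later visits to a loop.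
\<close>

definition growth :: real where
  "growth = 1 + (1 + real H) / K + (real H + 1) * r\<^sub>0 * K\<^sup>2 + real H * \<tau>\<^sub>0 + \<delta>"

definition visit_factor :: "('v \<times> 'v \<Rightarrow> nat) \<Rightarrow> 'v \<times> 'v \<Rightarrow> real" where
  "visit_factor c e = (if c e = 0 then \<rho> e else if c e = 1 then 1 else \<tau> e)"

lemma r\<^sub>0_nonneg: "0 \<le> r\<^sub>0"
  using \<rho>_nonneg \<rho>_le order_trans by blast

lemma \<delta>_nonneg: "0 \<le> \<delta>"
  using \<tau>_nonneg \<tau>_loop order_trans by blast

lemma growth_ge_1: "1 \<le> growth"
  using K_ge_1 r\<^sub>0_nonneg \<tau>\<^sub>0_nonneg \<delta>_nonneg unfolding growth_def by (simp add: add_increasing2)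

lemma visit_weight_nonneg: "0 \<le> visit_weight \<rho> \<tau> e j"
  by (simp add: visit_weight_def \<rho>_nonneg \<tau>_nonneg)

lemma weight_nonneg: "0 \<le> weight c"
  unfolding weight_def by (intro prod_nonneg) (auto simp: visit_weight_nonneg)

lemma weight_add_visit:
  assumes "e \<in> V \<times> V"
  shows "weight (add_visit c e) = weight c * visit_factor c e"
proof -
  have 1: "weight c = visit_weight \<rho> \<tau> e (c e) * (\<Prod>d\<in>V \<times> V - {e}. visit_weight \<rho> \<tau> d (c d))"
    unfolding weight_def using assms finite_V by (subst prod.remove[of _ e]) auto
  have 2: "weight (add_visit c e) = visit_weight \<rho> \<tau> e (Suc (c e)) * (\<Prod>d\<in>V \<times> V - {e}. visit_weight \<rho> \<tau> d (c d))"
    unfolding weight_def using assms finite_V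
    by (subst prod.remove[of _ e]) (auto intro!: prod.cong)
  have "visit_weight \<rho> \<tau> e (Suc (c e)) = visit_weight \<rho> \<tau> e (c e) * visit_factor c e"
  proof -
    consider "c e = 0" | "c e = 1" | j where "c e = Suc (Suc j)"
      by (metis One_nat_def not0_implies_Suc)
    then show ?thesis by cases (auto simp: visit_weight_def visit_factor_def)
  qed
  with 1 2 show ?thesis by simp
qed

lemma card_out_le:
  assumes "u \<in> V" "(\<Sum>e\<in>V \<times> V. c e) \<le> H"
  shows "card {v \<in> V. c (u, v) \<noteq> 0} \<le> H"
proof -
  have "card {v \<in> V. c (u, v) \<noteq> 0} = (\<Sum>v\<in>{v \<in> V. c (u, v) \<noteq> 0}. 1)" by simp
  also have "\<dots> \<le> (\<Sum>v\<in>{v \<in> V. c (u, v) \<noteq> 0}. c (u, v))"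
    by (rule sum_mono) auto
  also have "\<dots> \<le> (\<Sum>v\<in>V. c (u, v))"
    using finite_V by (intro sum_mono2) auto
  also have "\<dots> = (\<Sum>e\<in>Pair u ` V. c e)"
    by (subst sum.reindex) (auto simp: inj_on_def)
  also have "\<dots> \<le> (\<Sum>e\<in>V \<times> V. c e)"
    using finite_V assms by (intro sum_mono2) auto
  finally show ?thesis using assms by simp
qed

lemma card_departed_le:
  assumes "(\<Sum>e\<in>V \<times> V. c e) \<le> H"
  shows "card {u \<in> V. departed V c u} \<le> H"
proof -
  have "card {u \<in> V. departed V c u} = (\<Sum>u\<in>{u \<in> V. departed V c u}. 1)" by simp
  also have "\<dots> \<le> (\<Sum>u\<in>{u \<in> V. departed V c u}. \<Sum>v\<in>V. c (u, v))"
  proof (rule sum_mono)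
    fix u assume "u \<in> {u \<in> V. departed V c u}"
    then obtain v where v: "v \<in> V" "c (u, v) \<noteq> 0" by (auto simp: departed_def)
    then have "1 \<le> c (u, v)" by simp
    also have "\<dots> \<le> (\<Sum>v\<in>V. c (u, v))"
      using v(1) finite_V by (intro member_le_sum) auto
    finally show "1 \<le> (\<Sum>v\<in>V. c (u, v))" .
  qed
  also have "\<dots> \<le> (\<Sum>u\<in>V. \<Sum>v\<in>V. c (u, v))"
    using finite_V by (intro sum_mono2) auto
  also have "\<dots> = (\<Sum>e\<in>V \<times> V. c e)"
    by (simp add: sum.cartesian_product)
  finally show ?thesis using assms by simp
qed

lemma departed_add_visit:
  assumes "v \<in> V" "w \<in> V"
  shows "departed V (add_visit c (u, v)) w \<longleftrightarrow> departed V c w \<or> w = u"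
  using assms by (auto simp: departed_def)

lemma excess_add_visit:
  assumes "u \<in> V" "v \<in> V"
  shows "excess V (add_visit c (u, v)) + (card (open_out V c u) - 1)
         = excess V c + (card (open_out V (add_visit c (u, v)) u) - 1)"
proof -
  have o: "open_out V (add_visit c (u, v)) w = open_out V c w" if "w \<noteq> u" for w
    using that by (auto simp: open_out_def)
  have "excess V (add_visit c (u, v)) = (card (open_out V (add_visit c (u, v)) u) - 1)
      + (\<Sum>w\<in>V - {u}. card (open_out V c w) - 1)"
    unfolding excess_def using assms finite_V
    by (subst sum.remove[of _ u]) (auto simp: o intro!: sum.cong)
  moreover have "excess V c = (card (open_out V c u) - 1) + (\<Sum>w\<in>V - {u}. card (open_out V c w) - 1)"
    unfolding excess_def using assms finite_V by (subst sum.remove[of _ u]) auto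
  ultimately show ?thesis by simp
qed

lemma open_out_add_visit:
  assumes "v \<in> V"
  shows "open_out V (add_visit c (u, v)) u =
     (if c (u, v) = 0 then insert v (open_out V c u)
      else if c (u, v) = 1 then open_out V c u - {v} else open_out V c u)"
  using assms by (auto simp: open_out_def split: if_splits)

lemma excess_first_visit:
  assumes "u \<in> V" "v \<in> V" "c (u, v) = 0"
  shows "excess V (add_visit c (u, v)) \<le> excess V c + 1"
    and "\<not> departed V c u \<Longrightarrow> excess V (add_visit c (u, v)) = excess V c"
proof -
  have fin: "finite (open_out V c u)" using finite_V by (simp add: open_out_def)
  have "card (open_out V (add_visit c (u, v)) u) = Suc (card (open_out V c u))"
    using assms fin by (subst open_out_add_visit) (auto simp: open_out_def)
  note * = excess_add_visit[OF assms(1,2), of c, unfolded this]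
  then show "excess V (add_visit c (u, v)) \<le> excess V c + 1" by simp
  assume "\<not> departed V c u"
  then have "open_out V c u = {}" by (auto simp: open_out_def departed_def)
  with * show "excess V (add_visit c (u, v)) = excess V c" by simp
qed

lemma excess_second_visit:
  assumes "u \<in> V" "v \<in> V" "c (u, v) = 1"
  shows "excess V (add_visit c (u, v)) \<le> excess V c"
    and "card (open_out V c u) \<noteq> 1 \<Longrightarrow> excess V (add_visit c (u, v)) + 1 = excess V c"
proof -
  have fin: "finite (open_out V c u)" using finite_V by (simp add: open_out_def)
  have v: "v \<in> open_out V c u" using assms by (simp add: open_out_def)
  have "card (open_out V (add_visit c (u, v)) u) = card (open_out V c u) - 1"
    using assms fin v by (subst open_out_add_visit) auto
  note * = excess_add_visit[OF assms(1,2), of c, unfolded this]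
  then show "excess V (add_visit c (u, v)) \<le> excess V c" by simp
  assume "card (open_out V c u) \<noteq> 1"
  moreover have "card (open_out V c u) \<noteq> 0" using v fin by auto
  ultimately show "excess V (add_visit c (u, v)) + 1 = excess V c" using * by linarith
qed

lemma excess_later_visit:
  assumes "u \<in> V" "v \<in> V" "c (u, v) \<ge> 2"
  shows "excess V (add_visit c (u, v)) = excess V c"
  using excess_add_visit[OF assms(1,2), of c] assms
  by (simp add: open_out_add_visit)

text \<open>
  All out-edges of \<open>u\<close> are new. A step to a fresh vertex leaves the potential alone, and these steps
  have total weight at most 1. A step to one of the at most \<open>H + 1\<close> other vertices raises the potential
  by 2 but has weight \<open>r\<^sub>0\<close> only.
\<close>

lemma step_from_fresh:
  assumes u: "u \<in> V" and c: "(\<Sum>e\<in>V \<times> V. c e) \<le> H" and nd: "\<not> departed V c u"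
  shows "(\<Sum>v\<in>V. visit_factor c (u, v) * K ^ potential V (add_visit c (u, v)) v)
         \<le> growth * K ^ potential V c u"
proof -
  let ?D = "{v \<in> V. departed V c v \<or> v = u}"
  have c0: "c (u, v) = 0" if "v \<in> V" for v using nd that by (auto simp: departed_def)
  have D: "real (card ?D) \<le> real H + 1"
  proof -
    have "?D \<subseteq> insert u {v \<in> V. departed V c v}" by auto
    then have "card ?D \<le> card (insert u {v \<in> V. departed V c v})"
      using finite_V by (intro card_mono) auto
    also have "\<dots> \<le> Suc (card {v \<in> V. departed V c v})"
      using finite_V by (simp add: card_insert_if)
    also have "\<dots> \<le> Suc H" using card_departed_le[OF c] by simp
    finally show ?thesis by simp
  qed
  have pos: "0 \<le> K ^ j" for j using K_ge_1 by simp
  have tm: "visit_factor c (u, v) * K ^ potential V (add_visit c (u, v)) v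
       \<le> (\<rho> (u, v) + (if v \<in> ?D then r\<^sub>0 * K\<^sup>2 else 0)) * K ^ excess V c" if v: "v \<in> V" for v
  proof -
    have "potential V (add_visit c (u, v)) v = excess V c + (if v \<in> ?D then 2 else 0)"
      using v u by (simp add: potential_def departed_add_visit[OF v] excess_first_visit(2)[where c = c, OF u v c0[OF v] nd])
    then have "visit_factor c (u, v) * K ^ potential V (add_visit c (u, v)) v
       = \<rho> (u, v) * (if v \<in> ?D then K\<^sup>2 else 1) * K ^ excess V c"
      using c0[OF v] by (cases "v \<in> ?D") (simp_all add: visit_factor_def power2_eq_square del: mem_Collect_eq)
    also have "\<rho> (u, v) * (if v \<in> ?D then K\<^sup>2 else 1) \<le> \<rho> (u, v) + (if v \<in> ?D then r\<^sub>0 * K\<^sup>2 else 0)"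
      using mult_right_mono[OF \<rho>_le[of "(u,v)"], of "K\<^sup>2"] \<rho>_nonneg[of "(u,v)"] by auto
    finally show ?thesis using pos by (simp add: mult_right_mono)
  qed
  have "(\<Sum>v\<in>V. visit_factor c (u, v) * K ^ potential V (add_visit c (u, v)) v)
     \<le> (\<Sum>v\<in>V. (\<rho> (u, v) + (if v \<in> ?D then r\<^sub>0 * K\<^sup>2 else 0)) * K ^ excess V c)"
    by (rule sum_mono) (rule tm)
  also have "\<dots> = ((\<Sum>v\<in>V. \<rho> (u, v)) + real (card ?D) * (r\<^sub>0 * K\<^sup>2)) * K ^ excess V c"
  proof -
    have "(\<Sum>v\<in>V. if v \<in> ?D then r\<^sub>0 * K\<^sup>2 else 0) = (\<Sum>v\<in>?D. r\<^sub>0 * K\<^sup>2)"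
      using sum.inter_restrict[OF finite_V, of "\<lambda>_. r\<^sub>0 * K\<^sup>2" ?D, symmetric] inf.absorb2[of ?D V] by auto
    then show ?thesis by (simp add: sum_distrib_right[symmetric] sum.distrib)
  qed
  also have "\<dots> \<le> (1 + (real H + 1) * (r\<^sub>0 * K\<^sup>2)) * K ^ excess V c"
    using pos \<rho>_row[OF u] D r\<^sub>0_nonneg by (intro mult_right_mono add_mono) (auto intro!: mult_right_mono)
  also have "\<dots> \<le> growth * K ^ excess V c"
    using pos K_ge_1 \<tau>\<^sub>0_nonneg \<delta>_nonneg unfolding growth_def by (intro mult_right_mono) auto
  finally show ?thesis using nd by (simp add: potential_def)
qed

text \<open>
  Retracing the only edge that was visited once is the step of weight 1. If there are several such
  edges, each choice removes one unit of excess, which pays for their number. Leaving for a fresh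
  vertex gives back the two units of position and creates at most one unit of excess. Third and later
  visits do not change the excess and carry the factor \<open>\<tau>\<close>.
\<close>

lemma step_from_departed:
  assumes u: "u \<in> V" and c: "(\<Sum>e\<in>V \<times> V. c e) \<le> H" and d: "departed V c u"
  shows "(\<Sum>v\<in>V. visit_factor c (u, v) * K ^ potential V (add_visit c (u, v)) v)
         \<le> growth * K ^ potential V c u"
proof -
  let ?E = "excess V c" and ?X = "\<lambda>v. visit_factor c (u, v) * K ^ potential V (add_visit c (u, v)) v"
  let ?D = "{v \<in> V. departed V c v}"
  let ?j = "card (open_out V c u)"
  let ?A = "{v \<in> V. c (u, v) = 0}" and ?B = "{v \<in> V. c (u, v) = 1}" and ?C = "{v \<in> V. c (u, v) \<ge> 2}"
  have pos: "0 \<le> K ^ j" for j using K_ge_1 by simp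
  have pot: "potential V (add_visit c (u, v)) v = excess V (add_visit c (u, v)) + (if v \<in> ?D then 2 else 0)"
    if "v \<in> V" for v using that d by (auto simp: potential_def departed_add_visit)
  have D: "real (card ?D) \<le> real H" using card_departed_le[OF c] by simp
  have K0: "K > 0" using K_ge_1 by simp
  \<comment> \<open>The two units paid for the position at \<open>u\<close> exceed the one unit of new excess by a factor \<open>K\<close>.\<close>
  have KE: "K ^ Suc ?E = K ^ (?E + 2) / K" using K0 by (simp add: field_simps)
  have KE1: "K ^ (?E + 2) / K \<ge> 0" using pos K0 by simp
  have A1: "?X v \<le> \<rho> (u, v) * (K ^ (?E + 2) / K) + (if v \<in> ?D then r\<^sub>0 * K\<^sup>2 * K ^ (?E + 2) else 0)"
    if v: "v \<in> ?A" for v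
  proof -
    have vV: "v \<in> V" and c0: "c (u, v) = 0" using v by auto
    have ex: "excess V (add_visit c (u, v)) \<le> ?E + 1" using excess_first_visit(1)[where c = c, OF u vV c0] .
    show ?thesis
    proof (cases "v \<in> ?D")
      case False
      have "K ^ potential V (add_visit c (u, v)) v \<le> K ^ Suc ?E"
        using ex False K_ge_1 pot[OF vV] by (intro power_increasing) (simp_all del: mem_Collect_eq)
      then have "?X v \<le> \<rho> (u, v) * K ^ Suc ?E"
        using c0 \<rho>_nonneg by (simp add: visit_factor_def mult_left_mono del: power_Suc)
      then have "?X v \<le> \<rho> (u, v) * (K ^ (?E + 2) / K)" unfolding KE .
      then show ?thesis unfolding if_not_P[OF False] by simp
    next
      case True
      have "K ^ potential V (add_visit c (u, v)) v \<le> K ^ (?E + 3)"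
        using ex True K_ge_1 pot[OF vV] by (intro power_increasing) (simp_all del: mem_Collect_eq)
      then have "?X v \<le> r\<^sub>0 * K ^ (?E + 3)"
        using c0 \<rho>_le[of "(u,v)"] pos r\<^sub>0_nonneg by (simp add: visit_factor_def mult_mono)
      also have "\<dots> \<le> r\<^sub>0 * K ^ (?E + 4)" using K_ge_1 r\<^sub>0_nonneg
        by (intro mult_left_mono power_increasing) auto
      also have "\<dots> = r\<^sub>0 * K\<^sup>2 * K ^ (?E + 2)" by (simp add: power_add algebra_simps power2_eq_square power4_eq_xxxx)
      finally show ?thesis using True mult_nonneg_nonneg[OF \<rho>_nonneg[of "(u,v)"] KE1] by simp
    qed
  qed
  have A: "(\<Sum>v\<in>?A. ?X v) \<le> (1 / K + (real H + 1) * r\<^sub>0 * K\<^sup>2) * K ^ (?E + 2)"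
  proof -
    have "(\<Sum>v\<in>?A. ?X v) \<le> (\<Sum>v\<in>?A. \<rho> (u, v) * (K ^ (?E + 2) / K) + (if v \<in> ?D then r\<^sub>0 * K\<^sup>2 * K ^ (?E + 2) else 0))"
      by (rule sum_mono) (rule A1)
    also have "\<dots> \<le> (\<Sum>v\<in>V. \<rho> (u, v) * (K ^ (?E + 2) / K) + (if v \<in> ?D then r\<^sub>0 * K\<^sup>2 * K ^ (?E + 2) else 0))"
      using finite_V KE1 r\<^sub>0_nonneg K0 \<rho>_nonneg by (intro sum_mono2) (auto intro!: add_nonneg_nonneg mult_nonneg_nonneg)
    also have "\<dots> = (\<Sum>v\<in>V. \<rho> (u, v)) * (K ^ (?E + 2) / K) + real (card ?D) * (r\<^sub>0 * K\<^sup>2 * K ^ (?E + 2))"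
    proof -
      have "(\<Sum>v\<in>V. if v \<in> ?D then r\<^sub>0 * K\<^sup>2 * K ^ (?E + 2) else 0) = (\<Sum>v\<in>?D. r\<^sub>0 * K\<^sup>2 * K ^ (?E + 2))"
        using sum.inter_restrict[OF finite_V, of "\<lambda>_. r\<^sub>0 * K\<^sup>2 * K ^ (?E + 2)" ?D, symmetric] inf.absorb2[of ?D V] by auto
      then show ?thesis by (simp add: sum_distrib_right[symmetric] sum.distrib)
    qed
    also have "\<dots> \<le> 1 * (K ^ (?E + 2) / K) + (real H + 1) * (r\<^sub>0 * K\<^sup>2 * K ^ (?E + 2))"
      using \<rho>_row[OF u] D KE1 K0 by (intro add_mono mult_right_mono mult_nonneg_nonneg r\<^sub>0_nonneg pos) auto
    also have "\<dots> = (1 / K + (real H + 1) * r\<^sub>0 * K\<^sup>2) * K ^ (?E + 2)"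
      by (simp only: distrib_right times_divide_eq_left mult_1 mult.assoc)
    finally show ?thesis .
  qed
  have B: "(\<Sum>v\<in>?B. ?X v) \<le> (1 + real H / K) * K ^ (?E + 2)"
  proof (cases "?j = 1")
    case True
    have "?X v \<le> K ^ (?E + 2)" if v: "v \<in> ?B" for v
    proof -
      have vV: "v \<in> V" and c1: "c (u, v) = 1" using v by auto
      have "K ^ potential V (add_visit c (u, v)) v \<le> K ^ (?E + 2)"
        using excess_second_visit(1)[where c = c, OF u vV c1] pot[OF vV] K_ge_1
        by (intro power_increasing) auto
      then show ?thesis using c1 by (simp add: visit_factor_def)
    qed
    then have "(\<Sum>v\<in>?B. ?X v) \<le> real (card ?B) * K ^ (?E + 2)" by (rule sum_bounded_above)
    also have "\<dots> = 1 * K ^ (?E + 2)" using True by (simp add: open_out_def)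
    also have "\<dots> \<le> (1 + real H / K) * K ^ (?E + 2)" using K0 by (intro mult_right_mono pos) auto
    finally show ?thesis .
  next
    case False
    have "?X v \<le> K ^ (?E + 2) / K" if v: "v \<in> ?B" for v
    proof -
      have vV: "v \<in> V" and c1: "c (u, v) = 1" using v by auto
      have "K ^ potential V (add_visit c (u, v)) v \<le> K ^ Suc ?E"
        using excess_second_visit(2)[where c = c, OF u vV c1 False] pot[OF vV] K_ge_1 by (intro power_increasing) auto
      then show ?thesis using c1 KE by (simp add: visit_factor_def)
    qed
    then have "(\<Sum>v\<in>?B. ?X v) \<le> real (card ?B) * (K ^ (?E + 2) / K)" by (rule sum_bounded_above)
    also have "\<dots> \<le> real H * (K ^ (?E + 2) / K)"
    proof -
      have "card ?B \<le> card {v \<in> V. c (u, v) \<noteq> 0}" using finite_V by (intro card_mono) auto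
      then have "card ?B \<le> H" using card_out_le[OF u c] by simp
      then show ?thesis using KE1 by (intro mult_right_mono) auto
    qed
    also have "\<dots> = real H / K * K ^ (?E + 2)" by (simp only: times_divide_eq_left times_divide_eq_right)
    also have "\<dots> \<le> (1 + real H / K) * K ^ (?E + 2)" using K0 by (intro mult_right_mono pos) auto
    finally show ?thesis .
  qed
  have C: "(\<Sum>v\<in>?C. ?X v) \<le> (real H * \<tau>\<^sub>0 + \<delta>) * K ^ (?E + 2)"
  proof -
    have "?X v \<le> (\<tau>\<^sub>0 + (if v = u then \<delta> else 0)) * K ^ (?E + 2)" if v: "v \<in> ?C" for v
    proof -
      have vV: "v \<in> V" and c2: "c (u, v) \<ge> 2" using v by auto
      have 1: "K ^ potential V (add_visit c (u, v)) v \<le> K ^ (?E + 2)"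
        using excess_later_visit[where c = c, OF u vV c2] pot[OF vV] K_ge_1 by (intro power_increasing) auto
      have 2: "\<tau> (u, v) \<le> \<tau>\<^sub>0 + (if v = u then \<delta> else 0)"
        using \<tau>_off[of u v] \<tau>_loop[of u] \<tau>\<^sub>0_nonneg by (cases "v = u") auto
      have "visit_factor c (u, v) = \<tau> (u, v)" using c2 by (simp add: visit_factor_def)
      then show ?thesis using mult_mono[OF 2 1] \<tau>_nonneg[of "(u,v)"] pos \<tau>\<^sub>0_nonneg \<delta>_nonneg by simp
    qed
    then have "(\<Sum>v\<in>?C. ?X v) \<le> (\<Sum>v\<in>?C. (\<tau>\<^sub>0 + (if v = u then \<delta> else 0)) * K ^ (?E + 2))"
      by (rule sum_mono)
    also have "\<dots> = (real (card ?C) * \<tau>\<^sub>0 + (\<Sum>v\<in>?C. if v = u then \<delta> else 0)) * K ^ (?E + 2)"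
      by (simp add: sum_distrib_right[symmetric] sum.distrib)
    also have "\<dots> \<le> (real H * \<tau>\<^sub>0 + \<delta>) * K ^ (?E + 2)"
    proof -
      have "card ?C \<le> card {v \<in> V. c (u, v) \<noteq> 0}" using finite_V by (intro card_mono) auto
      then have "card ?C \<le> H" using card_out_le[OF u c] by simp
      moreover have "(\<Sum>v\<in>?C. if v = u then \<delta> else 0) \<le> \<delta>"
        using finite_V \<delta>_nonneg by (subst sum.delta) auto
      ultimately show ?thesis using \<tau>\<^sub>0_nonneg by (intro mult_right_mono add_mono pos) auto
    qed
    finally show ?thesis .
  qed
  have "(\<Sum>v\<in>V. ?X v) = (\<Sum>v\<in>?A. ?X v) + (\<Sum>v\<in>?B. ?X v) + (\<Sum>v\<in>?C. ?X v)"
  proof -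
    have "V = (?A \<union> ?B) \<union> ?C" by auto
    then have "(\<Sum>v\<in>V. ?X v) = (\<Sum>v\<in>(?A \<union> ?B) \<union> ?C. ?X v)" by simp
    also have "\<dots> = (\<Sum>v\<in>?A \<union> ?B. ?X v) + (\<Sum>v\<in>?C. ?X v)"
      using finite_V by (intro sum.union_disjoint) auto
    also have "(\<Sum>v\<in>?A \<union> ?B. ?X v) = (\<Sum>v\<in>?A. ?X v) + (\<Sum>v\<in>?B. ?X v)"
      using finite_V by (intro sum.union_disjoint) auto
    finally show ?thesis .
  qed
  also have "\<dots> \<le> growth * K ^ (?E + 2)"
  proof -
    have "growth = (1 / K + (real H + 1) * r\<^sub>0 * K\<^sup>2) + (1 + real H / K) + (real H * \<tau>\<^sub>0 + \<delta>)"
      by (simp add: growth_def add_divide_distrib)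
    then have "growth * K ^ (?E + 2) = (1 / K + (real H + 1) * r\<^sub>0 * K\<^sup>2) * K ^ (?E + 2)
        + (1 + real H / K) * K ^ (?E + 2) + (real H * \<tau>\<^sub>0 + \<delta>) * K ^ (?E + 2)"
      by (simp only: distrib_right)
    then show ?thesis using A B C by linarith
  qed
  finally show ?thesis using d by (simp add: potential_def)
qed

text \<open>
  The total weight of the continuations by one step, discounted by the potential, grows by a factor close
  to 1. This replaces the enumeration of walk shapes in the usual moment method.
\<close>

lemma step_bound:
  assumes "u \<in> V" "(\<Sum>e\<in>V \<times> V. c e) \<le> H"
  shows "(\<Sum>v\<in>V. weight (add_visit c (u, v)) * K ^ potential V (add_visit c (u, v)) v)
         \<le> weight c * growth * K ^ potential V c u"
proof -
  have "(\<Sum>v\<in>V. weight (add_visit c (u, v)) * K ^ potential V (add_visit c (u, v)) v)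
     = weight c * (\<Sum>v\<in>V. visit_factor c (u, v) * K ^ potential V (add_visit c (u, v)) v)"
    unfolding sum_distrib_left using assms by (intro sum.cong) (auto simp: weight_add_visit)
  also have "\<dots> \<le> weight c * (growth * K ^ potential V c u)"
    using step_from_fresh[OF assms] step_from_departed[OF assms]
    by (intro mult_left_mono weight_nonneg) blast
  finally show ?thesis by simp
qed

end

section \<open>Moments of walk sums\<close>

text \<open>
  \<open>mat_iter V B r h\<close> is \<open>B ^ r h\<close> for the matrix \<open>B\<close> with index set \<open>V\<close>. The recursion peels off the first
  step of a walk.
\<close>

primrec mat_iter :: "'v set \<Rightarrow> ('v \<times> 'v \<Rightarrow> complex) \<Rightarrow> nat \<Rightarrow> ('v \<Rightarrow> complex) \<Rightarrow> 'v \<Rightarrow> complex" where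
  "mat_iter V B 0 h = h"
| "mat_iter V B (Suc r) h = (\<lambda>u. \<Sum>v\<in>V. B (u, v) * mat_iter V B r h v)"

definition bounded_rv :: "'a measure \<Rightarrow> ('a \<Rightarrow> complex) \<Rightarrow> bool" where
  "bounded_rv M Y \<longleftrightarrow> Y \<in> borel_measurable M \<and> (\<exists>C. \<forall>\<omega>\<in>space M. cmod (Y \<omega>) \<le> C)"

lemma bounded_rv_const [intro, simp]: "bounded_rv M (\<lambda>_. z)"
  by (auto simp: bounded_rv_def)

lemma bounded_rv_mult [intro]:
  assumes "bounded_rv M Y" "bounded_rv M Z"
  shows "bounded_rv M (\<lambda>\<omega>. Y \<omega> * Z \<omega>)"
proof -
  obtain C D where C: "\<And>\<omega>. \<omega> \<in> space M \<Longrightarrow> cmod (Y \<omega>) \<le> C" and D: "\<And>\<omega>. \<omega> \<in> space M \<Longrightarrow> cmod (Z \<omega>) \<le> D"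
    using assms by (auto simp: bounded_rv_def)
  have "cmod (Y \<omega> * Z \<omega>) \<le> C * D" if "\<omega> \<in> space M" for \<omega>
    unfolding norm_mult using C[OF that] D[OF that] by (intro mult_mono) (auto intro: order_trans[OF norm_ge_zero])
  then show ?thesis using assms by (auto simp: bounded_rv_def)
qed

lemma bounded_rv_add [intro]:
  assumes "bounded_rv M Y" "bounded_rv M Z"
  shows "bounded_rv M (\<lambda>\<omega>. Y \<omega> + Z \<omega>)"
proof -
  obtain C D where C: "\<And>\<omega>. \<omega> \<in> space M \<Longrightarrow> cmod (Y \<omega>) \<le> C" and D: "\<And>\<omega>. \<omega> \<in> space M \<Longrightarrow> cmod (Z \<omega>) \<le> D"
    using assms by (auto simp: bounded_rv_def)
  have "cmod (Y \<omega> + Z \<omega>) \<le> C + D" if "\<omega> \<in> space M" for \<omega>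
    using C[OF that] D[OF that] norm_triangle_ineq[of "Y \<omega>" "Z \<omega>"] by linarith
  then show ?thesis using assms by (auto simp: bounded_rv_def)
qed

lemma bounded_rv_cnj [intro]: "bounded_rv M Y \<Longrightarrow> bounded_rv M (\<lambda>\<omega>. cnj (Y \<omega>))"
proof -
  have "cnj \<in> borel_measurable borel"
    by (intro borel_measurable_continuous_onI continuous_intros)
  then show "bounded_rv M Y \<Longrightarrow> bounded_rv M (\<lambda>\<omega>. cnj (Y \<omega>))"
    by (auto simp: bounded_rv_def intro: measurable_compose)
qed

lemma bounded_rv_sum [intro]: "(\<And>i. i \<in> I \<Longrightarrow> bounded_rv M (Y i)) \<Longrightarrow> bounded_rv M (\<lambda>\<omega>. \<Sum>i\<in>I. Y i \<omega>)"
  by (induction I rule: infinite_finite_induct) auto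

lemma bounded_rv_prod [intro]: "(\<And>i. i \<in> I \<Longrightarrow> bounded_rv M (Y i)) \<Longrightarrow> bounded_rv M (\<lambda>\<omega>. \<Prod>i\<in>I. Y i \<omega>)"
  by (induction I rule: infinite_finite_induct) auto

lemma bounded_rv_power [intro]: "bounded_rv M Y \<Longrightarrow> bounded_rv M (\<lambda>\<omega>. Y \<omega> ^ k)"
  by (induction k) auto

lemma bounded_rv_mat_iter:
  assumes "\<And>u v. u \<in> V \<Longrightarrow> v \<in> V \<Longrightarrow> bounded_rv M (B (u, v))"
    and "\<And>x. x \<in> V \<Longrightarrow> bounded_rv M (h x)" and "u \<in> V"
  shows "bounded_rv M (\<lambda>\<omega>. mat_iter V (\<lambda>e. B e \<omega>) r (\<lambda>x. h x \<omega>) u)"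
  using assms(3)
proof (induction r arbitrary: u)
  case (Suc r)
  then show ?case unfolding mat_iter.simps
    by (intro bounded_rv_sum bounded_rv_mult assms(1)) auto
qed (use assms in auto)

lemma (in prob_space) bounded_rv_integrable: "bounded_rv M Y \<Longrightarrow> integrable M Y"
  by (auto simp: bounded_rv_def intro: integrable_const_bound)

definition conj_if :: "bool \<Rightarrow> complex \<Rightarrow> complex" where
  "conj_if s z = (if s then cnj z else z)"

lemma bounded_rv_conj_if [intro]: "bounded_rv M Y \<Longrightarrow> bounded_rv M (\<lambda>\<omega>. conj_if s (Y \<omega>))"
  by (cases s) (auto simp: conj_if_def)

lemma conj_if_mult: "conj_if s (x * y) = conj_if s x * conj_if s y"
  and conj_if_sum: "conj_if s (\<Sum>i\<in>I. f i) = (\<Sum>i\<in>I. conj_if s (f i))"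
  by (auto simp: conj_if_def)

lemma conj_if_mat_iter:
  "conj_if s (mat_iter V B r h u) = mat_iter V (\<lambda>e. conj_if s (B e)) r (\<lambda>x. conj_if s (h x)) u"
  by (induction r arbitrary: u) (simp_all add: conj_if_sum conj_if_mult)

text \<open>
  The first argument of \<open>\<alpha>\<close> tells the exponents of the conjugates from the others.
\<close>

definition monomial :: "'v set \<Rightarrow> ('v \<times> 'v \<Rightarrow> complex) \<Rightarrow> (bool \<Rightarrow> 'v \<times> 'v \<Rightarrow> nat) \<Rightarrow> complex" where
  "monomial V B \<alpha> = (\<Prod>e\<in>V \<times> V. B e ^ \<alpha> False e * cnj (B e) ^ \<alpha> True e)"

definition visits :: "(bool \<Rightarrow> 'v \<times> 'v \<Rightarrow> nat) \<Rightarrow> 'v \<times> 'v \<Rightarrow> nat" where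
  "visits \<alpha> e = \<alpha> False e + \<alpha> True e"

lemma visits_add_visit: "visits (\<alpha>(s := add_visit (\<alpha> s) e)) = add_visit (visits \<alpha>) e"
  by (cases s) (auto simp: visits_def fun_eq_iff)

lemma monomial_add_visit:
  assumes "finite V" "e \<in> V \<times> V"
  shows "monomial V B (\<alpha>(s := add_visit (\<alpha> s) e)) = monomial V B \<alpha> * conj_if s (B e)"
proof -
  have 1: "monomial V B \<alpha> = (B e ^ \<alpha> False e * cnj (B e) ^ \<alpha> True e)
      * (\<Prod>d\<in>V \<times> V - {e}. B d ^ \<alpha> False d * cnj (B d) ^ \<alpha> True d)"
    unfolding monomial_def using assms by (subst prod.remove[of _ e]) auto
  let ?\<beta> = "\<alpha>(s := add_visit (\<alpha> s) e)"
  have 2: "monomial V B ?\<beta> = (B e ^ ?\<beta> False e * cnj (B e) ^ ?\<beta> True e)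
      * (\<Prod>d\<in>V \<times> V - {e}. B d ^ \<alpha> False d * cnj (B d) ^ \<alpha> True d)"
    unfolding monomial_def using assms by (subst prod.remove[of _ e]) (auto intro!: prod.cong)
  show ?thesis unfolding 1 2 by (cases s) (auto simp: conj_if_def)
qed

lemma sum_add_visit:
  assumes "finite E" "e \<in> E" shows "(\<Sum>d\<in>E. add_visit c e d) = Suc (\<Sum>d\<in>E. c d)"
  using assms by (simp add: sum.remove[of _ e])

locale walk_moments = walk_weights V \<rho> \<tau> r\<^sub>0 \<tau>\<^sub>0 \<delta> K H + prob_space M
  for V :: "'v set" and \<rho> \<tau> and r\<^sub>0 \<tau>\<^sub>0 \<delta> K :: real and H :: nat and M :: "'a measure" +
  fixes b :: "'v \<times> 'v \<Rightarrow> 'a \<Rightarrow> complex"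
  assumes b_bounded: "\<And>e. e \<in> V \<times> V \<Longrightarrow> bounded_rv M (b e)"
begin

abbreviation edge_mono :: "(bool \<Rightarrow> 'v \<times> 'v \<Rightarrow> nat) \<Rightarrow> 'a \<Rightarrow> complex" where
  "edge_mono \<alpha> \<omega> \<equiv> monomial V (\<lambda>e. b e \<omega>) \<alpha>"

lemma bounded_rv_edge_mono [intro]: "bounded_rv M (edge_mono \<alpha>)"
  unfolding monomial_def using b_bounded by (intro bounded_rv_prod bounded_rv_mult bounded_rv_power bounded_rv_cnj)

text \<open>
  One walk of length \<open>r\<close> is summed out, in the presence of the edges \<open>\<alpha>\<close> that earlier walks have visited.
  The factor \<open>h x\<close> stands for everything that is read after the walk has arrived at \<open>x\<close>. Each step of
  the walk moves one matrix entry into the monomial, and \<open>step_bound\<close> controls the sum over its targets.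
\<close>

lemma walk_bound:
  assumes h: "\<And>x. x \<in> V \<Longrightarrow> bounded_rv M (h x)" and A: "0 \<le> A"
    and fin: "\<And>\<alpha> x. x \<in> V \<Longrightarrow> (\<Sum>e\<in>V \<times> V. visits \<alpha> e) \<le> L \<Longrightarrow>
       cmod (expectation (\<lambda>\<omega>. edge_mono \<alpha> \<omega> * h x \<omega>)) \<le> A * weight (visits \<alpha>) * K ^ excess V (visits \<alpha>)"
    and L: "L \<le> H" and u: "u \<in> V" and len: "(\<Sum>e\<in>V \<times> V. visits \<alpha> e) + r \<le> L"
  shows "cmod (expectation (\<lambda>\<omega>. edge_mono \<alpha> \<omega> * mat_iter V (\<lambda>e. conj_if s (b e \<omega>)) r (\<lambda>x. h x \<omega>) u))
     \<le> A * weight (visits \<alpha>) * growth ^ r * K ^ potential V (visits \<alpha>) u"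
  using u len
proof (induction r arbitrary: u \<alpha>)
  case 0
  have "K ^ excess V (visits \<alpha>) \<le> K ^ potential V (visits \<alpha>) u"
    using K_ge_1 by (intro power_increasing) (auto simp: potential_def)
  then have "A * weight (visits \<alpha>) * K ^ excess V (visits \<alpha>)
     \<le> A * weight (visits \<alpha>) * K ^ potential V (visits \<alpha>) u"
    using A weight_nonneg by (intro mult_left_mono) auto
  then show ?case using fin[of u \<alpha>] 0 by simp
next
  case (Suc r)
  let ?I = "\<lambda>v \<omega>. mat_iter V (\<lambda>e. conj_if s (b e \<omega>)) r (\<lambda>x. h x \<omega>) v"
  let ?\<beta> = "\<lambda>v. \<alpha>(s := add_visit (\<alpha> s) (u, v))"
  have I: "bounded_rv M (?I v)" if "v \<in> V" for v
    using bounded_rv_mat_iter[of V M "\<lambda>e \<omega>. conj_if s (b e \<omega>)" h v r] b_bounded h that by auto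
  have "expectation (\<lambda>\<omega>. edge_mono \<alpha> \<omega> * mat_iter V (\<lambda>e. conj_if s (b e \<omega>)) (Suc r) (\<lambda>x. h x \<omega>) u)
      = expectation (\<lambda>\<omega>. \<Sum>v\<in>V. edge_mono (?\<beta> v) \<omega> * ?I v \<omega>)"
    using Suc.prems(1) finite_V
    by (intro Bochner_Integration.integral_cong)
       (auto simp: sum_distrib_left monomial_add_visit mult.assoc intro!: sum.cong)
  also have "\<dots> = (\<Sum>v\<in>V. expectation (\<lambda>\<omega>. edge_mono (?\<beta> v) \<omega> * ?I v \<omega>))"
    using I by (intro Bochner_Integration.integral_sum bounded_rv_integrable) auto
  also have "cmod \<dots> \<le> (\<Sum>v\<in>V. cmod (expectation (\<lambda>\<omega>. edge_mono (?\<beta> v) \<omega> * ?I v \<omega>)))"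
    by (rule norm_sum)
  also have "\<dots> \<le> (\<Sum>v\<in>V. A * weight (visits (?\<beta> v)) * growth ^ r * K ^ potential V (visits (?\<beta> v)) v)"
  proof (intro sum_mono Suc.IH)
    fix v assume v: "v \<in> V"
    have "(\<Sum>e\<in>V \<times> V. visits (?\<beta> v) e) = Suc (\<Sum>e\<in>V \<times> V. visits \<alpha> e)"
      unfolding visits_add_visit using finite_V Suc.prems(1) v by (intro sum_add_visit) auto
    then show "(\<Sum>e\<in>V \<times> V. visits (?\<beta> v) e) + r \<le> L" using Suc.prems by simp
  qed
  also have "\<dots> = A * growth ^ r * (\<Sum>v\<in>V. weight (add_visit (visits \<alpha>) (u, v))
        * K ^ potential V (add_visit (visits \<alpha>) (u, v)) v)"
    unfolding visits_add_visit sum_distrib_left by (simp add: mult_ac)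
  also have "\<dots> \<le> A * growth ^ r * (weight (visits \<alpha>) * growth * K ^ potential V (visits \<alpha>) u)"
    using A growth_ge_1 Suc.prems L by (intro mult_left_mono step_bound) auto
  finally show ?case by (simp add: mult_ac)
qed

text \<open>
  The even power \<open>\<bar>z\<bar> ^ (2 k)\<close> as a product of factors that are linear in \<open>z\<close> or in its conjugate,
  so that the walks can be read one after the other.
\<close>

fun alternating :: "nat \<Rightarrow> complex \<Rightarrow> complex" where
  "alternating 0 z = 1"
| "alternating (Suc t) z = conj_if (odd t) z * alternating t z"

lemma alternating_even: "alternating (2 * k) z = of_real (cmod z ^ (2 * k))"
proof (induction k)
  case (Suc k)
  have "alternating (2 * Suc k) z = (z * cnj z) * alternating (2 * k) z"
    by (simp add: conj_if_def mult_ac)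
  also have "z * cnj z = of_real (cmod z ^ 2)"
    using complex_norm_square[of z] by simp
  finally have "alternating (2 * Suc k) z = of_real (cmod z ^ 2) * of_real (cmod z ^ (2 * k))"
    unfolding Suc .
  also have "\<dots> = of_real (cmod z ^ (2 * Suc k))"
    unfolding of_real_mult[symmetric] power_add[symmetric] by simp
  finally show ?case .
qed simp

lemma bounded_rv_alternating: "bounded_rv M Y \<Longrightarrow> bounded_rv M (\<lambda>\<omega>. alternating t (Y \<omega>))"
  by (induction t) auto

text \<open>
  The end vectors at the end points of the walks that have already been read.
\<close>

definition end_factors :: "('v \<Rightarrow> 'a \<Rightarrow> complex) \<Rightarrow> (bool \<times> 'v) list \<Rightarrow> 'a \<Rightarrow> complex" where
  "end_factors \<zeta> zs \<omega> = (\<Prod>(s, x)\<leftarrow>zs. conj_if s (\<zeta> x \<omega>))"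

lemma end_factors_Cons: "end_factors \<zeta> ((s, x) # zs) \<omega> = conj_if s (\<zeta> x \<omega>) * end_factors \<zeta> zs \<omega>"
  by (simp add: end_factors_def)

lemma bounded_rv_end_factors:
  assumes "\<And>x. x \<in> V \<Longrightarrow> bounded_rv M (\<zeta> x)" "set zs \<subseteq> UNIV \<times> V"
  shows "bounded_rv M (end_factors \<zeta> zs)"
  using assms(2)
proof (induction zs)
  case (Cons z zs)
  obtain s x where z: "z = (s, x)" by (cases z)
  show ?case unfolding z end_factors_Cons
    using Cons z assms(1) by (intro bounded_rv_mult bounded_rv_conj_if) auto
qed (simp add: end_factors_def[abs_def])

text \<open>
  A walk that restarts at \<open>q\<close> stands at a vertex that may have been left before, which costs \<open>K\<^sup>2\<close>; otherwise
  the potential does not notice where one walk ends and the next one begins. The sum runs over all tuples of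
  walks with arbitrary end points; their total weight is already small enough.
\<close>

lemma moment_bound:
  assumes \<zeta>: "\<And>x. x \<in> V \<Longrightarrow> bounded_rv M (\<zeta> x)" and Y: "bounded_rv M Y"
    and A: "0 \<le> A" and q: "q \<in> V" and H: "T * l \<le> H" and T: "T = 2 * k"
    and base: "\<And>\<alpha> zs. length zs = T \<Longrightarrow> set zs \<subseteq> UNIV \<times> V \<Longrightarrow>
       cmod (expectation (\<lambda>\<omega>. edge_mono \<alpha> \<omega> * end_factors \<zeta> zs \<omega> * Y \<omega>)) \<le> A * weight (visits \<alpha>)"
  shows "cmod (expectation (\<lambda>\<omega>. Y \<omega> *
           of_real (cmod (mat_iter V (\<lambda>e. b e \<omega>) l (\<lambda>x. \<zeta> x \<omega>) q) ^ T)))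
         \<le> A * (K\<^sup>2 * growth ^ l) ^ T"
proof -
  let ?F = "\<lambda>\<omega>. mat_iter V (\<lambda>e. b e \<omega>) l (\<lambda>x. \<zeta> x \<omega>) q"
  have F: "bounded_rv M ?F"
    using bounded_rv_mat_iter[of V M b \<zeta> q l] b_bounded \<zeta> q by auto
  have claim: "cmod (expectation (\<lambda>\<omega>. edge_mono \<alpha> \<omega> * (end_factors \<zeta> zs \<omega> * Y \<omega> * alternating t (?F \<omega>))))
      \<le> A * (K\<^sup>2 * growth ^ l) ^ t * weight (visits \<alpha>) * K ^ excess V (visits \<alpha>)"
    if "length zs + t = T" "set zs \<subseteq> UNIV \<times> V" "(\<Sum>e\<in>V \<times> V. visits \<alpha> e) + t * l \<le> H" for \<alpha> zs t
    using that
  proof (induction t arbitrary: \<alpha> zs)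
    case 0
    have "1 \<le> K ^ excess V (visits \<alpha>)" using K_ge_1 by simp
    then have "A * weight (visits \<alpha>) * 1 \<le> A * weight (visits \<alpha>) * K ^ excess V (visits \<alpha>)"
      using A weight_nonneg by (intro mult_left_mono) auto
    then show ?case using base[of zs \<alpha>] 0 by (simp add: mult.assoc)
  next
    case (Suc t)
    let ?s = "odd t"
    let ?h = "\<lambda>x \<omega>. end_factors \<zeta> ((?s, x) # zs) \<omega> * Y \<omega> * alternating t (?F \<omega>)"
    let ?W = "\<lambda>\<omega>. end_factors \<zeta> zs \<omega> * Y \<omega> * alternating t (?F \<omega>)"
    have lin: "mat_iter V B r (\<lambda>x. g x * y) v = mat_iter V B r g v * y" for B r g y v
      by (induction r arbitrary: v) (simp_all add: sum_distrib_right mult.assoc)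
    have eq: "end_factors \<zeta> zs \<omega> * Y \<omega> * alternating (Suc t) (?F \<omega>)
        = mat_iter V (\<lambda>e. conj_if ?s (b e \<omega>)) l (\<lambda>x. ?h x \<omega>) q" for \<omega>
    proof -
      have "mat_iter V (\<lambda>e. conj_if ?s (b e \<omega>)) l (\<lambda>x. ?h x \<omega>) q
         = mat_iter V (\<lambda>e. conj_if ?s (b e \<omega>)) l (\<lambda>x. conj_if ?s (\<zeta> x \<omega>) * ?W \<omega>) q"
        by (simp add: end_factors_Cons mult.assoc)
      also have "\<dots> = conj_if ?s (?F \<omega>) * ?W \<omega>"
        by (simp only: lin conj_if_mat_iter)
      finally show ?thesis by (simp add: mult_ac)
    qed
    have "cmod (expectation (\<lambda>\<omega>. edge_mono \<alpha> \<omega> * mat_iter V (\<lambda>e. conj_if ?s (b e \<omega>)) l (\<lambda>x. ?h x \<omega>) q))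
      \<le> A * (K\<^sup>2 * growth ^ l) ^ t * weight (visits \<alpha>) * growth ^ l * K ^ potential V (visits \<alpha>) q"
    proof (rule walk_bound[where L = "(\<Sum>e\<in>V \<times> V. visits \<alpha> e) + l"])
      show "bounded_rv M (?h x)" if "x \<in> V" for x
        using that Suc.prems \<zeta> Y F
        by (intro bounded_rv_mult bounded_rv_end_factors bounded_rv_alternating) auto
      show "0 \<le> A * (K\<^sup>2 * growth ^ l) ^ t" using A growth_ge_1 by simp
      show "cmod (expectation (\<lambda>\<omega>. edge_mono \<beta> \<omega> * ?h x \<omega>))
         \<le> A * (K\<^sup>2 * growth ^ l) ^ t * weight (visits \<beta>) * K ^ excess V (visits \<beta>)"
        if "x \<in> V" "(\<Sum>e\<in>V \<times> V. visits \<beta> e) \<le> (\<Sum>e\<in>V \<times> V. visits \<alpha> e) + l" for \<beta> x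
        using Suc.prems that by (intro Suc.IH) auto
    qed (use Suc.prems q in auto)
    also have "\<dots> \<le> A * (K\<^sup>2 * growth ^ l) ^ t * weight (visits \<alpha>) * growth ^ l * K ^ (excess V (visits \<alpha>) + 2)"
      using A growth_ge_1 K_ge_1 weight_nonneg[of "visits \<alpha>"]
      by (intro mult_left_mono power_increasing mult_nonneg_nonneg) (auto simp: potential_def)
    also have "\<dots> = A * (K\<^sup>2 * growth ^ l) ^ Suc t * weight (visits \<alpha>) * K ^ excess V (visits \<alpha>)"
      by (simp add: power_add algebra_simps power2_eq_square)
    finally show ?case unfolding eq .
  qed
  have v0: "visits (\<lambda>_ _. 0) = (\<lambda>_. 0)" by (simp add: visits_def fun_eq_iff)
  have w0: "weight (\<lambda>_. 0) = 1" by (simp add: weight_def visit_weight_def)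
  have e0: "excess V (\<lambda>_. 0) = 0" by (simp add: excess_def open_out_def)
  have m0: "edge_mono (\<lambda>_ _. 0) \<omega> = 1" for \<omega> by (simp add: monomial_def)
  show ?thesis
    using claim[of "[]" T "\<lambda>_ _. 0"] H alternating_even[of k]
    by (simp add: v0 w0 e0 m0 end_factors_def T)
qed

end

section \<open>Large eigenvalues of a perturbed matrix\<close>

lemma mat_iter_cong:
  assumes "\<And>x. x \<in> V \<Longrightarrow> h x = h' x" "u \<in> V"
  shows "mat_iter V B r h u = mat_iter V B r h' u"
  using assms(2) by (induction r arbitrary: u) (simp_all add: assms(1))

lemma mat_iter_add: "mat_iter V B r (\<lambda>x. g x + h x) u = mat_iter V B r g u + mat_iter V B r h u"
  by (induction r arbitrary: u) (simp_all add: distrib_left sum.distrib)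

lemma mat_iter_scale: "mat_iter V B r (\<lambda>x. z * h x) u = z * mat_iter V B r h u"
  by (induction r arbitrary: u) (simp_all add: sum_distrib_left mult_ac)

lemma mat_iter_sum: "mat_iter V B r (\<lambda>x. \<Sum>i\<in>I. g i x) u = (\<Sum>i\<in>I. mat_iter V B r (g i) u)"
proof (induction I rule: infinite_finite_induct)
  have "mat_iter V B r (\<lambda>x. 0 * 0) u = 0" by (subst mat_iter_scale) simp
  then show "mat_iter V B r (\<lambda>x. \<Sum>i\<in>{}. g i x) u = (\<Sum>i\<in>{}. mat_iter V B r (g i) u)" by simp
  fix A :: "'b set" assume "infinite A"
  then show "mat_iter V B r (\<lambda>x. \<Sum>i\<in>A. g i x) u = (\<Sum>i\<in>A. mat_iter V B r (g i) u)"
    using \<open>mat_iter V B r (\<lambda>x. 0 * 0) u = 0\<close> by simp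
qed (simp add: mat_iter_add)

lemma mat_iter_Suc_right: "mat_iter V B (Suc r) h u = mat_iter V B r (\<lambda>x. \<Sum>v\<in>V. B (x, v) * h v) u"
  by (induction r arbitrary: u) simp_all

abbreviation unit_at :: "'v \<Rightarrow> 'v \<Rightarrow> complex" where
  "unit_at x \<equiv> (\<lambda>y. of_bool (y = x))"

lemma mat_iter_expand:
  assumes "finite V" "u \<in> V"
  shows "mat_iter V B r h u = (\<Sum>x\<in>V. h x * mat_iter V B r (unit_at x) u)"
proof -
  have "mat_iter V B r h u = mat_iter V B r (\<lambda>y. \<Sum>x\<in>V. h x * unit_at x y) u"
    using assms by (intro mat_iter_cong) (simp_all add: of_bool_def if_distrib[of "(*) _"] cong: if_cong)
  then show ?thesis by (simp add: mat_iter_sum mat_iter_scale)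
qed

definition del_col :: "'v \<Rightarrow> ('v \<times> 'v \<Rightarrow> complex) \<Rightarrow> 'v \<times> 'v \<Rightarrow> complex" where
  "del_col y B e = (if snd e = y then 0 else B e)"

text \<open>
  The sum over the walks from \<open>q\<close> that enter \<open>y\<close> exactly once, with their last step. It is linear in the column
  of \<open>y\<close>, and its coefficients do not depend on that column.
\<close>

definition first_passage :: "'v set \<Rightarrow> ('v \<times> 'v \<Rightarrow> complex) \<Rightarrow> nat \<Rightarrow> 'v \<Rightarrow> 'v \<Rightarrow> complex" where
  "first_passage V B j q y = mat_iter V (del_col y B) j (\<lambda>x. B (x, y)) q"

text \<open>
  Decomposition of the walks according to their first step into \<open>y\<close>.
\<close>

lemma mat_iter_first_passage_gen:
  assumes "finite V" "y \<in> V" "q \<in> V"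
  shows "mat_iter V B l h q = mat_iter V (del_col y B) l h q
     + (\<Sum>j<l. first_passage V B j q y * mat_iter V B (l - 1 - j) h y)"
  using assms(3)
proof (induction l arbitrary: q)
  case (Suc l)
  let ?I = "\<lambda>r v. mat_iter V B r h v" and ?C = "\<lambda>v. mat_iter V (del_col y B) l h v"
  let ?G = "\<lambda>j v. first_passage V B j v y"
  have "?I (Suc l) q = (\<Sum>v\<in>V. del_col y B (q, v) * ?I l v + (if v = y then B (q, y) * ?I l y else 0))"
    unfolding mat_iter.simps by (rule sum.cong) (simp_all add: del_col_def)
  also have "\<dots> = (\<Sum>v\<in>V. del_col y B (q, v) * ?I l v) + B (q, y) * ?I l y"
    using assms by (simp add: sum.distrib)
  also have "(\<Sum>v\<in>V. del_col y B (q, v) * ?I l v)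
      = (\<Sum>v\<in>V. del_col y B (q, v) * ?C v) + (\<Sum>v\<in>V. \<Sum>j<l. del_col y B (q, v) * ?G j v * ?I (l - 1 - j) y)"
    unfolding sum.distrib[symmetric]
    by (intro sum.cong refl, subst Suc.IH, assumption) (simp add: distrib_left sum_distrib_left mult.assoc)
  also have "(\<Sum>v\<in>V. del_col y B (q, v) * ?C v) = mat_iter V (del_col y B) (Suc l) h q" by simp
  also have "(\<Sum>v\<in>V. \<Sum>j<l. del_col y B (q, v) * ?G j v * ?I (l - 1 - j) y)
      = (\<Sum>j<l. ?G (Suc j) q * ?I (l - 1 - j) y)"
    by (subst sum.swap) (simp add: first_passage_def sum_distrib_right)
  also have "mat_iter V (del_col y B) (Suc l) h q + \<dots> + B (q, y) * ?I l y
      = mat_iter V (del_col y B) (Suc l) h q + (\<Sum>j<Suc l. ?G j q * ?I (Suc l - 1 - j) y)"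
    by (subst sum.lessThan_Suc_shift) (simp add: first_passage_def)
  finally show ?case .
qed simp

lemma mat_iter_first_passage:
  assumes "finite V" "y \<in> V" "q \<in> V" "l \<ge> 1"
  shows "mat_iter V B l (unit_at y) q
     = (\<Sum>j<l. first_passage V B j q y * mat_iter V B (l - 1 - j) (unit_at y) y)"
proof -
  obtain r where r: "l = Suc r" using assms(4) by (cases l) auto
  have "(\<Sum>v\<in>V. del_col y B (x, v) * unit_at y v) = 0" for x
    by (intro sum.neutral) (auto simp: del_col_def)
  moreover have "mat_iter V (del_col y B) r (\<lambda>_. 0) q = 0"
    using mat_iter_sum[of V _ r _ "{}"] by simp
  ultimately have "mat_iter V (del_col y B) l (unit_at y) q = 0"
    unfolding r mat_iter_Suc_right by simp
  then show ?thesis by (subst mat_iter_first_passage_gen[OF assms(1-3)]) simp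
qed

lemma eigenvector_iterated:
  assumes eig: "\<And>u. u \<in> V \<Longrightarrow> x u = \<mu> * ((\<Sum>v\<in>V. B (u, v) * x v) + w u)" and "u \<in> V"
  shows "x u = \<mu> ^ l * mat_iter V B l x u + (\<Sum>i<l. \<mu> ^ Suc i * mat_iter V B i w u)"
proof (induction l)
  case (Suc l)
  have "mat_iter V B l x u = mat_iter V B l (\<lambda>u. \<mu> * ((\<Sum>v\<in>V. B (u, v) * x v) + w u)) u"
    by (rule mat_iter_cong) (rule eig, assumption, rule assms(2))
  also have "\<dots> = \<mu> * (mat_iter V B (Suc l) x u + mat_iter V B l w u)"
    unfolding mat_iter_scale mat_iter_add mat_iter_Suc_right ..
  finally show ?case using Suc by (simp add: algebra_simps)
qed simp

text \<open>
  The edges of \<open>E\<close> are the large entries \<open>s\<close>, and \<open>w = s x\<close> is supported on their starting points. By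
  \<open>eigenvector_iterated\<close>, \<open>w p\<close> is \<open>(s w) p / z\<close> plus terms \<open>s (p, q) (b ^ i w) q\<close> with \<open>1 \<le> i < k\<close> and a
  remainder of order \<open>1 / \<bar>z\<bar> ^ k\<close>. The middle terms only see \<open>b ^ i\<close> from the end of one large entry to the
  start of another one, where \<open>F1\<close> and \<open>F2\<close> make it small. In \<open>(s w) p\<close> the formula is inserted once
  more; the product of three large entries that would then appear vanishes by \<open>no3\<close>. In the maximum
  norm this gives \<open>W \<le> W / 2 + (remainder)\<close>, while \<open>XW\<close> shows that the remainder is negligible against \<open>W\<close>.
\<close>

lemma no_large_eigenvalue:
  fixes V :: "'v set" and a b :: "'v \<times> 'v \<Rightarrow> complex" and k :: nat and L R \<Sigma> t :: real
  defines "s \<equiv> \<lambda>e. a e - b e"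
  defines "E \<equiv> {e \<in> V \<times> V. s e \<noteq> 0}"
  assumes V: "finite V"
    and R: "\<And>q y l. q \<in> V \<Longrightarrow> y \<in> V \<Longrightarrow> l \<le> k \<Longrightarrow> cmod (mat_iter V b l (unit_at y) q) \<le> R"
    and \<Sigma>: "\<And>e. e \<in> E \<Longrightarrow> cmod (s e) \<le> \<Sigma>" "0 \<le> \<Sigma>"
    and L: "real (card E) \<le> L"
    and no3: "\<And>u v x y. (u, v) \<in> E \<Longrightarrow> (v, x) \<in> E \<Longrightarrow> (x, y) \<in> E \<Longrightarrow> False"
    and F1: "\<And>p q y x j. (p, q) \<in> E \<Longrightarrow> (y, x) \<in> E \<Longrightarrow> j < k \<Longrightarrow>
               cmod (s (p, q)) * cmod (first_passage V b j q y) \<le> t"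
    and F2: "\<And>o' p q y x j. (o', p) \<in> E \<Longrightarrow> (p, q) \<in> E \<Longrightarrow> (y, x) \<in> E \<Longrightarrow> j < k \<Longrightarrow>
               cmod (s (o', p)) * cmod (s (p, q)) * cmod (first_passage V b j q y) \<le> t"
    and t: "0 \<le> t"
    and lam: "1 \<le> cmod z"
    and N1: "2 * real (card V) * R \<le> cmod z ^ k"
    and N2: "2 * (1 + L) * (L\<^sup>2 * (real k)\<^sup>2 * t * R) \<le> 1"
    and N3: "4 * real k * L * R * (1 + L) * (1 + \<Sigma>) * (L * \<Sigma> * real (card V) * R) < cmod z ^ k"
    and eig: "\<And>u. u \<in> V \<Longrightarrow> (\<Sum>v\<in>V. a (u, v) * x v) = z * x u"
    and nz: "u\<^sub>0 \<in> V" "x u\<^sub>0 \<noteq> 0"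
  shows False
proof -
  define N where "N = real (card V)"
  define \<mu> where "\<mu> = 1 / z"
  define w where "w p = (\<Sum>v\<in>V. s (p, v) * x v)" for p
  define T where "T = fst ` E"
  define X where "X = Max ((\<lambda>u. cmod (x u)) ` V)"
  define W where "W = Max ((\<lambda>u. cmod (w u)) ` V)"
  have Vne: "V \<noteq> {}" using nz by auto
  have \<mu>: "cmod \<mu> \<le> 1" "\<mu> * z = 1" using lam by (auto simp: \<mu>_def norm_divide divide_le_eq_1)
  have \<mu>i: "cmod (\<mu> ^ i) \<le> 1" for i using \<mu> by (simp add: norm_power power_le_one)
  have \<mu>step: "cmod (\<mu> ^ Suc i * y) \<le> cmod y" for i y
    using mult_right_mono[OF \<mu>i[of "Suc i"] norm_ge_zero[of y]] by (simp only: norm_mult mult_1)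
  have finE: "finite E" using V by (auto simp: E_def)
  have finT: "finite T" and TV: "T \<subseteq> V" using finE by (auto simp: T_def E_def)
  have cT: "real (card T) \<le> L" using card_image_le[OF finE, of fst] L by (simp add: T_def)
  have L0: "0 \<le> L" using L by linarith
  have cQ: "real (card {q \<in> V. (p, q) \<in> E}) \<le> L" for p
  proof -
    have "card {q \<in> V. (p, q) \<in> E} = card (Pair p ` {q \<in> V. (p, q) \<in> E})"
      by (intro card_image[symmetric]) (auto simp: inj_on_def)
    also have "\<dots> \<le> card E" using finE by (intro card_mono) auto
    finally show ?thesis using L by simp
  qed
  have wT: "w p = 0" if "p \<in> V" "p \<notin> T" for p
    unfolding w_def
  proof (rule sum.neutral, rule ballI)
    fix v assume "v \<in> V"
    then have "(p, v) \<notin> E" using that(2) by (auto simp: T_def image_iff)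
    then show "s (p, v) * x v = 0" using \<open>v \<in> V\<close> that(1) by (simp add: E_def)
  qed
  have xX: "cmod (x u) \<le> X" if "u \<in> V" for u using that V by (auto simp: X_def)
  have wW: "cmod (w u) \<le> W" if "u \<in> V" for u using that V by (auto simp: W_def)
  have X0: "0 < X" using xX[OF nz(1)] nz(2) by (meson less_le_trans zero_less_norm_iff)
  have W0: "0 \<le> W" using wW[OF nz(1)] norm_ge_zero order_trans by blast
  have R0: "0 \<le> R" using R[OF nz(1) nz(1), of 0] norm_ge_zero order_trans by blast
  have xeq: "x u = \<mu> * ((\<Sum>v\<in>V. b (u, v) * x v) + w u)" if "u \<in> V" for u
  proof -
    have "(\<Sum>v\<in>V. b (u, v) * x v) + w u = z * x u"
      unfolding w_def sum.distrib[symmetric] eig[OF that, symmetric] by (intro sum.cong) (auto simp: s_def algebra_simps)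
    then show ?thesis using \<mu>(2) by (simp add: mult.assoc[symmetric])
  qed
  note xiter = eigenvector_iterated[where V = V and B = b, OF xeq]
  have kx: "cmod (mat_iter V b k x u) \<le> N * R * X" if u: "u \<in> V" for u
  proof -
    have "cmod (mat_iter V b k x u) = cmod (\<Sum>y\<in>V. x y * mat_iter V b k (unit_at y) u)"
      using mat_iter_expand[OF V u] by metis
    also have "\<dots> \<le> (\<Sum>y\<in>V. X * R)"
      using u X0 R xX by (intro sum_norm_le) (auto simp: norm_mult intro!: mult_mono)
    finally show ?thesis by (simp add: N_def mult_ac)
  qed
  have iw_eq: "mat_iter V b i w u = (\<Sum>y\<in>T. w y * mat_iter V b i (unit_at y) u)" if u: "u \<in> V" for i u
    unfolding mat_iter_expand[OF V u, of b i w] using V TV wT by (intro sum.mono_neutral_right) auto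
  have iw: "cmod (mat_iter V b i w u) \<le> L * R * W" if u: "u \<in> V" and i: "i \<le> k" for i u
  proof -
    have "cmod (mat_iter V b i w u) \<le> (\<Sum>y\<in>T. W * R)"
      unfolding iw_eq[OF u] using u i W0 R wW TV by (intro sum_norm_le) (auto simp: norm_mult intro!: mult_mono)
    also have "\<dots> = real (card T) * (W * R)" by simp
    also have "\<dots> \<le> L * (W * R)" using cT W0 R0 by (intro mult_right_mono) auto
    finally show ?thesis by (simp add: mult_ac)
  qed
  define \<nu> where "\<nu> = cmod \<mu> ^ k"
  have \<nu>: "0 < \<nu>" "\<nu> * cmod z ^ k = 1"
  proof -
    have "0 < cmod z" using lam by linarith
    then show "0 < \<nu>" "\<nu> * cmod z ^ k = 1"
      by (simp_all add: \<nu>_def \<mu>_def norm_divide power_divide)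
  qed
  have XW: "X \<le> 2 * (real k * L * R * W)"
  proof -
    have "X \<in> (\<lambda>u. cmod (x u)) ` V" using V Vne by (auto simp: X_def intro!: Max_in)
    then obtain u where u: "u \<in> V" "X = cmod (x u)" by auto
    have "X \<le> cmod (\<mu> ^ k * mat_iter V b k x u) + cmod (\<Sum>i<k. \<mu> ^ Suc i * mat_iter V b i w u)"
      unfolding u(2) by (subst xiter[OF _ u(1), of k]) (auto intro: norm_triangle_ineq)
    also have "cmod (\<mu> ^ k * mat_iter V b k x u) \<le> \<nu> * (N * R * X)"
      using kx[OF u(1)] \<nu> by (auto simp: norm_mult norm_power \<nu>_def intro!: mult_left_mono)
    also have "\<nu> * (N * R * X) \<le> X / 2"
    proof -
      have "\<nu> * (2 * N * R) \<le> \<nu> * cmod z ^ k" using N1 \<nu> by (intro mult_left_mono) (auto simp: N_def)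
      then have "\<nu> * (2 * N * R) * X \<le> 1 * X" using \<nu> X0 by (intro mult_right_mono) auto
      then show ?thesis by (simp add: mult_ac)
    qed
    also have "cmod (\<Sum>i<k. \<mu> ^ Suc i * mat_iter V b i w u) \<le> (\<Sum>i<k. 1 * (L * R * W))"
    proof (rule sum_norm_le)
      fix i assume "i \<in> {..<k}"
      then show "cmod (\<mu> ^ Suc i * mat_iter V b i w u) \<le> 1 * (L * R * W)"
        unfolding mult_1 by (intro order_trans[OF \<mu>step iw[OF u(1)]]) simp
    qed
    finally show ?thesis by (simp add: algebra_simps)
  qed
  define e where "e p = w p - \<mu> * (\<Sum>q\<in>V. s (p, q) * w q)" for p
  define \<theta> where "\<theta> = L * \<Sigma> * N * R * \<nu>"
  define \<kappa> where "\<kappa> = L\<^sup>2 * (real k)\<^sup>2 * t * R"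
  have \<theta>0: "0 \<le> \<theta>" using L0 \<Sigma> R0 \<nu> by (auto simp: \<theta>_def N_def)
  \<comment> \<open>The weight \<open>c\<close> is 1, or the modulus of a large entry that leads to \<open>p\<close>.\<close>
  have ebound: "c * cmod (e p) \<le> C * \<theta> * X + \<kappa> * W"
    if p: "p \<in> V" and c: "0 \<le> c" "c \<le> C"
      and cF: "\<And>q y j. (p, q) \<in> E \<Longrightarrow> y \<in> T \<Longrightarrow> j < k \<Longrightarrow> c * cmod (s (p, q)) * cmod (first_passage V b j q y) \<le> t"
    for c C p
  proof -
    let ?Q = "{q \<in> V. (p, q) \<in> E}"
    let ?r = "\<lambda>q. \<mu> ^ k * mat_iter V b k x q"
    let ?d = "\<lambda>q. \<Sum>i\<in>{1..<k}. \<mu> ^ Suc i * mat_iter V b i w q"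
    have k0: "k \<noteq> 0"
    proof
      assume "k = 0"
      with XW X0 show False by simp
    qed
    have xq: "x q = ?r q + \<mu> * w q + ?d q" if "q \<in> V" for q
    proof -
      have "{..<k} = insert 0 {1..<k}" using k0 by auto
      then have "(\<Sum>i<k. \<mu> ^ Suc i * mat_iter V b i w q) = \<mu> * w q + ?d q" by simp
      then show ?thesis using xiter[OF _ that, of k] by (simp add: add.assoc)
    qed
    have "e p = (\<Sum>q\<in>V. s (p, q) * (x q - \<mu> * w q))"
      by (simp add: e_def w_def[of p] sum_distrib_left right_diff_distrib sum_subtractf mult_ac)
    also have "\<dots> = (\<Sum>q\<in>V. s (p, q) * (?r q + ?d q))"
      using xq by (intro sum.cong) auto
    also have "\<dots> = (\<Sum>q\<in>?Q. s (p, q) * (?r q + ?d q))"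
      using V p by (intro sum.mono_neutral_right) (auto simp: E_def)
    finally have "c * cmod (e p) \<le> c * (\<Sum>q\<in>?Q. cmod (s (p, q) * (?r q + ?d q)))"
      using c by (simp only:) (intro mult_left_mono norm_sum)
    also have "\<dots> \<le> (\<Sum>q\<in>?Q. C * (\<Sigma> * (\<nu> * (N * R * X))) + real k * (L * (real k * (t * R) * W)))"
      unfolding sum_distrib_left
    proof (rule sum_mono)
      fix q assume q: "q \<in> ?Q"
      then have qV: "q \<in> V" and qE: "(p, q) \<in> E" by auto
      have 1: "c * (cmod (s (p, q)) * cmod (?r q)) \<le> C * (\<Sigma> * (\<nu> * (N * R * X)))"
      proof -
        have "cmod (?r q) \<le> \<nu> * (N * R * X)"
          using kx[OF qV] \<nu> by (auto simp: norm_mult norm_power \<nu>_def intro!: mult_left_mono)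
        then have "cmod (s (p, q)) * cmod (?r q) \<le> \<Sigma> * (\<nu> * (N * R * X))"
          using \<Sigma>(1)[OF qE] \<Sigma>(2) by (intro mult_mono) auto
        then show ?thesis by (rule mult_mono[OF c(2)]) (use c in auto)
      qed
      have 2: "c * cmod (s (p, q)) * cmod (mat_iter V b i w q) \<le> L * (real k * (t * R) * W)"
        if i: "i \<in> {1..<k}" for i
      proof -
        have fp: "c * cmod (s (p, q)) * cmod (mat_iter V b i (unit_at y) q) \<le> real k * (t * R)" if y: "y \<in> T" for y
        proof -
          have yV: "y \<in> V" using y TV by auto
          have "c * cmod (s (p, q)) * cmod (mat_iter V b i (unit_at y) q)
              = c * cmod (s (p, q)) * cmod (\<Sum>j<i. first_passage V b j q y * mat_iter V b (i - 1 - j) (unit_at y) y)"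
            using mat_iter_first_passage[OF V yV qV, of i b] i by simp
          also have "\<dots> \<le> c * cmod (s (p, q)) * (\<Sum>j<i. cmod (first_passage V b j q y) * R)"
            using c i yV R by (intro mult_left_mono sum_norm_le) (auto simp: norm_mult intro!: mult_left_mono)
          also have "\<dots> = (\<Sum>j<i. c * cmod (s (p, q)) * cmod (first_passage V b j q y) * R)"
            by (simp add: sum_distrib_left mult_ac)
          also have "\<dots> \<le> (\<Sum>j<i. t * R)"
            using cF[OF qE y] i R0 by (intro sum_mono mult_right_mono) auto
          also have "\<dots> \<le> real k * (t * R)" using i t R0 by (auto intro!: mult_right_mono)
          finally show ?thesis .
        qed
        have "c * cmod (s (p, q)) * cmod (mat_iter V b i w q)
            \<le> c * cmod (s (p, q)) * (\<Sum>y\<in>T. cmod (w y) * cmod (mat_iter V b i (unit_at y) q))"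
          unfolding iw_eq[OF qV] using c by (intro mult_left_mono sum_norm_le) (auto simp: norm_mult)
        also have "\<dots> = (\<Sum>y\<in>T. c * cmod (s (p, q)) * cmod (mat_iter V b i (unit_at y) q) * cmod (w y))"
          by (simp add: sum_distrib_left mult_ac)
        also have "\<dots> \<le> (\<Sum>y\<in>T. real k * (t * R) * W)"
        proof (rule sum_mono)
          fix y assume y: "y \<in> T"
          then have "cmod (w y) \<le> W" using wW TV by auto
          then show "c * cmod (s (p, q)) * cmod (mat_iter V b i (unit_at y) q) * cmod (w y)
              \<le> real k * (t * R) * W"
            by (rule mult_mono[OF fp[OF y]]) (use t R0 in auto)
        qed
        also have "\<dots> = real (card T) * (real k * (t * R) * W)" by simp
        also have "\<dots> \<le> L * (real k * (t * R) * W)" using cT t R0 W0 by (intro mult_right_mono) auto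
        finally show ?thesis .
      qed
      have 3: "c * (cmod (s (p, q)) * cmod (?d q)) \<le> real k * (L * (real k * (t * R) * W))"
      proof -
        have "cmod (?d q) \<le> (\<Sum>i\<in>{1..<k}. cmod (mat_iter V b i w q))"
          by (intro sum_norm_le \<mu>step)
        then have "c * (cmod (s (p, q)) * cmod (?d q)) \<le> c * (cmod (s (p, q)) * (\<Sum>i\<in>{1..<k}. cmod (mat_iter V b i w q)))"
          using c by (intro mult_left_mono) auto
        also have "\<dots> = (\<Sum>i\<in>{1..<k}. c * cmod (s (p, q)) * cmod (mat_iter V b i w q))"
          by (simp add: sum_distrib_left mult_ac)
        also have "\<dots> \<le> (\<Sum>i\<in>{1..<k}. L * (real k * (t * R) * W))" using 2 by (intro sum_mono)
        also have "\<dots> \<le> real k * (L * (real k * (t * R) * W))"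
          using L0 t R0 W0 by (auto intro!: mult_right_mono)
        finally show ?thesis .
      qed
      have "c * cmod (s (p, q) * (?r q + ?d q)) \<le> c * (cmod (s (p, q)) * (cmod (?r q) + cmod (?d q)))"
        unfolding norm_mult[of "s (p, q)"] using c by (intro mult_left_mono norm_triangle_ineq) auto
      also have "\<dots> \<le> C * (\<Sigma> * (\<nu> * (N * R * X))) + real k * (L * (real k * (t * R) * W))"
        using 1 3 by (simp add: distrib_left)
      finally show "c * cmod (s (p, q) * (?r q + ?d q)) \<le> \<dots>" .
    qed
    also have "\<dots> = real (card ?Q) * (C * (\<Sigma> * (\<nu> * (N * R * X))) + real k * (L * (real k * (t * R) * W)))"
      by simp
    also have "\<dots> \<le> L * (C * (\<Sigma> * (\<nu> * (N * R * X))) + real k * (L * (real k * (t * R) * W)))"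
      using cQ[of p] c \<Sigma> \<nu> R0 X0 L0 t W0 by (intro mult_right_mono) (auto simp: N_def)
    also have "\<dots> = C * \<theta> * X + \<kappa> * W"
      by (simp add: \<theta>_def \<kappa>_def algebra_simps power2_eq_square)
    finally show ?thesis .
  qed
  have e1: "cmod (e p) \<le> \<theta> * X + \<kappa> * W" if "p \<in> V" for p
  proof -
    have "1 * cmod (e p) \<le> 1 * \<theta> * X + \<kappa> * W"
    proof (rule ebound[OF that])
      fix q y j assume "(p, q) \<in> E" "y \<in> T" "j < k"
      then show "1 * cmod (s (p, q)) * cmod (first_passage V b j q y) \<le> t"
        using F1[of p q y _ j] by (auto simp: T_def)
    qed auto
    then show ?thesis by simp
  qed
  have e2: "cmod (s (o', p)) * cmod (e p) \<le> \<Sigma> * \<theta> * X + \<kappa> * W" if op: "(o', p) \<in> E" for o' p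
  proof (rule ebound)
    show "p \<in> V" using op by (auto simp: E_def)
    show "cmod (s (o', p)) \<le> \<Sigma>" using \<Sigma>(1)[OF op] .
    fix q y j assume "(p, q) \<in> E" "y \<in> T" "j < k"
    then show "cmod (s (o', p)) * cmod (s (p, q)) * cmod (first_passage V b j q y) \<le> t"
      using F2[OF op, of q y _ j] by (auto simp: T_def)
  qed auto
  \<comment> \<open>After a large entry at most one more can follow, so that \<open>s w\<close> vanishes at its end.\<close>
  have head: "w q = e q" if "(p, q) \<in> E" for p q
  proof -
    have "(\<Sum>y\<in>V. s (q, y) * w y) = 0"
    proof (rule sum.neutral, rule ballI)
      fix y assume y: "y \<in> V"
      show "s (q, y) * w y = 0"
      proof (cases "(q, y) \<in> E")
        case True
        have "y \<notin> T"
        proof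
          assume "y \<in> T"
          then obtain y2 where "(y, y2) \<in> E" by (auto simp: T_def)
          with no3 that True show False by blast
        qed
        then show ?thesis using wT[OF y] by simp
      next
        case False
        then show ?thesis using that y by (auto simp: E_def)
      qed
    qed
    then show ?thesis by (simp add: e_def)
  qed
  have wp: "cmod (w p) \<le> (1 + L) * (1 + \<Sigma>) * \<theta> * X + (1 + L) * \<kappa> * W" if p: "p \<in> V" for p
  proof -
    let ?Q = "{q \<in> V. (p, q) \<in> E}"
    have "w p = e p + \<mu> * (\<Sum>q\<in>V. s (p, q) * w q)" by (simp add: e_def)
    also have "(\<Sum>q\<in>V. s (p, q) * w q) = (\<Sum>q\<in>?Q. s (p, q) * e q)"
      using V p head by (intro sum.mono_neutral_cong_right) (auto simp: E_def)
    finally have "cmod (w p) \<le> cmod (e p) + cmod \<mu> * cmod (\<Sum>q\<in>?Q. s (p, q) * e q)"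
      by (simp only: norm_mult[symmetric] norm_triangle_ineq)
    also have "cmod \<mu> * cmod (\<Sum>q\<in>?Q. s (p, q) * e q) \<le> 1 * (\<Sum>q\<in>?Q. \<Sigma> * \<theta> * X + \<kappa> * W)"
      using \<mu> e2 by (intro mult_mono sum_norm_le) (auto simp: norm_mult)
    also have "\<dots> = real (card ?Q) * (\<Sigma> * \<theta> * X + \<kappa> * W)" by simp
    also have "\<dots> \<le> L * (\<Sigma> * \<theta> * X + \<kappa> * W)"
      using cQ[of p] \<Sigma> \<theta>0 X0 W0 t R0 by (intro mult_right_mono) (auto simp: \<kappa>_def)
    finally have "cmod (w p) \<le> (\<theta> * X + \<kappa> * W) + L * (\<Sigma> * \<theta> * X + \<kappa> * W)" using e1[OF p] by simp
    also have "\<dots> \<le> (1 + L) * (1 + \<Sigma>) * \<theta> * X + (1 + L) * \<kappa> * W"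
      using L0 \<Sigma> \<theta>0 X0 by (simp add: algebra_simps)
    finally show ?thesis .
  qed
  have "W \<in> (\<lambda>u. cmod (w u)) ` V" using V Vne by (auto simp: W_def intro!: Max_in)
  then have "W \<le> (1 + L) * (1 + \<Sigma>) * \<theta> * X + (1 + L) * \<kappa> * W" using wp by auto
  moreover have "(1 + L) * \<kappa> * W \<le> (1 / 2) * W"
  proof (rule mult_right_mono[OF _ W0])
    have "2 * ((1 + L) * \<kappa>) \<le> 1" using N2 by (simp only: \<kappa>_def mult.assoc)
    then show "(1 + L) * \<kappa> \<le> 1 / 2" by linarith
  qed
  ultimately have "W \<le> 2 * ((1 + L) * (1 + \<Sigma>) * \<theta>) * X" by linarith
  also have "\<dots> \<le> 2 * ((1 + L) * (1 + \<Sigma>) * \<theta>) * (2 * (real k * L * R * W))"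
    using XW L0 \<Sigma> \<theta>0 by (intro mult_left_mono) auto
  also have "\<dots> = (4 * real k * L * R * (1 + L) * (1 + \<Sigma>) * (L * \<Sigma> * N * R)) * \<nu> * W"
    by (simp add: \<theta>_def algebra_simps)
  finally have WW: "W \<le> (4 * real k * L * R * (1 + L) * (1 + \<Sigma>) * (L * \<Sigma> * N * R)) * \<nu> * W" .
  have Wpos: "0 < W"
  proof (rule ccontr)
    assume "\<not> 0 < W"
    then have "W = 0" using W0 by simp
    with XW X0 show False by simp
  qed
  have "(4 * real k * L * R * (1 + L) * (1 + \<Sigma>) * (L * \<Sigma> * N * R)) * \<nu> < cmod z ^ k * \<nu>"
    using N3 \<nu> by (intro mult_strict_right_mono) (auto simp: N_def)
  then have "(4 * real k * L * R * (1 + L) * (1 + \<Sigma>) * (L * \<Sigma> * N * R)) * \<nu> * W < 1 * W"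
    using \<nu> Wpos by (intro mult_strict_right_mono) (auto simp: mult.commute)
  with WW show False by simp
qed

section \<open>Truncated independent entries\<close>

text \<open>
  The entries of one random matrix. Independence enters only through \<open>factorize\<close>; vanishing entries are
  allowed, and the condition on \<open>\<rho>\<close> expresses that every row has total variance at most 1.
\<close>

locale edge_family = prob_space M
  for M :: "'a measure" +
  fixes V :: "'v set" and a :: "'v \<times> 'v \<Rightarrow> 'a \<Rightarrow> complex" and \<rho> :: "'v \<times> 'v \<Rightarrow> real"
    and r\<^sub>0 D \<tau>\<^sub>0 \<delta> :: real
  assumes finite_V: "finite V"
    and a_measurable: "\<And>e. e \<in> V \<times> V \<Longrightarrow> a e \<in> borel_measurable M"
    and factorize: "\<And>f. (\<And>e. f e \<in> borel_measurable borel) \<Longrightarrow> (\<And>e. \<exists>C. \<forall>z. cmod (f e z) \<le> C) \<Longrightarrow>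
        expectation (\<lambda>\<omega>. \<Prod>e\<in>V \<times> V. f e (a e \<omega>)) = (\<Prod>e\<in>V \<times> V. expectation (\<lambda>\<omega>. f e (a e \<omega>)))"
    and \<rho>_nonneg: "\<And>e. 0 \<le> \<rho> e" and \<rho>_le: "\<And>e. \<rho> e \<le> r\<^sub>0"
    and \<rho>_row: "\<And>u. u \<in> V \<Longrightarrow> (\<Sum>v\<in>V. \<rho> (u, v)) \<le> 1"
    and a_int: "\<And>e. e \<in> V \<times> V \<Longrightarrow> integrable M (a e)"
    and a_int2: "\<And>e. e \<in> V \<times> V \<Longrightarrow> integrable M (\<lambda>\<omega>. cmod (a e \<omega>) ^ 2)"
    and a_int4: "\<And>e. e \<in> V \<times> V \<Longrightarrow> integrable M (\<lambda>\<omega>. cmod (a e \<omega>) ^ 4)"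
    and a_mean: "\<And>e. e \<in> V \<times> V \<Longrightarrow> expectation (a e) = 0"
    and a_second: "\<And>e. e \<in> V \<times> V \<Longrightarrow> expectation (\<lambda>\<omega>. cmod (a e \<omega>) ^ 2) \<le> \<rho> e"
    and a_fourth: "\<And>e. e \<in> V \<times> V \<Longrightarrow> expectation (\<lambda>\<omega>. cmod (a e \<omega>) ^ 4) \<le> D * r\<^sub>0 * \<rho> e"
    and D_ge_1: "1 \<le> D"
    and \<tau>\<^sub>0_pos: "0 < \<tau>\<^sub>0" and \<tau>\<^sub>0_le: "\<tau>\<^sub>0 \<le> \<delta>" and \<delta>_le_1: "\<delta> \<le> 1"
    and small: "D * r\<^sub>0 \<le> \<tau>\<^sub>0 ^ 3"
begin

definition thr :: "'v \<times> 'v \<Rightarrow> real" where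
  "thr e = (if fst e = snd e then \<delta> else \<tau>\<^sub>0)"

definition trunc :: "'v \<times> 'v \<Rightarrow> complex \<Rightarrow> complex" where
  "trunc e z = (if cmod z \<le> thr e then z else 0)"

text \<open>
  The cutoff \<open>S\<close> makes the variable bounded. The maximum with 1 lets a product over a set of large entries
  dominate the product over each of its subsets.
\<close>

definition large :: "real \<Rightarrow> 'v \<times> 'v \<Rightarrow> complex \<Rightarrow> real" where
  "large S e z = (if thr e < cmod z \<and> cmod z \<le> S then max 1 (cmod z) else 0)"

text \<open>
  The entries in \<open>Z\<close> are removed. If they are large, this changes nothing, and it makes the bulk independent
  of them.
\<close>

definition bulk :: "('v \<times> 'v) set \<Rightarrow> 'v \<times> 'v \<Rightarrow> 'a \<Rightarrow> complex" where
  "bulk Z e \<omega> = (if e \<in> Z then 0 else trunc e (a e \<omega>))"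

lemma thr_bounds: "\<tau>\<^sub>0 \<le> thr e" "thr e \<le> 1" "0 < thr e"
  using \<tau>\<^sub>0_pos \<tau>\<^sub>0_le \<delta>_le_1 by (auto simp: thr_def)

lemma r\<^sub>0_nonneg: "0 \<le> r\<^sub>0"
  using \<rho>_nonneg \<rho>_le order_trans by blast

lemma trunc_measurable [measurable]: "trunc e \<in> borel_measurable borel"
  unfolding trunc_def by measurable

lemma large_measurable [measurable]: "large S e \<in> borel_measurable borel"
  unfolding large_def by measurable

lemma cnj_measurable [measurable]: "cnj \<in> borel_measurable borel"
  by (intro borel_measurable_continuous_onI continuous_intros)

lemma cmod_trunc_le: "cmod (trunc e z) \<le> thr e" "cmod (trunc e z) \<le> cmod z" "cmod (trunc e z) \<le> 1"
  using thr_bounds[of e] by (auto simp: trunc_def)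

lemma bulk_bounded_rv: "e \<in> V \<times> V \<Longrightarrow> bounded_rv M (bulk Z e)"
  using a_measurable[of e] cmod_trunc_le(3)
  unfolding bounded_rv_def bulk_def by (auto intro!: exI[of _ 1])

definition mixed_moment :: "'v \<times> 'v \<Rightarrow> nat \<Rightarrow> nat \<Rightarrow> real" where
  "mixed_moment e i j = cmod (expectation (\<lambda>\<omega>. trunc e (a e \<omega>) ^ i * cnj (trunc e (a e \<omega>)) ^ j))"

text \<open>
  Markov's inequality for the fourth moment bounds the probability of a large entry by this number.
\<close>

definition tail_prob :: real where
  "tail_prob = D * r\<^sub>0\<^sup>2 / \<tau>\<^sub>0 ^ 4"

lemma tail_prob_nonneg: "0 \<le> tail_prob"
  using D_ge_1 \<tau>\<^sub>0_pos by (simp add: tail_prob_def)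

lemma a_fourth_le:
  assumes e: "e \<in> V \<times> V"
  shows "expectation (\<lambda>\<omega>. cmod (a e \<omega>) ^ 4) \<le> D * r\<^sub>0\<^sup>2"
proof -
  have "D * r\<^sub>0 * \<rho> e \<le> D * r\<^sub>0 * r\<^sub>0"
    using \<rho>_le[of e] D_ge_1 r\<^sub>0_nonneg by (intro mult_left_mono) auto
  then show ?thesis using a_fourth[OF e] by (simp add: power2_eq_square mult.assoc)
qed

lemma tail_prob_le:
  assumes e: "e \<in> V \<times> V"
  shows "expectation (\<lambda>\<omega>. (large S e (a e \<omega>)) ^ 4) \<le> tail_prob"
    and "prob {\<omega> \<in> space M. thr e < cmod (a e \<omega>)} \<le> tail_prob"
proof -
  note [measurable] = a_measurable[OF e]
  have le: "max 1 (cmod z) ^ 4 \<le> cmod z ^ 4 / \<tau>\<^sub>0 ^ 4" if "thr e < cmod z" for z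
  proof -
    have "\<tau>\<^sub>0 * max 1 (cmod z) \<le> cmod z"
      using that thr_bounds[of e] \<tau>\<^sub>0_pos by (auto simp: max_def intro: mult_left_le_one_le)
    then have "(\<tau>\<^sub>0 * max 1 (cmod z)) ^ 4 \<le> cmod z ^ 4"
      using \<tau>\<^sub>0_pos by (intro power_mono) auto
    then show ?thesis using \<tau>\<^sub>0_pos by (simp add: power_mult_distrib field_simps)
  qed
  have E: "expectation (\<lambda>\<omega>. cmod (a e \<omega>) ^ 4 / \<tau>\<^sub>0 ^ 4) \<le> tail_prob"
  proof -
    show ?thesis using a_fourth_le[OF e] \<tau>\<^sub>0_pos by (simp add: tail_prob_def divide_right_mono)
  qed
  have int: "integrable M (\<lambda>\<omega>. cmod (a e \<omega>) ^ 4 / \<tau>\<^sub>0 ^ 4)" using a_int4[OF e] by simp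
  have "large S e z ^ 4 \<le> cmod z ^ 4 / \<tau>\<^sub>0 ^ 4" for z
    using le[of z] \<tau>\<^sub>0_pos by (auto simp: large_def)
  then have "expectation (\<lambda>\<omega>. (large S e (a e \<omega>)) ^ 4) \<le> expectation (\<lambda>\<omega>. cmod (a e \<omega>) ^ 4 / \<tau>\<^sub>0 ^ 4)"
    using int by (intro integral_mono') (auto simp: \<tau>\<^sub>0_pos less_imp_le)
  with E show "expectation (\<lambda>\<omega>. (large S e (a e \<omega>)) ^ 4) \<le> tail_prob" by linarith
  have "indicator {\<omega> \<in> space M. thr e < cmod (a e \<omega>)} \<omega> \<le> cmod (a e \<omega>) ^ 4 / \<tau>\<^sub>0 ^ 4" for \<omega>
  proof (cases "thr e < cmod (a e \<omega>)")
    case True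
    have "1 \<le> max 1 (cmod (a e \<omega>)) ^ 4" by (intro one_le_power) auto
    also have "\<dots> \<le> cmod (a e \<omega>) ^ 4 / \<tau>\<^sub>0 ^ 4" by (rule le[OF True])
    finally show ?thesis by (auto simp: indicator_def intro: order_trans[of 0 1])
  qed (use \<tau>\<^sub>0_pos in \<open>auto simp: indicator_def\<close>)
  then have "expectation (indicator {\<omega> \<in> space M. thr e < cmod (a e \<omega>)}) \<le> expectation (\<lambda>\<omega>. cmod (a e \<omega>) ^ 4 / \<tau>\<^sub>0 ^ 4)"
    using int by (intro integral_mono') (auto simp: \<tau>\<^sub>0_pos less_imp_le)
  with E show "prob {\<omega> \<in> space M. thr e < cmod (a e \<omega>)} \<le> tail_prob" by simp
qed

lemma mixed_moment_le_power:
  assumes e: "e \<in> V \<times> V" and g: "integrable M g"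
    and le: "\<And>\<omega>. cmod (trunc e (a e \<omega>)) ^ (i + j) \<le> g \<omega>"
  shows "mixed_moment e i j \<le> expectation g"
proof -
  have "0 \<le> g \<omega>" for \<omega> using le[of \<omega>] by (meson norm_ge_zero order_trans zero_le_power)
  then show ?thesis
    unfolding mixed_moment_def
    using le g by (intro order_trans[OF integral_norm_bound] integral_mono') (auto simp: norm_mult norm_power power_add)
qed

text \<open>
  As the entry is centered, the mean of its truncation is minus the mean of the part cut off, which the
  fourth moment, divided by \<open>\<tau>\<^sub>0 ^ 3\<close>, bounds.
\<close>

lemma mixed_moment_1:
  assumes e: "e \<in> V \<times> V" and ij: "i + j = 1"
  shows "mixed_moment e i j \<le> D * r\<^sub>0 * \<rho> e / \<tau>\<^sub>0 ^ 3"
proof -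
  note [measurable] = a_measurable[OF e]
  let ?t = "\<lambda>\<omega>. trunc e (a e \<omega>)"
  have it: "integrable M ?t"
    using cmod_trunc_le(3) by (intro integrable_const_bound[of _ 1]) auto
  have "mixed_moment e i j = cmod (expectation ?t)"
  proof (cases "i = 0")
    case True
    then have "j = 1" using ij by simp
    then show ?thesis using True by (simp add: mixed_moment_def)
  next
    case False
    then have "i = 1" "j = 0" using ij by auto
    then show ?thesis by (simp add: mixed_moment_def)
  qed
  also have "expectation ?t = - expectation (\<lambda>\<omega>. a e \<omega> - ?t \<omega>)"
    using it a_int[OF e] a_mean[OF e] by simp
  also have "cmod \<dots> \<le> expectation (\<lambda>\<omega>. cmod (a e \<omega>) ^ 4 / \<tau>\<^sub>0 ^ 3)"
  proof -
    have le: "cmod (z - trunc e z) \<le> cmod z ^ 4 / \<tau>\<^sub>0 ^ 3" for z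
    proof (cases "cmod z \<le> thr e")
      case False
      then have "\<tau>\<^sub>0 ^ 3 \<le> cmod z ^ 3" using thr_bounds[of e] \<tau>\<^sub>0_pos by (intro power_mono) auto
      then have "cmod z * \<tau>\<^sub>0 ^ 3 \<le> cmod z * cmod z ^ 3" by (intro mult_left_mono) auto
      then show ?thesis using False \<tau>\<^sub>0_pos by (simp add: trunc_def field_simps power_Suc[symmetric] del: power_Suc)
    qed (use \<tau>\<^sub>0_pos in \<open>auto simp: trunc_def\<close>)
    have "cmod (- expectation (\<lambda>\<omega>. a e \<omega> - ?t \<omega>)) \<le> expectation (\<lambda>\<omega>. cmod (a e \<omega> - ?t \<omega>))"
      unfolding norm_minus_cancel by (rule integral_norm_bound)
    also have "\<dots> \<le> expectation (\<lambda>\<omega>. cmod (a e \<omega>) ^ 4 / \<tau>\<^sub>0 ^ 3)"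
      using a_int4[OF e] \<tau>\<^sub>0_pos le by (intro integral_mono') auto
    finally show ?thesis .
  qed
  also have "\<dots> \<le> D * r\<^sub>0 * \<rho> e / \<tau>\<^sub>0 ^ 3"
    using a_fourth[OF e] \<tau>\<^sub>0_pos by (simp add: divide_right_mono)
  finally show ?thesis .
qed

lemma mixed_moment_le_visit_weight:
  assumes e: "e \<in> V \<times> V"
  shows "mixed_moment e i j \<le> visit_weight \<rho> thr e (i + j)"
proof -
  consider "i + j = 0" | "i + j = 1" | "2 \<le> i + j" by linarith
  then show ?thesis
  proof cases
    case 1
    then show ?thesis by (simp add: mixed_moment_def visit_weight_def prob_space)
  next
    case 2
    have "D * r\<^sub>0 * \<rho> e / \<tau>\<^sub>0 ^ 3 \<le> \<tau>\<^sub>0 ^ 3 * \<rho> e / \<tau>\<^sub>0 ^ 3"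
      using small \<rho>_nonneg[of e] \<tau>\<^sub>0_pos by (intro divide_right_mono mult_right_mono) auto
    also have "\<dots> = \<rho> e" using \<tau>\<^sub>0_pos by simp
    finally show ?thesis using mixed_moment_1[OF e 2] 2 by (simp add: visit_weight_def)
  next
    case 3
    have "mixed_moment e i j \<le> expectation (\<lambda>\<omega>. cmod (a e \<omega>) ^ 2 * thr e ^ (i + j - 2))"
    proof (rule mixed_moment_le_power[OF e])
      fix \<omega>
      have "cmod (trunc e (a e \<omega>)) ^ (i + j) = cmod (trunc e (a e \<omega>)) ^ 2 * cmod (trunc e (a e \<omega>)) ^ (i + j - 2)"
        using 3 by (metis le_add_diff_inverse power_add)
      also have "\<dots> \<le> cmod (a e \<omega>) ^ 2 * thr e ^ (i + j - 2)"
        using cmod_trunc_le[of e] by (intro mult_mono power_mono) auto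
      finally show "cmod (trunc e (a e \<omega>)) ^ (i + j) \<le> cmod (a e \<omega>) ^ 2 * thr e ^ (i + j - 2)" .
    qed (use a_int2[OF e] in auto)
    also have "\<dots> \<le> \<rho> e * thr e ^ (i + j - 2)"
      using a_second[OF e] thr_bounds[of e] by (simp add: mult_right_mono)
    finally show ?thesis using 3 by (simp add: visit_weight_def)
  qed
qed

lemma mixed_moment_le_1: "e \<in> V \<times> V \<Longrightarrow> mixed_moment e i j \<le> 1"
  using mixed_moment_le_power[of e "\<lambda>_. 1" i j] cmod_trunc_le(3)[of e]
  by (auto simp: power_le_one prob_space)

lemma mixed_moment_nonneg: "0 \<le> mixed_moment e i j"
  by (simp add: mixed_moment_def)

text \<open>
  Four factors from a family of independent truncated entries: either one entry occurs once and
  contributes its tiny mean, or two entries occur twice, or one entry occurs four times.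
\<close>

lemma fourth_order_bound:
  assumes "(\<Sum>e\<in>V \<times> V. visits \<gamma> e) = 4"
  shows "(\<Prod>e\<in>V \<times> V. mixed_moment e (\<gamma> False e) (\<gamma> True e)) \<le> D * r\<^sub>0\<^sup>2 / \<tau>\<^sub>0 ^ 3"
proof -
  let ?m = "\<lambda>e. mixed_moment e (\<gamma> False e) (\<gamma> True e)"
  let ?E = "V \<times> V"
  have fin: "finite ?E" using finite_V by simp
  have t3: "\<tau>\<^sub>0 ^ 3 \<le> 1" using \<tau>\<^sub>0_pos \<tau>\<^sub>0_le \<delta>_le_1 by (intro power_le_one) auto
  have Dr: "0 \<le> D * r\<^sub>0\<^sup>2" using D_ge_1 by simp
  have up: "D * r\<^sub>0\<^sup>2 \<le> D * r\<^sub>0\<^sup>2 / \<tau>\<^sub>0 ^ 3"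
    using t3 Dr \<tau>\<^sub>0_pos by (simp add: pos_le_divide_eq mult_left_le)
  have rest: "prod ?m F \<le> 1" if "F \<subseteq> ?E" for F
    using that mixed_moment_le_1 mixed_moment_nonneg by (intro prod_le_1) auto
  have restp: "0 \<le> prod ?m F" for F using mixed_moment_nonneg by (intro prod_nonneg) auto
  have one: "prod ?m ?E \<le> ?m e" if "e \<in> ?E" for e
    using that fin rest[of "?E - {e}"] mult_left_mono[OF rest[of "?E - {e}"] mixed_moment_nonneg]
    by (subst prod.remove[of _ e]) auto
  show ?thesis
  proof (cases "\<exists>e\<in>?E. visits \<gamma> e = 1")
    case True
    then obtain e where e: "e \<in> ?E" "visits \<gamma> e = 1" by auto
    have "prod ?m ?E \<le> D * r\<^sub>0 * \<rho> e / \<tau>\<^sub>0 ^ 3"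
      using one[OF e(1)] mixed_moment_1[OF e(1), of "\<gamma> False e" "\<gamma> True e"] e(2) by (simp add: visits_def)
    also have "\<dots> \<le> D * r\<^sub>0 * r\<^sub>0 / \<tau>\<^sub>0 ^ 3"
      using \<rho>_le[of e] D_ge_1 r\<^sub>0_nonneg \<tau>\<^sub>0_pos by (intro divide_right_mono mult_left_mono) auto
    finally show ?thesis by (simp add: power2_eq_square)
  next
    case no1: False
    have ex: "\<exists>e\<in>?E. visits \<gamma> e \<noteq> 0"
    proof (rule ccontr)
      assume "\<not> ?thesis"
      then have "(\<Sum>e\<in>?E. visits \<gamma> e) = 0" by (intro sum.neutral) auto
      then show False using assms by simp
    qed
    then obtain e where e: "e \<in> ?E" "visits \<gamma> e \<noteq> 0" by auto
    have split: "visits \<gamma> e + (\<Sum>d\<in>?E - {e}. visits \<gamma> d) = 4"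
      using assms e(1) fin by (simp add: sum.remove)
    show ?thesis
    proof (cases "visits \<gamma> e = 4")
      case True
      have "?m e \<le> expectation (\<lambda>\<omega>. cmod (a e \<omega>) ^ 4)"
        using e True a_int4[OF e(1)] cmod_trunc_le(2)[of e]
        by (intro mixed_moment_le_power) (auto simp: visits_def intro!: power_mono)
      also have "\<dots> \<le> D * r\<^sub>0\<^sup>2" by (rule a_fourth_le[OF e(1)])
      finally show ?thesis using one[OF e(1)] up by simp
    next
      case n4: False
      have "\<exists>d\<in>?E - {e}. visits \<gamma> d \<noteq> 0"
      proof (rule ccontr)
        assume "\<not> ?thesis"
        then have "(\<Sum>d\<in>?E - {e}. visits \<gamma> d) = 0" by (intro sum.neutral) auto
        then show False using split n4 by simp
      qed
      then obtain d where d: "d \<in> ?E" "d \<noteq> e" "visits \<gamma> d \<noteq> 0" by auto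
      have "visits \<gamma> d \<le> (\<Sum>d\<in>?E - {e}. visits \<gamma> d)"
        using d fin by (intro member_le_sum) auto
      moreover have "visits \<gamma> d \<noteq> 1" "visits \<gamma> e \<noteq> 1" using no1 d e by auto
      ultimately have v2: "visits \<gamma> d = 2" "visits \<gamma> e = 2" using split d(3) e(2) by linarith+
      have "prod ?m ?E = ?m e * (?m d * prod ?m (?E - {e} - {d}))"
        using e d fin by (simp add: prod.remove[of _ e] prod.remove[of _ d])
      also have "\<dots> \<le> r\<^sub>0 * (r\<^sub>0 * 1)"
      proof -
        have 2: "?m c \<le> r\<^sub>0" if "c \<in> ?E" "visits \<gamma> c = 2" for c
        proof -
          have "?m c \<le> visit_weight \<rho> thr c 2"
            using mixed_moment_le_visit_weight[OF that(1), of "\<gamma> False c" "\<gamma> True c"] that(2)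
            by (simp add: visits_def)
          then show ?thesis using \<rho>_le[of c] by (simp add: visit_weight_def)
        qed
        have "?m d * prod ?m (?E - {e} - {d}) \<le> r\<^sub>0 * 1"
          using 2[OF d(1) v2(1)] rest[of "?E - {e} - {d}"] restp r\<^sub>0_nonneg by (intro mult_mono) auto
        then show ?thesis
          by (rule mult_mono[OF 2[OF e(1) v2(2)]])
             (use restp r\<^sub>0_nonneg mixed_moment_nonneg in auto)
      qed
      also have "\<dots> \<le> D * r\<^sub>0\<^sup>2" using mult_right_mono[OF D_ge_1, of "r\<^sub>0\<^sup>2"] by (simp add: power2_eq_square)
      finally show ?thesis using up by linarith
    qed
  qed
qed

definition large_prod :: "real \<Rightarrow> ('v \<times> 'v) set \<Rightarrow> 'a \<Rightarrow> real" where
  "large_prod S Z \<omega> = (\<Prod>e\<in>Z. large S e (a e \<omega>))"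

lemma large_bounds: "0 \<le> large S e z" "large S e z \<le> max 1 S"
  by (auto simp: large_def)

lemma large_prod_bounded_rv:
  assumes "Z \<subseteq> V \<times> V" shows "bounded_rv M (\<lambda>\<omega>. of_real (large_prod S Z \<omega> ^ 4))"
proof -
  have "bounded_rv M (\<lambda>\<omega>. complex_of_real (large S e (a e \<omega>)))" if "e \<in> Z" for e
    unfolding bounded_rv_def
  proof
    show "(\<lambda>\<omega>. complex_of_real (large S e (a e \<omega>))) \<in> borel_measurable M"
      using a_measurable[of e] that assms by auto
    show "\<exists>C. \<forall>\<omega>\<in>space M. cmod (complex_of_real (large S e (a e \<omega>))) \<le> C"
      using large_bounds by (intro exI[of _ "max 1 S"]) auto
  qed
  then show ?thesis unfolding large_prod_def of_real_power of_real_prod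
    by (intro bounded_rv_power bounded_rv_prod)
qed

lemma monomial_expectation_le:
  assumes Z: "Z \<subseteq> V \<times> V"
  shows "cmod (expectation (\<lambda>\<omega>. monomial V (\<lambda>e. bulk Z e \<omega>) \<alpha> * of_real (large_prod S Z \<omega> ^ 4)))
     \<le> (\<Prod>e\<in>V \<times> V. mixed_moment e (\<alpha> False e) (\<alpha> True e)) * (tail_prob) ^ card Z"
proof (cases "\<exists>e\<in>Z. visits \<alpha> e \<noteq> 0")
  case True
  then obtain e where e: "e \<in> Z" "visits \<alpha> e \<noteq> 0" by auto
  have "monomial V (\<lambda>e. bulk Z e \<omega>) \<alpha> = 0" for \<omega>
    unfolding monomial_def using e Z finite_V
    by (intro prod_zero bexI[of _ e]) (auto simp: bulk_def visits_def)
  then show ?thesis using mixed_moment_nonneg tail_prob_nonneg by (auto intro!: mult_nonneg_nonneg prod_nonneg)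
next
  case False
  let ?E = "V \<times> V"
  have fin: "finite ?E" using finite_V by simp
  define f where "f e z = (if e \<in> Z then of_real (large S e z ^ 4)
     else trunc e z ^ \<alpha> False e * cnj (trunc e z) ^ \<alpha> True e)" for e z
  have f_meas: "f e \<in> borel_measurable borel" for e
    unfolding f_def by (cases "e \<in> Z") auto
  have f_bd: "\<exists>C. \<forall>z. cmod (f e z) \<le> C" for e
  proof (cases "e \<in> Z")
    case True
    then show ?thesis using large_bounds
      by (intro exI[of _ "max 1 S ^ 4"]) (auto simp: f_def norm_power intro!: power_mono)
  next
    case False
    then show ?thesis using cmod_trunc_le(3)[of e]
      by (intro exI[of _ 1]) (auto simp: f_def norm_mult norm_power intro!: mult_le_one power_le_one)
  qed
  have lp: "complex_of_real (large_prod S Z \<omega> ^ 4) = (\<Prod>e\<in>?E. if e \<in> Z then of_real (large S e (a e \<omega>) ^ 4) else 1)" for \<omega>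
  proof -
    have "complex_of_real (large_prod S Z \<omega> ^ 4) = (\<Prod>e\<in>Z. of_real (large S e (a e \<omega>) ^ 4))"
      by (simp add: large_prod_def prod_power_distrib)
    also have "\<dots> = (\<Prod>e\<in>?E. if e \<in> Z then of_real (large S e (a e \<omega>) ^ 4) else 1)"
      using prod.inter_restrict[OF fin, of "\<lambda>e. complex_of_real (large S e (a e \<omega>) ^ 4)" Z] Z
      by (simp add: inf.absorb2)
    finally show ?thesis .
  qed
  have "monomial V (\<lambda>e. bulk Z e \<omega>) \<alpha> * of_real (large_prod S Z \<omega> ^ 4) = (\<Prod>e\<in>?E. f e (a e \<omega>))" for \<omega>
    unfolding monomial_def lp prod.distrib[symmetric]
    using False by (intro prod.cong) (auto simp: f_def bulk_def visits_def)
  then have "cmod (expectation (\<lambda>\<omega>. monomial V (\<lambda>e. bulk Z e \<omega>) \<alpha> * of_real (large_prod S Z \<omega> ^ 4)))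
     = (\<Prod>e\<in>?E. cmod (expectation (\<lambda>\<omega>. f e (a e \<omega>))))"
    using factorize[of f, OF f_meas f_bd] by (simp add: prod_norm)
  also have "\<dots> \<le> (\<Prod>e\<in>?E. mixed_moment e (\<alpha> False e) (\<alpha> True e) * (if e \<in> Z then tail_prob else 1))"
  proof (rule prod_mono, intro conjI)
    fix e assume e: "e \<in> ?E"
    show "cmod (expectation (\<lambda>\<omega>. f e (a e \<omega>)))
       \<le> mixed_moment e (\<alpha> False e) (\<alpha> True e) * (if e \<in> Z then tail_prob else 1)"
    proof (cases "e \<in> Z")
      case True
      then have 0: "\<alpha> False e = 0" "\<alpha> True e = 0" using False by (auto simp: visits_def)
      have "expectation (\<lambda>\<omega>. f e (a e \<omega>)) = of_real (expectation (\<lambda>\<omega>. large S e (a e \<omega>) ^ 4))"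
        using True by (simp add: f_def del: of_real_power)
      moreover have "0 \<le> expectation (\<lambda>\<omega>. large S e (a e \<omega>) ^ 4)"
        using large_bounds by (intro Bochner_Integration.integral_nonneg) auto
      ultimately show ?thesis using True tail_prob_le(1)[OF e, of S] 0 by (simp add: mixed_moment_def prob_space)
    qed (simp add: f_def mixed_moment_def)
  qed auto
  also have "\<dots> = (\<Prod>e\<in>?E. mixed_moment e (\<alpha> False e) (\<alpha> True e)) * (tail_prob) ^ card Z"
    unfolding prod.distrib using prod.inter_restrict[OF fin, of "\<lambda>e. tail_prob" Z, symmetric] Z
    by (simp add: inf.absorb2)
  finally show ?thesis .
qed

context
  fixes K :: real and H :: nat
  assumes K_ge_1: "1 \<le> K"
begin

lemma walk_weights_thr: "walk_weights V \<rho> thr r\<^sub>0 \<tau>\<^sub>0 \<delta> K"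
  using finite_V \<rho>_nonneg \<rho>_le \<rho>_row thr_bounds \<tau>\<^sub>0_pos K_ge_1
  by unfold_locales (auto simp: thr_def less_imp_le)

interpretation walk_weights V \<rho> thr r\<^sub>0 \<tau>\<^sub>0 \<delta> K H
  by (rule walk_weights_thr)

lemma entry_moment:
  assumes q: "q \<in> V" and H: "2 * k * l \<le> H"
  shows "expectation (\<lambda>\<omega>. cmod (mat_iter V (\<lambda>e. bulk {} e \<omega>) l (unit_at y) q) ^ (2 * k))
     \<le> (K\<^sup>2 * growth ^ l) ^ (2 * k)"
proof -
  interpret walk_moments V \<rho> thr r\<^sub>0 \<tau>\<^sub>0 \<delta> K H M "bulk {}"
    using bulk_bounded_rv by unfold_locales
  have pre: "end_factors (\<lambda>x \<omega>. unit_at y x) zs \<omega> = of_bool (\<forall>z\<in>set zs. snd z = y)" for zs \<omega>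
    by (induction zs) (auto simp: end_factors_def conj_if_def)
  have "cmod (expectation (\<lambda>\<omega>. 1 *
           of_real (cmod (mat_iter V (\<lambda>e. bulk {} e \<omega>) l (\<lambda>x. unit_at y x) q) ^ (2 * k))))
         \<le> 1 * (K\<^sup>2 * growth ^ l) ^ (2 * k)"
  proof (rule moment_bound[OF _ _ _ q H])
    fix \<alpha> and zs :: "(bool \<times> 'v) list"
    have "cmod (expectation (\<lambda>\<omega>. edge_mono \<alpha> \<omega>)) \<le> (\<Prod>e\<in>V \<times> V. mixed_moment e (\<alpha> False e) (\<alpha> True e))"
      using monomial_expectation_le[of "{}" \<alpha>] by (simp add: large_prod_def)
    also have "\<dots> \<le> weight (visits \<alpha>)"
      unfolding weight_def visits_def
      using mixed_moment_le_visit_weight mixed_moment_nonneg by (intro prod_mono) auto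
    finally show "cmod (expectation (\<lambda>\<omega>. edge_mono \<alpha> \<omega> * end_factors (\<lambda>x \<omega>. unit_at y x) zs \<omega> * 1)) \<le> 1 * weight (visits \<alpha>)"
      using weight_nonneg unfolding pre by simp
  qed auto
  moreover have "0 \<le> expectation (\<lambda>\<omega>. cmod (mat_iter V (\<lambda>e. bulk {} e \<omega>) l (unit_at y) q) ^ (2 * k))"
    by (intro Bochner_Integration.integral_nonneg) auto
  ultimately show ?thesis by (simp del: of_real_power)
qed

text \<open>
  Four walks that enter \<open>y\<close> only at their ends are read as in \<open>moment_bound\<close>, with the column of \<open>y\<close> as
  vector of end factors. The four end factors are independent of the walks and gain almost \<open>r\<^sub>0\<^sup>2\<close>,
  whatever the end points are. The large entries in \<open>Z\<close> are independent of all this.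
\<close>

lemma first_passage_moment:
  assumes Z: "Z \<subseteq> V \<times> V" and q: "q \<in> V" and y: "y \<in> V" and H: "4 * j \<le> H"
  shows "expectation (\<lambda>\<omega>. large_prod S Z \<omega> ^ 4 * cmod (first_passage V (\<lambda>e. bulk Z e \<omega>) j q y) ^ 4)
     \<le> D * r\<^sub>0\<^sup>2 / \<tau>\<^sub>0 ^ 3 * (tail_prob) ^ card Z * (K\<^sup>2 * growth ^ j) ^ 4"
proof -
  let ?C = "\<lambda>e \<omega>. del_col y (\<lambda>e. bulk Z e \<omega>) e" and ?\<zeta> = "\<lambda>x. bulk Z (x, y)"
  let ?p = "(tail_prob) ^ card Z"
  have p: "0 \<le> ?p" and A: "0 \<le> D * r\<^sub>0\<^sup>2 / \<tau>\<^sub>0 ^ 3" using D_ge_1 \<tau>\<^sub>0_pos tail_prob_nonneg by simp_all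
  have C: "bounded_rv M (?C e)" if "e \<in> V \<times> V" for e
    using bulk_bounded_rv[OF that, of Z] by (cases "snd e = y") (simp_all add: del_col_def)
  interpret walk_moments V \<rho> thr r\<^sub>0 \<tau>\<^sub>0 \<delta> K H M ?C
    using C by unfold_locales
  have pre: "\<exists>\<gamma>. (\<forall>\<omega>. end_factors ?\<zeta> zs \<omega> = monomial V (\<lambda>e. bulk Z e \<omega>) \<gamma>)
      \<and> (\<Sum>e\<in>V \<times> V. visits \<gamma> e) = length zs \<and> (\<forall>e. snd e \<noteq> y \<longrightarrow> visits \<gamma> e = 0)"
    if "set zs \<subseteq> UNIV \<times> V" for zs :: "(bool \<times> 'v) list"
    using that
  proof (induction zs)
    case Nil
    show ?case by (rule exI[of _ "\<lambda>_ _. 0"]) (simp add: end_factors_def monomial_def visits_def)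
  next
    case (Cons z zs)
    obtain s x where z: "z = (s, x)" by (cases z)
    obtain \<gamma> where \<gamma>: "\<And>\<omega>. end_factors ?\<zeta> zs \<omega> = monomial V (\<lambda>e. bulk Z e \<omega>) \<gamma>"
      "(\<Sum>e\<in>V \<times> V. visits \<gamma> e) = length zs" "\<And>e. snd e \<noteq> y \<Longrightarrow> visits \<gamma> e = 0"
      using Cons by auto
    have e: "(x, y) \<in> V \<times> V" using Cons.prems z y by auto
    have "end_factors ?\<zeta> (z # zs) \<omega> = monomial V (\<lambda>e. bulk Z e \<omega>) (\<gamma>(s := add_visit (\<gamma> s) (x, y)))" for \<omega>
      unfolding z end_factors_Cons monomial_add_visit[OF finite_V e] \<gamma>(1) by (simp add: mult.commute)
    moreover have "(\<Sum>d\<in>V \<times> V. visits (\<gamma>(s := add_visit (\<gamma> s) (x, y))) d) = length (z # zs)"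
      unfolding visits_add_visit using finite_V e \<gamma>(2) by (subst sum_add_visit) auto
    moreover have "visits (\<gamma>(s := add_visit (\<gamma> s) (x, y))) d = 0" if "snd d \<noteq> y" for d
      unfolding visits_add_visit using that \<gamma>(3) by auto
    ultimately show ?case by blast
  qed
  have "cmod (expectation (\<lambda>\<omega>. complex_of_real (large_prod S Z \<omega> ^ 4) *
           of_real (cmod (mat_iter V (\<lambda>e. ?C e \<omega>) j (\<lambda>x. ?\<zeta> x \<omega>) q) ^ 4)))
         \<le> (D * r\<^sub>0\<^sup>2 / \<tau>\<^sub>0 ^ 3 * ?p) * (K\<^sup>2 * growth ^ j) ^ 4"
  proof (rule moment_bound[OF _ large_prod_bounded_rv[OF Z] _ q, where k = 2])
    show "bounded_rv M (?\<zeta> x)" if "x \<in> V" for x using bulk_bounded_rv that y by auto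
    show "0 \<le> D * r\<^sub>0\<^sup>2 / \<tau>\<^sub>0 ^ 3 * ?p" by (rule mult_nonneg_nonneg[OF A p])
    fix \<alpha> and zs :: "(bool \<times> 'v) list"
    assume zs: "length zs = 4" "set zs \<subseteq> UNIV \<times> V"
    obtain \<gamma> where \<gamma>: "\<And>\<omega>. end_factors ?\<zeta> zs \<omega> = monomial V (\<lambda>e. bulk Z e \<omega>) \<gamma>"
      "(\<Sum>e\<in>V \<times> V. visits \<gamma> e) = 4" "\<And>e. snd e \<noteq> y \<Longrightarrow> visits \<gamma> e = 0"
      using pre[OF zs(2)] zs(1) by auto
    show "cmod (expectation (\<lambda>\<omega>. edge_mono \<alpha> \<omega> * end_factors ?\<zeta> zs \<omega> * complex_of_real (large_prod S Z \<omega> ^ 4)))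
       \<le> D * r\<^sub>0\<^sup>2 / \<tau>\<^sub>0 ^ 3 * ?p * weight (visits \<alpha>)"
    proof (cases "\<exists>e\<in>V \<times> V. snd e = y \<and> visits \<alpha> e \<noteq> 0")
      case True
      then obtain e where e: "e \<in> V \<times> V" "snd e = y" "visits \<alpha> e \<noteq> 0" by auto
      have "edge_mono \<alpha> \<omega> = 0" for \<omega>
        unfolding monomial_def using e finite_V
        by (intro prod_zero bexI[of _ e]) (auto simp: del_col_def visits_def)
      then show ?thesis using mult_nonneg_nonneg[OF mult_nonneg_nonneg[OF A p] weight_nonneg[of "visits \<alpha>"]]
        by simp
    next
      case False
      define \<beta> where "\<beta> = (\<lambda>s e. \<alpha> s e + \<gamma> s e)"
      have mono_bulk: "edge_mono \<alpha> \<omega> = monomial V (\<lambda>e. bulk Z e \<omega>) \<alpha>" for \<omega>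
        unfolding monomial_def using False by (intro prod.cong) (auto simp: del_col_def visits_def)
      have "edge_mono \<alpha> \<omega> * end_factors ?\<zeta> zs \<omega> = monomial V (\<lambda>e. bulk Z e \<omega>) \<beta>" for \<omega>
        unfolding mono_bulk \<gamma>(1) unfolding monomial_def \<beta>_def prod.distrib[symmetric] power_add
        by (intro prod.cong) (auto simp: mult_ac)
      then have "cmod (expectation (\<lambda>\<omega>. edge_mono \<alpha> \<omega> * end_factors ?\<zeta> zs \<omega> * complex_of_real (large_prod S Z \<omega> ^ 4)))
         \<le> (\<Prod>e\<in>V \<times> V. mixed_moment e (\<beta> False e) (\<beta> True e)) * ?p"
        using monomial_expectation_le[OF Z, of \<beta> S] by simp
      also have "(\<Prod>e\<in>V \<times> V. mixed_moment e (\<beta> False e) (\<beta> True e))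
         \<le> (\<Prod>e\<in>V \<times> V. visit_weight \<rho> thr e (visits \<alpha> e) * mixed_moment e (\<gamma> False e) (\<gamma> True e))"
      proof (rule prod_mono, intro conjI)
        fix e assume e: "e \<in> V \<times> V"
        show "mixed_moment e (\<beta> False e) (\<beta> True e)
           \<le> visit_weight \<rho> thr e (visits \<alpha> e) * mixed_moment e (\<gamma> False e) (\<gamma> True e)"
        proof (cases "snd e = y")
          case True
          then have "visits \<alpha> e = 0" using False e by auto
          then show ?thesis by (simp add: \<beta>_def visits_def visit_weight_def)
        next
          case ny: False
          then have "visits \<gamma> e = 0" using \<gamma>(3) by auto
          then have "\<gamma> False e = 0" "\<gamma> True e = 0" by (auto simp: visits_def)
          moreover have "mixed_moment e 0 0 = 1" by (simp add: mixed_moment_def prob_space)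
          ultimately show ?thesis
            using mixed_moment_le_visit_weight[OF e, of "\<alpha> False e" "\<alpha> True e"] by (simp add: \<beta>_def visits_def)
        qed
      qed (auto simp: mixed_moment_nonneg)
      also have "\<dots> = weight (visits \<alpha>) * (\<Prod>e\<in>V \<times> V. mixed_moment e (\<gamma> False e) (\<gamma> True e))"
        by (simp add: prod.distrib weight_def)
      also have "\<dots> \<le> weight (visits \<alpha>) * (D * r\<^sub>0\<^sup>2 / \<tau>\<^sub>0 ^ 3)"
        using fourth_order_bound[OF \<gamma>(2)] weight_nonneg by (intro mult_left_mono) auto
      finally show ?thesis using p by (simp add: mult_right_mono mult_ac)
    qed
  qed (use H in auto)
  moreover have "0 \<le> expectation (\<lambda>\<omega>. large_prod S Z \<omega> ^ 4 * cmod (first_passage V (\<lambda>e. bulk Z e \<omega>) j q y) ^ 4)"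
    by (intro Bochner_Integration.integral_nonneg) auto
  ultimately show ?thesis
    by (simp add: first_passage_def of_real_mult[symmetric] del: of_real_mult of_real_power)
qed

end

end

section \<open>Probabilities of exceptional events\<close>

lemma (in prob_space) union_bound:
  assumes "finite I" and A: "\<And>i. i \<in> I \<Longrightarrow> A i \<in> events" and c: "\<And>i. i \<in> I \<Longrightarrow> prob (A i) \<le> c i"
  shows "(\<Union>i\<in>I. A i) \<in> events" and "prob (\<Union>i\<in>I. A i) \<le> (\<Sum>i\<in>I. c i)"
proof -
  show "(\<Union>i\<in>I. A i) \<in> events" using assms by auto
  have "prob (\<Union>i\<in>I. A i) \<le> (\<Sum>i\<in>I. prob (A i))"
    using assms by (intro finite_measure_subadditive_finite) auto
  also have "\<dots> \<le> (\<Sum>i\<in>I. c i)" by (intro sum_mono c)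
  finally show "prob (\<Union>i\<in>I. A i) \<le> (\<Sum>i\<in>I. c i)" .
qed

lemma (in prob_space) power_markov:
  fixes Y :: "'a \<Rightarrow> real"
  assumes m: "Y \<in> borel_measurable M" and i: "integrable M (\<lambda>\<omega>. Y \<omega> ^ n)"
    and nn: "\<And>\<omega>. 0 \<le> Y \<omega>" and c: "0 < c" and E: "expectation (\<lambda>\<omega>. Y \<omega> ^ n) \<le> b"
  shows "{\<omega> \<in> space M. c < Y \<omega>} \<in> events" and "prob {\<omega> \<in> space M. c < Y \<omega>} \<le> b / c ^ n"
proof -
  note [measurable] = m
  show "{\<omega> \<in> space M. c < Y \<omega>} \<in> events" by measurable
  have "prob {\<omega> \<in> space M. c < Y \<omega>} \<le> prob {\<omega> \<in> space M. Y \<omega> ^ n \<ge> c ^ n}"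
    using c by (intro finite_measure_mono) (auto intro!: power_mono)
  also have "\<dots> \<le> expectation (\<lambda>\<omega>. Y \<omega> ^ n) / c ^ n"
    using i nn c by (intro integral_Markov_inequality_measure[of _ _ "{}"]) auto
  also have "\<dots> \<le> b / c ^ n" using E c by (intro divide_right_mono) auto
  finally show "prob {\<omega> \<in> space M. c < Y \<omega>} \<le> b / c ^ n" .
qed

lemma card_subsets_le_power:
  assumes "finite E" shows "card {Z. Z \<subseteq> E \<and> card Z = z} \<le> card E ^ z"
proof (cases "z \<le> card E")
  case True
  then show ?thesis using n_subsets[OF assms, of z] binomial_le_pow[OF True] by simp
next
  case False
  then show ?thesis using n_subsets[OF assms, of z] by (simp add: binomial_eq_0)
qed

context edge_family
begin

lemma factorize_real:
  fixes f :: "'v \<times> 'v \<Rightarrow> complex \<Rightarrow> real"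
  assumes m: "\<And>e. f e \<in> borel_measurable borel" and b: "\<And>e z. \<bar>f e z\<bar> \<le> C"
  shows "expectation (\<lambda>\<omega>. \<Prod>e\<in>V \<times> V. f e (a e \<omega>)) = (\<Prod>e\<in>V \<times> V. expectation (\<lambda>\<omega>. f e (a e \<omega>)))"
proof -
  have "expectation (\<lambda>\<omega>. \<Prod>e\<in>V \<times> V. complex_of_real (f e (a e \<omega>)))
      = (\<Prod>e\<in>V \<times> V. expectation (\<lambda>\<omega>. complex_of_real (f e (a e \<omega>))))"
  proof (rule factorize)
    show "(\<lambda>z. complex_of_real (f e z)) \<in> borel_measurable borel" for e using m[of e] by auto
    show "\<exists>C. \<forall>z. cmod (complex_of_real (f e z)) \<le> C" for e using b[of e] by auto
  qed
  then have "complex_of_real (expectation (\<lambda>\<omega>. \<Prod>e\<in>V \<times> V. f e (a e \<omega>)))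
      = complex_of_real (\<Prod>e\<in>V \<times> V. expectation (\<lambda>\<omega>. f e (a e \<omega>)))"
    by (simp flip: of_real_prod)
  then show ?thesis by (simp only: of_real_eq_iff)
qed

definition all_large :: "('v \<times> 'v) set \<Rightarrow> 'a set" where
  "all_large Z = {\<omega> \<in> space M. \<forall>e\<in>Z. thr e < cmod (a e \<omega>)}"

lemma all_large_prob:
  assumes Z: "Z \<subseteq> V \<times> V"
  shows "all_large Z \<in> events" and "prob (all_large Z) \<le> tail_prob ^ card Z"
proof -
  have finE: "finite (V \<times> V)" using finite_V by simp
  have finZ: "finite Z" using Z finE finite_subset by auto
  have m: "{\<omega> \<in> space M. thr e < cmod (a e \<omega>)} \<in> events" if "e \<in> Z" for e
    using a_measurable[of e] that Z by auto
  show ev: "all_large Z \<in> events"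
    unfolding all_large_def using finZ m by (intro sets.sets_Collect_finite_All) auto
  define f where "f e z = (if e \<in> Z \<longrightarrow> thr e < cmod z then 1 else 0 :: real)" for e and z :: complex
  have f_meas: "f e \<in> borel_measurable borel" for e
    unfolding f_def by (cases "e \<in> Z") auto
  have ind: "indicator (all_large Z) \<omega> = (\<Prod>e\<in>V \<times> V. f e (a e \<omega>))" if in_space: "\<omega> \<in> space M" for \<omega>
  proof (cases "\<omega> \<in> all_large Z")
    case True
    then show ?thesis by (auto simp: all_large_def f_def intro!: prod.neutral[symmetric])
  next
    case False
    then obtain e where "e \<in> Z" "\<not> thr e < cmod (a e \<omega>)" using in_space by (auto simp: all_large_def)
    then have "(\<Prod>e\<in>V \<times> V. f e (a e \<omega>)) = 0"
      using Z finE by (intro prod_zero bexI[of _ e]) (auto simp: f_def)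
    then show ?thesis using False by simp
  qed
  have "prob (all_large Z) = expectation (indicator (all_large Z))" using ev by simp
  also have "\<dots> = expectation (\<lambda>\<omega>. \<Prod>e\<in>V \<times> V. f e (a e \<omega>))"
    by (intro Bochner_Integration.integral_cong ind) auto
  also have "\<dots> = (\<Prod>e\<in>V \<times> V. expectation (\<lambda>\<omega>. f e (a e \<omega>)))"
    by (rule factorize_real[OF f_meas, where C = 1]) (auto simp: f_def)
  also have "\<dots> \<le> (\<Prod>e\<in>V \<times> V. if e \<in> Z then tail_prob else 1)"
  proof (rule prod_mono, intro conjI)
    fix e assume e: "e \<in> V \<times> V"
    show "0 \<le> expectation (\<lambda>\<omega>. f e (a e \<omega>))"
      by (intro Bochner_Integration.integral_nonneg) (auto simp: f_def)
    show "expectation (\<lambda>\<omega>. f e (a e \<omega>)) \<le> (if e \<in> Z then tail_prob else 1)"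
    proof (cases "e \<in> Z")
      case True
      then have "expectation (\<lambda>\<omega>. f e (a e \<omega>)) = expectation (indicator {\<omega> \<in> space M. thr e < cmod (a e \<omega>)})"
        by (intro Bochner_Integration.integral_cong) (auto simp: f_def indicator_def)
      then show ?thesis using True tail_prob_le(2)[OF e] m[OF True] by simp
    qed (simp add: f_def prob_space)
  qed
  also have "\<dots> = tail_prob ^ card Z"
    using prod.inter_restrict[OF finE, of "\<lambda>_. tail_prob" Z, symmetric] Z by (simp add: inf.absorb2)
  finally show "prob (all_large Z) \<le> tail_prob ^ card Z" .
qed

lemma some_large_prob:
  assumes I: "finite I" "real (card I) \<le> c" and Z: "\<And>i. i \<in> I \<Longrightarrow> Z i \<subseteq> V \<times> V \<and> card (Z i) = j"
  shows "(\<Union>i\<in>I. all_large (Z i)) \<in> events" and "prob (\<Union>i\<in>I. all_large (Z i)) \<le> c * tail_prob ^ j"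
proof -
  have each: "all_large (Z i) \<in> events" "prob (all_large (Z i)) \<le> tail_prob ^ j" if "i \<in> I" for i
    using all_large_prob[of "Z i"] Z[OF that] by auto
  show "(\<Union>i\<in>I. all_large (Z i)) \<in> events" using I(1) each by (rule union_bound(1))
  have "prob (\<Union>i\<in>I. all_large (Z i)) \<le> (\<Sum>i\<in>I. tail_prob ^ j)" using I(1) each by (rule union_bound(2))
  also have "\<dots> \<le> c * tail_prob ^ j" using I(2) tail_prob_nonneg by (simp add: mult_right_mono)
  finally show "prob (\<Union>i\<in>I. all_large (Z i)) \<le> c * tail_prob ^ j" .
qed

text \<open>
  Markov's inequality for \<open>2 ^ card\<close>, whose mean factorizes over the entries.
\<close>

lemma count_large_prob:
  shows "{\<omega> \<in> space M. L < real (card {e \<in> V \<times> V. thr e < cmod (a e \<omega>)})} \<in> events"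
    and "prob {\<omega> \<in> space M. L < real (card {e \<in> V \<times> V. thr e < cmod (a e \<omega>)})}
       \<le> exp (real (card V) ^ 2 * tail_prob) / 2 powr L"
proof -
  have finE: "finite (V \<times> V)" using finite_V by simp
  define f where "f e z = (if thr e < cmod z then 2 else 1 :: real)" for e and z :: complex
  have f_meas [measurable]: "f e \<in> borel_measurable borel" for e unfolding f_def by measurable
  let ?c = "\<lambda>\<omega>. real (card {e \<in> V \<times> V. thr e < cmod (a e \<omega>)})"
  let ?X = "\<lambda>\<omega>. \<Prod>e\<in>V \<times> V. f e (a e \<omega>)"
  have X: "?X \<omega> = 2 powr ?c \<omega>" for \<omega>
  proof -
    have "?X \<omega> = (\<Prod>e\<in>{e \<in> V \<times> V. thr e < cmod (a e \<omega>)}. 2)"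
      unfolding f_def using prod.inter_filter[OF finE, of "\<lambda>_. 2::real" "\<lambda>e. thr e < cmod (a e \<omega>)"] by simp
    then show ?thesis by (simp add: powr_realpow)
  qed
  have Xm: "?X \<in> borel_measurable M"
    using a_measurable by (intro borel_measurable_prod) (auto intro: measurable_compose[OF _ f_meas])
  have cX: "?c \<omega> = log 2 (?X \<omega>)" for \<omega> unfolding X by simp
  have cm: "?c \<in> borel_measurable M" unfolding cX using Xm by measurable
  then show "{\<omega> \<in> space M. L < ?c \<omega>} \<in> events" by measurable
  have Xi: "integrable M ?X"
  proof (rule integrable_const_bound[OF _ Xm, of "2 ^ card (V \<times> V)"])
    have "?X \<omega> \<le> (\<Prod>e\<in>V \<times> V. 2)" for \<omega> by (intro prod_mono) (auto simp: f_def)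
    moreover have "0 \<le> ?X \<omega>" for \<omega> by (intro prod_nonneg) (auto simp: f_def)
    ultimately show "AE \<omega> in M. norm (?X \<omega>) \<le> 2 ^ card (V \<times> V)" by simp
  qed
  have "prob {\<omega> \<in> space M. L < ?c \<omega>} \<le> prob {\<omega> \<in> space M. ?X \<omega> \<ge> 2 powr L}"
  proof (rule finite_measure_mono)
    show "{\<omega> \<in> space M. L < ?c \<omega>} \<subseteq> {\<omega> \<in> space M. ?X \<omega> \<ge> 2 powr L}" unfolding X by auto
    show "{\<omega> \<in> space M. ?X \<omega> \<ge> 2 powr L} \<in> events" using Xm by measurable
  qed
  also have "\<dots> \<le> expectation ?X / 2 powr L"
    using Xi unfolding X by (intro integral_Markov_inequality_measure[of _ _ "{}"]) auto
  also have "expectation ?X = (\<Prod>e\<in>V \<times> V. expectation (\<lambda>\<omega>. f e (a e \<omega>)))"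
    by (rule factorize_real[OF f_meas, where C = 2]) (auto simp: f_def)
  also have "\<dots> \<le> (\<Prod>e\<in>V \<times> V. exp tail_prob)"
  proof (rule prod_mono, intro conjI)
    fix e assume e: "e \<in> V \<times> V"
    note [measurable] = a_measurable[OF e]
    show "0 \<le> expectation (\<lambda>\<omega>. f e (a e \<omega>))"
      by (intro Bochner_Integration.integral_nonneg) (auto simp: f_def)
    have "expectation (\<lambda>\<omega>. f e (a e \<omega>)) = expectation (\<lambda>\<omega>. 1 + indicator {\<omega> \<in> space M. thr e < cmod (a e \<omega>)} \<omega>)"
      by (intro Bochner_Integration.integral_cong) (auto simp: f_def indicator_def)
    also have "\<dots> = 1 + prob {\<omega> \<in> space M. thr e < cmod (a e \<omega>)}"
    proof -
      have "{\<omega> \<in> space M. thr e < cmod (a e \<omega>)} \<in> events" by measurable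
      then have "integrable M (indicator {\<omega> \<in> space M. thr e < cmod (a e \<omega>)} :: 'a \<Rightarrow> real)"
        by (intro integrable_real_indicator) (auto simp: emeasure_eq_measure)
      then show ?thesis
        by (subst Bochner_Integration.integral_add) (auto simp: prob_space)
    qed
    also have "\<dots> \<le> 1 + tail_prob" using tail_prob_le(2)[OF e] by simp
    also have "\<dots> \<le> exp tail_prob" by (rule exp_ge_add_one_self)
    finally show "expectation (\<lambda>\<omega>. f e (a e \<omega>)) \<le> exp tail_prob" .
  qed
  also have "\<dots> = exp (real (card V) ^ 2 * tail_prob)"
    by (simp add: exp_of_nat_mult[symmetric] card_cartesian_product power2_eq_square)
  finally show "prob {\<omega> \<in> space M. L < ?c \<omega>} \<le> exp (real (card V) ^ 2 * tail_prob) / 2 powr L"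
    by (simp add: divide_right_mono)
qed

lemma cutoff_prob:
  assumes e: "e \<in> V \<times> V" and S: "0 < S"
  shows "{\<omega> \<in> space M. S < cmod (a e \<omega>)} \<in> events" and "prob {\<omega> \<in> space M. S < cmod (a e \<omega>)} \<le> D * r\<^sub>0\<^sup>2 / S ^ 4"
  using power_markov[of "\<lambda>\<omega>. cmod (a e \<omega>)" 4 S "D * r\<^sub>0\<^sup>2"] a_measurable[OF e] a_int4[OF e] a_fourth_le[OF e] S
  by auto

definition step_growth :: "real \<Rightarrow> nat \<Rightarrow> real" where
  "step_growth K H = walk_weights.growth r\<^sub>0 \<tau>\<^sub>0 \<delta> K H"

lemma step_growth_eq:
  assumes "1 \<le> K"
  shows "step_growth K H = 1 + (1 + real H) / K + (real H + 1) * r\<^sub>0 * K\<^sup>2 + real H * \<tau>\<^sub>0 + \<delta>"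
  unfolding step_growth_def using walk_weights.growth_def[OF walk_weights_thr[OF assms]] .

lemma step_growth_ge_1: "1 \<le> K \<Longrightarrow> 1 \<le> step_growth K H"
  unfolding step_growth_def using walk_weights.growth_ge_1[OF walk_weights_thr] .

lemma bounded_rv_norm_measurable: "bounded_rv M Y \<Longrightarrow> (\<lambda>\<omega>. cmod (Y \<omega>)) \<in> borel_measurable M"
  by (auto simp: bounded_rv_def)

lemma bounded_rv_norm_integrable: "bounded_rv M Y \<Longrightarrow> integrable M (\<lambda>\<omega>. cmod (Y \<omega>) ^ n)"
  using bounded_rv_integrable[OF bounded_rv_power[of M Y n]]
  by (simp flip: norm_power)

lemma entry_prob:
  assumes K: "1 \<le> K" and q: "q \<in> V" and y: "y \<in> V" and H: "2 * m * k \<le> H" and l: "l \<le> k" and R: "0 < R"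
  shows "{\<omega> \<in> space M. R < cmod (mat_iter V (\<lambda>e. bulk {} e \<omega>) l (unit_at y) q)} \<in> events"
    and "prob {\<omega> \<in> space M. R < cmod (mat_iter V (\<lambda>e. bulk {} e \<omega>) l (unit_at y) q)}
       \<le> (K\<^sup>2 * step_growth K H ^ k) ^ (2 * m) / R ^ (2 * m)"
proof -
  let ?Y = "\<lambda>\<omega>. mat_iter V (\<lambda>e. bulk {} e \<omega>) l (unit_at y) q"
  have Y: "bounded_rv M ?Y"
    using bounded_rv_mat_iter[of V M "bulk {}" "\<lambda>x _. unit_at y x" q l] bulk_bounded_rv q by auto
  have g: "1 \<le> step_growth K H" using step_growth_ge_1[OF K] .
  have "2 * m * l \<le> H" using H l by (meson le_trans mult_le_mono2)
  from entry_moment[OF K q this, of y]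
  have "expectation (\<lambda>\<omega>. cmod (?Y \<omega>) ^ (2 * m)) \<le> (K\<^sup>2 * step_growth K H ^ l) ^ (2 * m)"
    by (simp add: step_growth_def)
  also have "\<dots> \<le> (K\<^sup>2 * step_growth K H ^ k) ^ (2 * m)"
    using K g l by (intro power_mono mult_left_mono power_increasing) auto
  finally show "{\<omega> \<in> space M. R < cmod (?Y \<omega>)} \<in> events"
    and "prob {\<omega> \<in> space M. R < cmod (?Y \<omega>)} \<le> (K\<^sup>2 * step_growth K H ^ k) ^ (2 * m) / R ^ (2 * m)"
    using power_markov[of "\<lambda>\<omega>. cmod (?Y \<omega>)" "2 * m" R] R
      bounded_rv_norm_measurable[OF Y] bounded_rv_norm_integrable[OF Y] by auto
qed

lemma passage_prob:
  assumes K: "1 \<le> K" and Z: "Z \<subseteq> V \<times> V" and q: "q \<in> V" and y: "y \<in> V" and H: "4 * k \<le> H"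
    and j: "j < k" and t: "0 < t"
  shows "{\<omega> \<in> space M. t < large_prod S Z \<omega> * cmod (first_passage V (\<lambda>e. bulk Z e \<omega>) j q y)} \<in> events"
    and "prob {\<omega> \<in> space M. t < large_prod S Z \<omega> * cmod (first_passage V (\<lambda>e. bulk Z e \<omega>) j q y)}
       \<le> (D * r\<^sub>0\<^sup>2 / \<tau>\<^sub>0 ^ 3 * (K\<^sup>2 * step_growth K H ^ k) ^ 4) * tail_prob ^ card Z / t ^ 4"
proof -
  let ?F = "\<lambda>\<omega>. first_passage V (\<lambda>e. bulk Z e \<omega>) j q y"
  let ?Y = "\<lambda>\<omega>. large_prod S Z \<omega> * cmod (?F \<omega>)"
  have lp: "0 \<le> large_prod S Z \<omega>" for \<omega> unfolding large_prod_def using large_bounds by (intro prod_nonneg) auto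
  have C: "bounded_rv M (\<lambda>\<omega>. del_col y (\<lambda>e. bulk Z e \<omega>) e)" if "e \<in> V \<times> V" for e
    using bulk_bounded_rv[OF that, of Z] by (cases "snd e = y") (simp_all add: del_col_def)
  have F: "bounded_rv M ?F"
    unfolding first_passage_def
    using bounded_rv_mat_iter[of V M "\<lambda>e \<omega>. del_col y (\<lambda>e. bulk Z e \<omega>) e" "\<lambda>x. bulk Z (x, y)" q j]
      C bulk_bounded_rv q y by auto
  have G: "bounded_rv M (\<lambda>\<omega>. of_real (large_prod S Z \<omega> ^ 4) * ?F \<omega> ^ 4)"
    using large_prod_bounded_rv[OF Z] F by (intro bounded_rv_mult bounded_rv_power)
  have Y4: "?Y \<omega> ^ 4 = cmod (of_real (large_prod S Z \<omega> ^ 4) * ?F \<omega> ^ 4)" for \<omega>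
    using lp[of \<omega>] by (simp add: norm_mult norm_power power_mult_distrib)
  have Ym: "?Y \<in> borel_measurable M"
  proof -
    have "(\<lambda>\<omega>. large S e (a e \<omega>)) \<in> borel_measurable M" if "e \<in> Z" for e
      using a_measurable[of e] that Z by (auto intro: measurable_compose[OF _ large_measurable])
    then have "large_prod S Z \<in> borel_measurable M"
      unfolding large_prod_def[abs_def] by (rule borel_measurable_prod)
    then show ?thesis using bounded_rv_norm_measurable[OF F] by measurable
  qed
  have Yi: "integrable M (\<lambda>\<omega>. ?Y \<omega> ^ 4)"
    unfolding Y4 using bounded_rv_norm_integrable[OF G, of 1] by simp
  have g: "1 \<le> step_growth K H" using step_growth_ge_1[OF K] .
  have "4 * j \<le> H" using H j by simp
  from first_passage_moment[OF K Z q y this, of S]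
  have "expectation (\<lambda>\<omega>. ?Y \<omega> ^ 4) \<le> D * r\<^sub>0\<^sup>2 / \<tau>\<^sub>0 ^ 3 * tail_prob ^ card Z * (K\<^sup>2 * step_growth K H ^ j) ^ 4"
    by (simp add: step_growth_def power_mult_distrib)
  also have "\<dots> \<le> D * r\<^sub>0\<^sup>2 / \<tau>\<^sub>0 ^ 3 * tail_prob ^ card Z * (K\<^sup>2 * step_growth K H ^ k) ^ 4"
    using K g j D_ge_1 \<tau>\<^sub>0_pos tail_prob_nonneg
    by (intro mult_left_mono power_mono power_increasing mult_nonneg_nonneg) auto
  also have "\<dots> = (D * r\<^sub>0\<^sup>2 / \<tau>\<^sub>0 ^ 3 * (K\<^sup>2 * step_growth K H ^ k) ^ 4) * tail_prob ^ card Z" by simp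
  finally have E: "expectation (\<lambda>\<omega>. ?Y \<omega> ^ 4)
      \<le> (D * r\<^sub>0\<^sup>2 / \<tau>\<^sub>0 ^ 3 * (K\<^sup>2 * step_growth K H ^ k) ^ 4) * tail_prob ^ card Z" .
  have nn: "0 \<le> ?Y \<omega>" for \<omega> using lp by simp
  show "{\<omega> \<in> space M. t < ?Y \<omega>} \<in> events" by (rule power_markov(1)[OF Ym Yi nn t E])
  show "prob {\<omega> \<in> space M. t < ?Y \<omega>}
       \<le> (D * r\<^sub>0\<^sup>2 / \<tau>\<^sub>0 ^ 3 * (K\<^sup>2 * step_growth K H ^ k) ^ 4) * tail_prob ^ card Z / t ^ 4"
    by (rule power_markov(2)[OF Ym Yi nn t E])
qed

end

section \<open>The exceptional event for one size\<close>

text \<open>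
  The conditions under which \<open>no_large_eigenvalue\<close> applies, for a matrix \<open>a\<close> with bulk \<open>b\<close>.
\<close>

definition tame :: "'v set \<Rightarrow> nat \<Rightarrow> real \<Rightarrow> real \<Rightarrow> real \<Rightarrow> real \<Rightarrow> ('v \<times> 'v \<Rightarrow> complex) \<Rightarrow> ('v \<times> 'v \<Rightarrow> complex) \<Rightarrow> bool" where
  "tame V k L R S t a b \<longleftrightarrow> (let s = (\<lambda>e. a e - b e); E = {e \<in> V \<times> V. s e \<noteq> 0} in
     (\<forall>q\<in>V. \<forall>y\<in>V. \<forall>l\<le>k. cmod (mat_iter V b l (unit_at y) q) \<le> R) \<and>
     (\<forall>e\<in>E. cmod (s e) \<le> S) \<and>
     real (card E) \<le> L \<and>
     (\<forall>u v x y. (u, v) \<in> E \<longrightarrow> (v, x) \<in> E \<longrightarrow> (x, y) \<notin> E) \<and>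
     (\<forall>p q y x. \<forall>j<k. (p, q) \<in> E \<longrightarrow> (y, x) \<in> E \<longrightarrow>
        cmod (s (p, q)) * cmod (first_passage V b j q y) \<le> t) \<and>
     (\<forall>o' p q y x. \<forall>j<k. (o', p) \<in> E \<longrightarrow> (p, q) \<in> E \<longrightarrow> (y, x) \<in> E \<longrightarrow>
        cmod (s (o', p)) * cmod (s (p, q)) * cmod (first_passage V b j q y) \<le> t))"

text \<open>
  Three consecutive large entries contain a large loop, a pair of opposite large entries, or three different
  large entries on at most four vertices. For the conditions on first passages, \<open>Z\<close> is the set of at most three
  large entries involved; there are at most \<open>N ^ (2 z)\<close> sets with \<open>z\<close> elements, which \<open>tail_prob ^ z\<close>
  nearly compensates, and the bound of \<open>first_passage_moment\<close> for the bulk remains.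
\<close>

lemma (in edge_family) exceptional_event:
  fixes k m H :: nat and K L R S t :: real
  assumes K: "1 \<le> K" and S: "0 < S" and R: "0 < R" and t: "0 < t"
    and Hm: "2 * m * k \<le> H" and H4: "4 * k \<le> H"
  defines "N \<equiv> real (card V)"
  defines "g \<equiv> K\<^sup>2 * step_growth K H ^ k"
  shows "\<exists>Bad\<in>events. prob Bad \<le>
      (\<Sum>u\<in>V. prob {\<omega> \<in> space M. \<delta> < cmod (a (u, u) \<omega>)}) +
      N\<^sup>2 * (D * r\<^sub>0\<^sup>2 / S ^ 4) + exp (N\<^sup>2 * tail_prob) / 2 powr L + N\<^sup>2 * tail_prob\<^sup>2 + N ^ 4 * tail_prob ^ 3
      + N\<^sup>2 * (real k + 1) * (g ^ (2 * m) / R ^ (2 * m))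
      + (\<Sum>z\<in>{1..3}. N ^ (2 * z) * (9 * real k * ((D * r\<^sub>0\<^sup>2 / \<tau>\<^sub>0 ^ 3 * g ^ 4) * tail_prob ^ z / t ^ 4)))
    \<and> (\<forall>\<omega>\<in>space M - Bad. tame V k L R S t (\<lambda>e. a e \<omega>) (\<lambda>e. bulk {} e \<omega>))"
proof -
  let ?E = "V \<times> V"
  have finE: "finite ?E" using finite_V by simp
  have cE: "real (card ?E) = N\<^sup>2" by (simp add: N_def card_cartesian_product power2_eq_square)
  define B1 where "B1 = (\<Union>u\<in>V. {\<omega> \<in> space M. \<delta> < cmod (a (u, u) \<omega>)})"
  define B2 where "B2 = (\<Union>e\<in>?E. {\<omega> \<in> space M. S < cmod (a e \<omega>)})"
  define B3 where "B3 = {\<omega> \<in> space M. L < real (card {e \<in> ?E. thr e < cmod (a e \<omega>)})}"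
  define I4 where "I4 = {(u, v). u \<in> V \<and> v \<in> V \<and> u \<noteq> v}"
  define B4 where "B4 = (\<Union>(u, v)\<in>I4. all_large {(u, v), (v, u)})"
  define I5 where "I5 = {(u, v, x, y). u \<in> V \<and> v \<in> V \<and> x \<in> V \<and> y \<in> V \<and> card {(u, v), (v, x), (x, y)} = 3}"
  define B5 where "B5 = (\<Union>(u, v, x, y)\<in>I5. all_large {(u, v), (v, x), (x, y)})"
  define I6 where "I6 = V \<times> V \<times> {..k}"
  define B6 where "B6 = (\<Union>(q, y, l)\<in>I6. {\<omega> \<in> space M. R < cmod (mat_iter V (\<lambda>e. bulk {} e \<omega>) l (unit_at y) q)})"
  define P where "P Z = (\<Union>(q, y, j)\<in>snd ` Z \<times> fst ` Z \<times> {..<k}.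
      {\<omega> \<in> space M. t < large_prod S Z \<omega> * cmod (first_passage V (\<lambda>e. bulk Z e \<omega>) j q y)})" for Z
  define B7 where "B7 = (\<Union>z\<in>{1..3}. \<Union>Z\<in>{Z. Z \<subseteq> ?E \<and> card Z = z}. P Z)"
  have b1: "B1 \<in> events" "prob B1 \<le> (\<Sum>u\<in>V. prob {\<omega> \<in> space M. \<delta> < cmod (a (u, u) \<omega>)})"
    unfolding B1_def using a_measurable by (intro union_bound finite_V; auto)+
  have b2: "B2 \<in> events" "prob B2 \<le> N\<^sup>2 * (D * r\<^sub>0\<^sup>2 / S ^ 4)"
  proof -
    show "B2 \<in> events" unfolding B2_def using finE cutoff_prob[OF _ S] by (intro union_bound(1)[where c = "\<lambda>_. D * r\<^sub>0\<^sup>2 / S ^ 4"])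
    have "prob B2 \<le> (\<Sum>e\<in>?E. D * r\<^sub>0\<^sup>2 / S ^ 4)"
      unfolding B2_def using finE cutoff_prob[OF _ S] by (intro union_bound(2))
    then show "prob B2 \<le> N\<^sup>2 * (D * r\<^sub>0\<^sup>2 / S ^ 4)" by (simp add: cE)
  qed
  have b3: "B3 \<in> events" "prob B3 \<le> exp (N\<^sup>2 * tail_prob) / 2 powr L"
    unfolding B3_def N_def by (rule count_large_prob)+
  have b4: "B4 \<in> events" "prob B4 \<le> N\<^sup>2 * tail_prob\<^sup>2"
  proof -
    have sub: "I4 \<subseteq> ?E" by (auto simp: I4_def)
    have I4: "finite I4" "real (card I4) \<le> N\<^sup>2"
      using finite_subset[OF sub finE] card_mono[OF finE sub] cE[symmetric] by auto
    have "(case i of (u, v) \<Rightarrow> {(u, v), (v, u)}) \<subseteq> ?E \<and> card (case i of (u, v) \<Rightarrow> {(u, v), (v, u)}) = 2"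
      if "i \<in> I4" for i using that by (auto simp: I4_def)
    note * = some_large_prob[OF I4 this]
    have "B4 = (\<Union>i\<in>I4. all_large (case i of (u, v) \<Rightarrow> {(u, v), (v, u)}))" by (auto simp: B4_def)
    then show "B4 \<in> events" "prob B4 \<le> N\<^sup>2 * tail_prob\<^sup>2" using * by simp_all
  qed
  have b5: "B5 \<in> events" "prob B5 \<le> N ^ 4 * tail_prob ^ 3"
  proof -
    have sub: "I5 \<subseteq> V \<times> V \<times> V \<times> V" by (auto simp: I5_def)
    have fin: "finite (V \<times> V \<times> V \<times> V)" using finite_V by simp
    have "real (card I5) \<le> real (card (V \<times> V \<times> V \<times> V))" using card_mono[OF fin sub] by simp
    also have "\<dots> = N ^ 4" by (simp add: N_def card_cartesian_product power4_eq_xxxx)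
    finally have I5: "finite I5" "real (card I5) \<le> N ^ 4" using finite_subset[OF sub fin] by auto
    let ?Z = "\<lambda>(u, v, x, y). {(u, v), (v, x), (x, y)}"
    have "?Z i \<subseteq> ?E \<and> card (?Z i) = 3" if "i \<in> I5" for i using that by (auto simp: I5_def)
    note * = some_large_prob[OF I5 this]
    have "B5 = (\<Union>i\<in>I5. all_large (?Z i))" by (auto simp: B5_def)
    then show "B5 \<in> events" "prob B5 \<le> N ^ 4 * tail_prob ^ 3" using * by simp_all
  qed
  have b6: "B6 \<in> events" "prob B6 \<le> N\<^sup>2 * (real k + 1) * (g ^ (2 * m) / R ^ (2 * m))"
  proof -
    have fin: "finite I6" using finite_V by (simp add: I6_def)
    have each: "(case i of (q, y, l) \<Rightarrow> {\<omega> \<in> space M. R < cmod (mat_iter V (\<lambda>e. bulk {} e \<omega>) l (unit_at y) q)}) \<in> events"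
       "prob (case i of (q, y, l) \<Rightarrow> {\<omega> \<in> space M. R < cmod (mat_iter V (\<lambda>e. bulk {} e \<omega>) l (unit_at y) q)})
         \<le> g ^ (2 * m) / R ^ (2 * m)" if i: "i \<in> I6" for i
      using i entry_prob[OF K _ _ Hm _ R] unfolding I6_def g_def by auto
    show "B6 \<in> events" unfolding B6_def using fin each by (rule union_bound(1))
    have "prob B6 \<le> (\<Sum>i\<in>I6. g ^ (2 * m) / R ^ (2 * m))" unfolding B6_def using fin each by (rule union_bound(2))
    also have "\<dots> = N\<^sup>2 * (real k + 1) * (g ^ (2 * m) / R ^ (2 * m))"
      by (simp add: I6_def N_def card_cartesian_product power2_eq_square algebra_simps)
    finally show "prob B6 \<le> N\<^sup>2 * (real k + 1) * (g ^ (2 * m) / R ^ (2 * m))" .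
  qed
  define \<beta> where "\<beta> z = (D * r\<^sub>0\<^sup>2 / \<tau>\<^sub>0 ^ 3 * g ^ 4) * tail_prob ^ z / t ^ 4" for z
  have \<beta>0: "0 \<le> \<beta> z" for z
    using D_ge_1 \<tau>\<^sub>0_pos tail_prob_nonneg by (simp add: \<beta>_def)
  have p7: "P Z \<in> events" "prob (P Z) \<le> 9 * real k * \<beta> z"
    if Z: "Z \<subseteq> ?E" "card Z = z" "z \<in> {1..3}" for Z z
  proof -
    let ?I = "snd ` Z \<times> fst ` Z \<times> {..<k}"
    let ?A = "\<lambda>i. case i of (q, y, j) \<Rightarrow>
      {\<omega> \<in> space M. t < large_prod S Z \<omega> * cmod (first_passage V (\<lambda>e. bulk Z e \<omega>) j q y)}"
    have finZ: "finite Z" using finite_subset[OF Z(1) finE] .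
    have fin: "finite ?I" using finZ by simp
    have each: "?A i \<in> events" "prob (?A i) \<le> \<beta> z" if i: "i \<in> ?I" for i
    proof -
      obtain q y j where i': "i = (q, y, j)" "q \<in> snd ` Z" "y \<in> fst ` Z" "j < k" using i by auto
      then have "q \<in> V" "y \<in> V" using Z(1) by auto
      from passage_prob[OF K Z(1) this H4 i'(4) t, of S]
      show "?A i \<in> events" "prob (?A i) \<le> \<beta> z" unfolding i'(1) \<beta>_def g_def Z(2) by auto
    qed
    show "P Z \<in> events" unfolding P_def using fin each by (rule union_bound(1))
    have "prob (P Z) \<le> (\<Sum>i\<in>?I. \<beta> z)" unfolding P_def using fin each by (rule union_bound(2))
    also have "\<dots> = real (card (snd ` Z) * card (fst ` Z)) * real k * \<beta> z"
      by (simp add: card_cartesian_product)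
    \<comment> \<open>At most three end points and three starting points come from \<open>Z\<close>.\<close>
    also have "\<dots> \<le> 9 * real k * \<beta> z"
    proof (intro mult_right_mono)
      have "card (snd ` Z) \<le> 3" "card (fst ` Z) \<le> 3"
        using card_image_le[OF finZ, of snd] card_image_le[OF finZ, of fst] Z by auto
      then have "card (snd ` Z) * card (fst ` Z) \<le> 3 * 3" by (rule mult_le_mono)
      then show "real (card (snd ` Z) * card (fst ` Z)) \<le> 9" by linarith
    qed (use \<beta>0 in auto)
    finally show "prob (P Z) \<le> 9 * real k * \<beta> z" .
  qed
  have b7: "B7 \<in> events" "prob B7 \<le> (\<Sum>z\<in>{1..3}. N ^ (2 * z) * (9 * real k * \<beta> z))"
  proof -
    let ?Q = "\<lambda>z. \<Union>Z\<in>{Z. Z \<subseteq> ?E \<and> card Z = z}. P Z"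
    have each: "?Q z \<in> events" "prob (?Q z) \<le> N ^ (2 * z) * (9 * real k * \<beta> z)" if z: "z \<in> {1..3}" for z
    proof -
      have fin: "finite {Z. Z \<subseteq> ?E \<and> card Z = z}" using finE by (auto intro: finite_subset[of _ "Pow ?E"])
      show "?Q z \<in> events" using fin p7(1)[OF _ _ z] by (intro sets.finite_UN) auto
      have "prob (?Q z) \<le> (\<Sum>Z\<in>{Z. Z \<subseteq> ?E \<and> card Z = z}. 9 * real k * \<beta> z)"
        using fin p7[OF _ _ z] by (intro union_bound(2)) auto
      also have "\<dots> = real (card {Z. Z \<subseteq> ?E \<and> card Z = z}) * (9 * real k * \<beta> z)" by simp
      also have "\<dots> \<le> N ^ (2 * z) * (9 * real k * \<beta> z)"
      proof (rule mult_right_mono)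
        have "real (card {Z. Z \<subseteq> ?E \<and> card Z = z}) \<le> real (card ?E ^ z)"
          using card_subsets_le_power[OF finE] by (simp only: of_nat_le_iff)
        then show "real (card {Z. Z \<subseteq> ?E \<and> card Z = z}) \<le> N ^ (2 * z)" by (simp add: cE power_mult)
      qed (use \<beta>0 in auto)
      finally show "prob (?Q z) \<le> N ^ (2 * z) * (9 * real k * \<beta> z)" .
    qed
    have fin: "finite {1..3::nat}" by simp
    show "B7 \<in> events" unfolding B7_def using fin each by (rule union_bound(1))
    show "prob B7 \<le> (\<Sum>z\<in>{1..3}. N ^ (2 * z) * (9 * real k * \<beta> z))"
      unfolding B7_def using fin each by (rule union_bound(2))
  qed
  define Bad where "Bad = B1 \<union> B2 \<union> B3 \<union> B4 \<union> B5 \<union> B6 \<union> B7"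
  have ev: "Bad \<in> events" unfolding Bad_def using b1 b2 b3 b4 b5 b6 b7 by auto
  have "prob Bad \<le> prob B1 + prob B2 + prob B3 + prob B4 + prob B5 + prob B6 + prob B7"
    unfolding Bad_def using b1(1) b2(1) b3(1) b4(1) b5(1) b6(1) b7(1)
    by (intro order_trans[OF measure_Un_le] add_right_mono sets.Un order_refl)
  then have pr: "prob Bad \<le> (\<Sum>u\<in>V. prob {\<omega> \<in> space M. \<delta> < cmod (a (u, u) \<omega>)}) +
      N\<^sup>2 * (D * r\<^sub>0\<^sup>2 / S ^ 4) + exp (N\<^sup>2 * tail_prob) / 2 powr L + N\<^sup>2 * tail_prob\<^sup>2 + N ^ 4 * tail_prob ^ 3
      + N\<^sup>2 * (real k + 1) * (g ^ (2 * m) / R ^ (2 * m))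
      + (\<Sum>z\<in>{1..3}. N ^ (2 * z) * (9 * real k * \<beta> z))"
    using b1(2) b2(2) b3(2) b4(2) b5(2) b6(2) b7(2) by linarith
  have "tame V k L R S t (\<lambda>e. a e \<omega>) (\<lambda>e. bulk {} e \<omega>)" if \<omega>: "\<omega> \<in> space M - Bad" for \<omega>
  proof -
    define s where "s e = a e \<omega> - bulk {} e \<omega>" for e
    define E where "E = {e \<in> ?E. s e \<noteq> 0}"
    have \<omega>M: "\<omega> \<in> space M" using \<omega> by simp
    have n: "\<omega> \<notin> B1" "\<omega> \<notin> B2" "\<omega> \<notin> B3" "\<omega> \<notin> B4" "\<omega> \<notin> B5" "\<omega> \<notin> B6" "\<omega> \<notin> B7"
      using \<omega> by (auto simp: Bad_def)
    have s0: "s e \<noteq> 0 \<longleftrightarrow> thr e < cmod (a e \<omega>)" for e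
      using thr_bounds(3)[of e] by (auto simp: s_def bulk_def trunc_def)
    have sa: "s e = a e \<omega>" "bulk {} e \<omega> = 0" if "e \<in> E" for e
      using that s0[of e] by (auto simp: E_def s_def bulk_def trunc_def)
    have E: "E = {e \<in> ?E. thr e < cmod (a e \<omega>)}" by (auto simp: E_def s0)
    have EE: "E \<subseteq> ?E" by (auto simp: E_def)
    have sS: "cmod (s e) \<le> S" if "e \<in> E" for e
      using n(2) that sa[OF that] \<omega>M EE unfolding B2_def by (auto simp: not_less)
    have noloop: "u \<noteq> v" if "(u, v) \<in> E" for u v
    proof
      assume "u = v"
      then have "u \<in> V" "\<delta> < cmod (a (u, u) \<omega>)" using that by (auto simp: E thr_def)
      then show False using n(1) \<omega>M by (auto simp: B1_def)
    qed
    have large: "\<omega> \<in> all_large Z" if "Z \<subseteq> E" for Z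
      using that \<omega>M by (auto simp: all_large_def E)
    have no2: "(v, u) \<notin> E" if "(u, v) \<in> E" for u v
    proof
      assume vu: "(v, u) \<in> E"
      have "(u, v) \<in> I4" using that noloop[OF that] EE by (auto simp: I4_def)
      moreover have "\<omega> \<in> all_large {(u, v), (v, u)}" using that vu by (intro large) auto
      ultimately show False using n(4) by (auto simp: B4_def)
    qed
    have no3: "(x, y) \<notin> E" if "(u, v) \<in> E" "(v, x) \<in> E" for u v x y
    proof
      assume xy: "(x, y) \<in> E"
      have "u \<noteq> v" "v \<noteq> x" "x \<noteq> y" using noloop that xy by auto
      moreover have "u \<noteq> x" using no2[OF that(1)] that(2) by auto
      ultimately have "card {(u, v), (v, x), (x, y)} = 3" by auto
      then have "(u, v, x, y) \<in> I5" using that xy EE by (auto simp: I5_def)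
      moreover have "\<omega> \<in> all_large {(u, v), (v, x), (x, y)}" using that xy by (intro large) auto
      ultimately show False using n(5) by (auto simp: B5_def)
    qed
    \<comment> \<open>The entries in \<open>Z\<close> are large, so that removing them from the bulk changes nothing.\<close>
    have fp: "large_prod S Z \<omega> * cmod (first_passage V (\<lambda>e. bulk {} e \<omega>) j q y) \<le> t"
      if Z: "Z \<subseteq> E" "card Z \<in> {1..3}" and qy: "q \<in> snd ` Z" "y \<in> fst ` Z" and j: "j < k" for Z q y j
    proof -
      have b: "bulk Z e \<omega> = bulk {} e \<omega>" for e
        using sa(2)[of e] Z(1) by (auto simp: bulk_def)
      have "\<omega> \<notin> P Z" using n(7) Z EE by (auto simp: B7_def)
      then show ?thesis using qy j \<omega>M by (force simp: P_def b not_less)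
    qed
    have lg: "large S e (a e \<omega>) = max 1 (cmod (s e))" if "e \<in> E" for e
      using that sS[OF that] sa(1)[OF that] by (auto simp: large_def E)
    have lgp: "prod (\<lambda>e. cmod (s e)) Y \<le> large_prod S Z \<omega>" if "Y \<subseteq> Z" "Z \<subseteq> E" for Y Z
    proof -
      have finZ: "finite Z" using that(2) EE finE by (auto intro: finite_subset)
      have "prod (\<lambda>e. cmod (s e)) Y \<le> prod (\<lambda>e. max 1 (cmod (s e))) Y" by (intro prod_mono) auto
      also have "\<dots> \<le> prod (\<lambda>e. max 1 (cmod (s e))) Y * prod (\<lambda>e. max 1 (cmod (s e))) (Z - Y)"
      proof -
        have "1 \<le> prod (\<lambda>e. max 1 (cmod (s e))) (Z - Y)" by (intro prod_ge_1) auto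
        moreover have "0 \<le> prod (\<lambda>e. max 1 (cmod (s e))) Y" by (intro prod_nonneg) auto
        ultimately show ?thesis by (simp add: mult_left_mono mult_le_cancel_left1)
      qed
      also have "\<dots> = prod (\<lambda>e. max 1 (cmod (s e))) Z"
        by (subst prod.subset_diff[OF that(1) finZ]) (rule mult.commute)
      also have "\<dots> = large_prod S Z \<omega>" unfolding large_prod_def using lg that by (intro prod.cong) auto
      finally show ?thesis .
    qed
    show ?thesis
      unfolding tame_def Let_def s_def[symmetric] E_def[symmetric]
    proof (intro conjI allI ballI impI)
      show "cmod (mat_iter V (\<lambda>e. bulk {} e \<omega>) l (unit_at y) q) \<le> R" if "q \<in> V" "y \<in> V" "l \<le> k" for q y l
        using n(6) that \<omega>M by (force simp: B6_def I6_def not_less)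
      show "cmod (s e) \<le> S" if "e \<in> E" for e by (rule sS[OF that])
      show "real (card E) \<le> L" using n(3) \<omega>M by (simp add: B3_def E not_less)
      show "(x, y) \<notin> E" if "(u, v) \<in> E" "(v, x) \<in> E" for u v x y by (rule no3[OF that])
      show "cmod (s (p, q)) * cmod (first_passage V (\<lambda>e. bulk {} e \<omega>) j q y) \<le> t"
        if "j < k" "(p, q) \<in> E" "(y, x) \<in> E" for p q y x j
      proof -
        let ?Z = "{(p, q), (y, x)}"
        have "card ?Z \<in> {1..3}" by (auto simp: card_insert_if)
        then have "large_prod S ?Z \<omega> * cmod (first_passage V (\<lambda>e. bulk {} e \<omega>) j q y) \<le> t"
          using that by (intro fp) auto
        moreover have "cmod (s (p, q)) \<le> large_prod S ?Z \<omega>" using lgp[of "{(p, q)}" ?Z] that by auto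
        ultimately show ?thesis by (meson mult_right_mono norm_ge_zero order_trans)
      qed
      show "cmod (s (o', p)) * cmod (s (p, q)) * cmod (first_passage V (\<lambda>e. bulk {} e \<omega>) j q y) \<le> t"
        if "j < k" "(o', p) \<in> E" "(p, q) \<in> E" "(y, x) \<in> E" for o' p q y x j
      proof -
        let ?Z = "{(o', p), (p, q), (y, x)}"
        have ne: "(o', p) \<noteq> (p, q)" using noloop[OF that(2)] by auto
        have "card ?Z \<in> {1..3}" by (auto simp: card_insert_if)
        then have "large_prod S ?Z \<omega> * cmod (first_passage V (\<lambda>e. bulk {} e \<omega>) j q y) \<le> t"
          using that by (intro fp) auto
        moreover have "cmod (s (o', p)) * cmod (s (p, q)) \<le> large_prod S ?Z \<omega>"
          using lgp[of "{(o', p), (p, q)}" ?Z] that ne by auto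
        ultimately show ?thesis by (meson mult_right_mono norm_ge_zero order_trans)
      qed
    qed
  qed
  with ev pr show ?thesis unfolding \<beta>_def by blast
qed

lemma tame_no_large_eigenvalue:
  fixes V :: "'v set" and k :: nat and L R S t :: real
  assumes "finite V" and tame: "tame V k L R S t a b"
    and S: "0 \<le> S" and t: "0 \<le> t" and z: "1 \<le> \<zeta>" "\<zeta> \<le> cmod z"
    and N1: "2 * real (card V) * R \<le> \<zeta> ^ k"
    and N2: "2 * (1 + L) * (L\<^sup>2 * (real k)\<^sup>2 * t * R) \<le> 1"
    and N3: "4 * real k * L * R * (1 + L) * (1 + S) * (L * S * real (card V) * R) < \<zeta> ^ k"
    and eig: "\<And>u. u \<in> V \<Longrightarrow> (\<Sum>v\<in>V. a (u, v) * x v) = z * x u" and u: "u \<in> V"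
  shows "x u = 0"
proof (rule ccontr)
  assume nz: "x u \<noteq> 0"
  have zk: "\<zeta> ^ k \<le> cmod z ^ k" using z by (intro power_mono) auto
  note T = tame[unfolded tame_def Let_def]
  show False
    by (rule no_large_eigenvalue[OF assms(1), where a = a and b = b and R = R and \<Sigma> = S and L = L and t = t
          and k = k and z = z and x = x, OF _ _ S _ _ _ _ t _ _ N2 _ eig u nz])
       (use T z N1 N3 zk in \<open>(blast | linarith)+\<close>)
qed

section \<open>Choice of the parameters\<close>

text \<open>
  The numerical conditions on \<open>n\<close>, for truncation at \<open>\<tau>\<close>, \<open>p\<close> as in \<open>tail_prob\<close>, at most \<open>L\<close> large entries of
  modulus at most \<open>S\<close>, entries of powers of the bulk bounded by \<open>R\<close>, first passages between large entries
  bounded by \<open>t\<close>, and walks of length at most \<open>l\<close>. The exponents are chosen such that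
  \<open>L ^ 3 R t\<close> still tends to 0, which beats all sums over large entries, and that the failure probabilities
  are at most \<open>\<epsilon> = x powr (-5/4)\<close>. The moment of order 1600 is what a union bound over all entries needs,
  given that \<open>R\<close> exceeds the bound \<open>g\<close> of \<open>moment_bound\<close> by the factor \<open>x powr (1/400)\<close> only.
\<close>

definition suitable_size :: "real \<Rightarrow> real \<Rightarrow> real \<Rightarrow> real \<Rightarrow> nat \<Rightarrow> bool" where
  "suitable_size D C \<delta> m n \<longleftrightarrow> (let x = real n; l = C * ln x + 1; N = m * x; \<tau> = x powr (-1/200);
      p = D * (1 / x)\<^sup>2 / \<tau> ^ 4; R = x powr (1/200); L = x powr (1/40); S = x powr (1/2); t = x powr (-1/10);
      K = x powr (1/1600); g = x powr (1/400); \<epsilon> = x powr (-5/4) in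
    1 \<le> x \<and> \<tau> \<le> \<delta> \<and> D * (1 / x) \<le> \<tau> ^ 3 \<and>
    (1 + 1600 * l) / K + (1600 * l + 1) * (1 / x) * K\<^sup>2 + 1600 * l * \<tau> \<le> \<delta> \<and>
    exp 2 \<le> x powr (1/3200) \<and>
    2 * N * R \<le> x powr 20 \<and>
    2 * (1 + L) * (L\<^sup>2 * l\<^sup>2 * t * R) \<le> 1 \<and>
    4 * l * L * R * (1 + L) * (1 + S) * (L * S * N * R) < x powr 20 \<and>
    N\<^sup>2 * (D * (1 / x)\<^sup>2 / S ^ 4) \<le> \<epsilon> \<and>
    exp (N\<^sup>2 * p) / 2 powr L \<le> \<epsilon> \<and>
    N\<^sup>2 * p\<^sup>2 \<le> \<epsilon> \<and>
    N ^ 4 * p ^ 3 \<le> \<epsilon> \<and>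
    N\<^sup>2 * (l + 1) * (g / R) ^ 1600 \<le> \<epsilon> \<and>
    (\<forall>z\<in>{1, 2, 3}. N ^ (2 * z) * (9 * l * ((D * (1 / x)\<^sup>2 / \<tau> ^ 3 * g ^ 4) * p ^ z / t ^ 4)) \<le> \<epsilon>))"

lemma eventually_suitable_size:
  assumes D: "1 \<le> D" and C: "0 < C" and \<delta>: "0 < \<delta>" and m: "1 \<le> m"
  shows "\<forall>\<^sub>F n in sequentially. suitable_size D C \<delta> m n"
proof -
  have z: "\<forall>\<^sub>F n in sequentially. (m * real n) ^ (2 * z) * (9 * (C * ln (real n) + 1) *
      ((D * (1 / real n)\<^sup>2 / (real n powr (-1/200)) ^ 3 * (real n powr (1/400)) ^ 4)
        * (D * (1 / real n)\<^sup>2 / (real n powr (-1/200)) ^ 4) ^ z / (real n powr (-1/10)) ^ 4))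
      \<le> real n powr (-5/4)" if "z \<in> {1, 2, 3}" for z :: nat
  proof -
    from that consider "z = 1" | "z = 2" | "z = 3" by auto
    then show ?thesis using assms by cases (simp only:, real_asymp)+
  qed
  show ?thesis
    unfolding suitable_size_def Let_def
    by (intro eventually_conj eventually_ball_finite ballI z) (simp | use assms in real_asymp)+
qed

text \<open>
  The walks have length \<open>k\<close>, about \<open>C ln n\<close>, so that \<open>\<zeta> ^ k\<close> exceeds \<open>n ^ 20\<close> and dominates all polynomial
  factors. The constant \<open>\<delta>\<close> in the growth rate of the walks contributes \<open>(1 + 2 \<delta>) ^ k\<close>, a power of
  \<open>n\<close> whose exponent is small if \<open>\<delta>\<close> is chosen after \<open>C\<close>.
\<close>

lemma (in edge_family) eigenvalue_event:
  fixes n m :: nat and C \<zeta> :: real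
  assumes size: "suitable_size D C \<delta> (real m) n"
    and r\<^sub>0: "r\<^sub>0 = 1 / real n" and \<tau>\<^sub>0: "\<tau>\<^sub>0 = real n powr (-1/200)" and cV: "card V = m * n"
    and C: "0 < C" "20 \<le> C * ln \<zeta>" "2 * \<delta> * C \<le> 1/3200" and \<zeta>: "1 < \<zeta>"
  shows "\<exists>Bad\<in>events. prob Bad \<le> (\<Sum>u\<in>V. prob {\<omega> \<in> space M. \<delta> < cmod (a (u, u) \<omega>)}) + 8 * real n powr (-5/4)
    \<and> (\<forall>\<omega>\<in>space M - Bad. \<forall>z x. \<zeta> \<le> cmod z \<longrightarrow>
        (\<forall>u\<in>V. (\<Sum>v\<in>V. a (u, v) \<omega> * x v) = z * x u) \<longrightarrow> (\<forall>u\<in>V. x u = 0))"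
proof -
  define y where "y = real n"
  define k where "k = nat \<lceil>C * ln y\<rceil>"
  define l where "l = C * ln y + 1"
  define N where "N = real m * y"
  define p where "p = D * (1 / y)\<^sup>2 / (y powr (-1/200)) ^ 4"
  define R where "R = y powr (1/200)"
  define L where "L = y powr (1/40)"
  define S where "S = y powr (1/2)"
  define t where "t = y powr (-1/10)"
  define K where "K = y powr (1/1600)"
  define g where "g = y powr (1/400)"
  define \<epsilon> where "\<epsilon> = y powr (-5/4)"
  have sz: "1 \<le> y" "(1 + 1600 * l) / K + (1600 * l + 1) * (1 / y) * K\<^sup>2 + 1600 * l * y powr (-1/200) \<le> \<delta>"
    "exp 2 \<le> y powr (1/3200)" "2 * N * R \<le> y powr 20"
    "2 * (1 + L) * (L\<^sup>2 * l\<^sup>2 * t * R) \<le> 1"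
    "4 * l * L * R * (1 + L) * (1 + S) * (L * S * N * R) < y powr 20"
    "N\<^sup>2 * (D * (1 / y)\<^sup>2 / S ^ 4) \<le> \<epsilon>" "exp (N\<^sup>2 * p) / 2 powr L \<le> \<epsilon>" "N\<^sup>2 * p\<^sup>2 \<le> \<epsilon>" "N ^ 4 * p ^ 3 \<le> \<epsilon>"
    "N\<^sup>2 * (l + 1) * (g / R) ^ 1600 \<le> \<epsilon>"
    and sz7: "\<And>z. z \<in> {1, 2, 3} \<Longrightarrow> N ^ (2 * z) * (9 * l * ((D * (1 / y)\<^sup>2 / (y powr (-1/200)) ^ 3 * g ^ 4) * p ^ z / t ^ 4)) \<le> \<epsilon>"
    using size unfolding suitable_size_def Let_def y_def[symmetric] l_def[symmetric] N_def[symmetric]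
      R_def[symmetric] L_def[symmetric] S_def[symmetric] t_def[symmetric] K_def[symmetric] g_def[symmetric]
      \<epsilon>_def[symmetric] p_def[symmetric] by blast+
  have y0: "0 < y" using sz(1) by simp
  have pos: "0 < R" "0 < L" "0 < S" "0 < t" "0 < g" using y0 by (simp_all add: R_def L_def S_def t_def g_def)
  have K1: "1 \<le> K" using sz(1) by (simp add: K_def ge_one_powr_ge_zero)
  have lny: "0 \<le> C * ln y" using C sz(1) by simp
  have kl: "real k \<le> l" "C * ln y \<le> real k" unfolding k_def l_def using lny by linarith+
  have l1: "1 \<le> l" using lny by (simp add: l_def)
  have \<delta>0: "0 \<le> \<delta>" using \<tau>\<^sub>0_pos \<tau>\<^sub>0_le by linarith
  have N: "real (card V) = N" by (simp add: cV N_def y_def)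
  have N0: "0 \<le> N" using y0 by (simp add: N_def)
  have tp: "tail_prob = p"
  proof -
    have "tail_prob = D * r\<^sub>0\<^sup>2 / \<tau>\<^sub>0 ^ 4" by (rule tail_prob_def)
    also have "\<dots> = p" by (simp add: p_def y_def r\<^sub>0 \<tau>\<^sub>0)
    finally show ?thesis .
  qed
  have p0: "0 \<le> p" using tail_prob_nonneg tp by simp
  \<comment> \<open>1600 walks of length \<open>k\<close> make at most \<open>H\<close> visits in total.\<close>
  define H where "H = 1600 * k"
  define G where "G = step_growth K H"
  have G1: "1 \<le> G" using step_growth_ge_1[OF K1] by (simp add: G_def)
  have "G \<le> 1 + 2 * \<delta>"
  proof -
    have Hl: "real H \<le> 1600 * l" using kl by (simp add: H_def)
    have "(1 + real H) / K \<le> (1 + 1600 * l) / K" using Hl K1 by (intro divide_right_mono) auto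
    moreover have "(real H + 1) * (1 / y) * K\<^sup>2 \<le> (1600 * l + 1) * (1 / y) * K\<^sup>2"
      using Hl y0 by (intro mult_right_mono) auto
    moreover have "real H * y powr (-1/200) \<le> 1600 * l * y powr (-1/200)"
      using Hl by (intro mult_right_mono) auto
    moreover have "G = 1 + (1 + real H) / K + (real H + 1) * (1 / y) * K\<^sup>2 + real H * y powr (-1/200) + \<delta>"
    proof -
      have "G = 1 + (1 + real H) / K + (real H + 1) * r\<^sub>0 * K\<^sup>2 + real H * \<tau>\<^sub>0 + \<delta>"
        unfolding G_def by (rule step_growth_eq[OF K1])
      then show ?thesis by (simp only: r\<^sub>0 \<tau>\<^sub>0 y_def)
    qed
    ultimately show ?thesis using sz(2) by linarith
  qed
  also have "\<dots> \<le> exp (2 * \<delta>)" by (rule exp_ge_add_one_self)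
  finally have "G ^ k \<le> exp (2 * \<delta>) ^ k" using G1 by (intro power_mono) auto
  also have "\<dots> = exp (2 * \<delta> * real k)" by (simp add: exp_of_nat_mult[symmetric] mult.commute)
  also have "\<dots> \<le> exp (2 * \<delta> * C * ln y + 2)"
  proof -
    have "2 * \<delta> * real k \<le> 2 * \<delta> * l" using kl \<delta>0 by (intro mult_left_mono) auto
    also have "\<dots> = 2 * \<delta> * C * ln y + 2 * \<delta>" by (simp add: l_def algebra_simps)
    finally show ?thesis using \<delta>_le_1 by simp
  qed
  also have "\<dots> \<le> exp (1/3200 * ln y + 2)"
  proof -
    have "2 * \<delta> * C * ln y \<le> 1/3200 * ln y" using C(3) sz(1) by (intro mult_right_mono) auto
    then show ?thesis by simp
  qed
  also have "\<dots> = y powr (1/3200) * exp 2" using y0 by (simp add: exp_add powr_def)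
  also have "\<dots> \<le> y powr (1/3200) * y powr (1/3200)" using sz(3) by (intro mult_left_mono) auto
  also have "\<dots> = y powr (1/1600)" using y0 by (simp add: powr_add[symmetric])
  also have "\<dots> \<le> y powr (1/800)" using sz(1) by (intro powr_mono) auto
  finally have Gk: "G ^ k \<le> y powr (1/800)" .
  have gg: "K\<^sup>2 * G ^ k \<le> g"
  proof -
    have "K\<^sup>2 = y powr (1/800)" using y0 by (simp add: K_def power2_eq_square powr_add[symmetric])
    then have "K\<^sup>2 * G ^ k \<le> y powr (1/800) * y powr (1/800)" using Gk by (simp add: mult_left_mono)
    also have "\<dots> = g" using y0 by (simp add: g_def powr_add[symmetric])
    finally show ?thesis .
  qed
  have KG0: "0 \<le> K\<^sup>2 * G ^ k" using G1 by simp
  have "2 * 800 * k \<le> H" "4 * k \<le> H" by (simp_all add: H_def)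
  from exceptional_event[OF K1 pos(3) pos(1) pos(4) this, of L, unfolded N tp G_def[symmetric]]
  obtain Bad where Bad: "Bad \<in> events" and prB: "prob Bad \<le>
      (\<Sum>u\<in>V. prob {\<omega> \<in> space M. \<delta> < cmod (a (u, u) \<omega>)}) +
      N\<^sup>2 * (D * r\<^sub>0\<^sup>2 / S ^ 4) + exp (N\<^sup>2 * p) / 2 powr L + N\<^sup>2 * p\<^sup>2 + N ^ 4 * p ^ 3
      + N\<^sup>2 * (real k + 1) * ((K\<^sup>2 * G ^ k) ^ (2 * 800) / R ^ (2 * 800))
      + (\<Sum>z\<in>{1..3}. N ^ (2 * z) * (9 * real k * ((D * r\<^sub>0\<^sup>2 / \<tau>\<^sub>0 ^ 3 * (K\<^sup>2 * G ^ k) ^ 4) * p ^ z / t ^ 4)))"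
    and tm: "\<And>\<omega>. \<omega> \<in> space M - Bad \<Longrightarrow> tame V k L R S t (\<lambda>e. a e \<omega>) (\<lambda>e. bulk {} e \<omega>)"
    by blast
  have T6: "N\<^sup>2 * (real k + 1) * ((K\<^sup>2 * G ^ k) ^ (2 * 800) / R ^ (2 * 800)) \<le> \<epsilon>"
  proof -
    have "N\<^sup>2 * (real k + 1) * ((K\<^sup>2 * G ^ k) ^ (2 * 800) / R ^ (2 * 800))
       \<le> N\<^sup>2 * (l + 1) * (g ^ (2 * 800) / R ^ (2 * 800))"
      using kl l1 gg KG0 pos N0 by (intro mult_mono divide_right_mono power_mono) auto
    also have "\<dots> = N\<^sup>2 * (l + 1) * (g / R) ^ 1600" by (simp add: power_divide)
    finally show ?thesis using sz(11) by linarith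
  qed
  have T7: "N ^ (2 * z) * (9 * real k * ((D * r\<^sub>0\<^sup>2 / \<tau>\<^sub>0 ^ 3 * (K\<^sup>2 * G ^ k) ^ 4) * p ^ z / t ^ 4)) \<le> \<epsilon>"
    if z: "z \<in> {1, 2, 3}" for z
  proof -
    have A: "0 \<le> D * r\<^sub>0\<^sup>2 / \<tau>\<^sub>0 ^ 3" using D_ge_1 \<tau>\<^sub>0_pos by simp
    have "(D * r\<^sub>0\<^sup>2 / \<tau>\<^sub>0 ^ 3 * (K\<^sup>2 * G ^ k) ^ 4) * p ^ z / t ^ 4 \<le> (D * r\<^sub>0\<^sup>2 / \<tau>\<^sub>0 ^ 3 * g ^ 4) * p ^ z / t ^ 4"
      using A gg KG0 p0 pos by (intro divide_right_mono mult_right_mono mult_left_mono power_mono) auto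
    moreover have "0 \<le> (D * r\<^sub>0\<^sup>2 / \<tau>\<^sub>0 ^ 3 * (K\<^sup>2 * G ^ k) ^ 4) * p ^ z / t ^ 4"
      using pos mult_nonneg_nonneg[OF mult_nonneg_nonneg[OF A zero_le_power[OF KG0]] zero_le_power[OF p0]]
      by (intro divide_nonneg_pos) auto
    ultimately have "N ^ (2 * z) * (9 * real k * ((D * r\<^sub>0\<^sup>2 / \<tau>\<^sub>0 ^ 3 * (K\<^sup>2 * G ^ k) ^ 4) * p ^ z / t ^ 4))
       \<le> N ^ (2 * z) * (9 * l * ((D * r\<^sub>0\<^sup>2 / \<tau>\<^sub>0 ^ 3 * g ^ 4) * p ^ z / t ^ 4))"
      using kl N0 l1 by (intro mult_left_mono mult_mono) auto
    also have "\<dots> \<le> \<epsilon>" using sz7[OF z] by (simp add: r\<^sub>0 \<tau>\<^sub>0 y_def)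
    finally show ?thesis .
  qed
  have "(\<Sum>z\<in>{1..3}. N ^ (2 * z) * (9 * real k * ((D * r\<^sub>0\<^sup>2 / \<tau>\<^sub>0 ^ 3 * (K\<^sup>2 * G ^ k) ^ 4) * p ^ z / t ^ 4)))
     \<le> (\<Sum>z\<in>{1..3::nat}. \<epsilon>)"
    by (rule sum_mono, rule T7) auto
  also have "\<dots> = 3 * \<epsilon>" by simp
  finally have T7': "(\<Sum>z\<in>{1..3}. N ^ (2 * z) * (9 * real k * ((D * r\<^sub>0\<^sup>2 / \<tau>\<^sub>0 ^ 3 * (K\<^sup>2 * G ^ k) ^ 4) * p ^ z / t ^ 4))) \<le> 3 * \<epsilon>" .
  have T2: "N\<^sup>2 * (D * r\<^sub>0\<^sup>2 / S ^ 4) \<le> \<epsilon>" using sz(7) by (simp add: r\<^sub>0 y_def)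
  have pr: "prob Bad \<le> (\<Sum>u\<in>V. prob {\<omega> \<in> space M. \<delta> < cmod (a (u, u) \<omega>)}) + 8 * \<epsilon>"
    using prB T2 sz(8-10) T6 T7' by linarith
  have \<zeta>k: "y powr 20 \<le> \<zeta> ^ k"
  proof -
    have "20 * ln y \<le> C * ln \<zeta> * ln y" using C(2) sz(1) by (intro mult_right_mono) auto
    also have "\<dots> = (C * ln y) * ln \<zeta>" by simp
    also have "\<dots> \<le> real k * ln \<zeta>" using kl \<zeta> by (intro mult_right_mono) auto
    finally have "exp (20 * ln y) \<le> exp (real k * ln \<zeta>)" by simp
    then show ?thesis using y0 \<zeta> by (simp add: powr_def exp_of_nat_mult)
  qed
  have "x u = 0" if \<omega>: "\<omega> \<in> space M - Bad" and z: "\<zeta> \<le> cmod z"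
    and eig: "\<forall>u\<in>V. (\<Sum>v\<in>V. a (u, v) \<omega> * x v) = z * x u" and u: "u \<in> V" for \<omega> z x u
  proof (rule tame_no_large_eigenvalue[OF finite_V tm[OF \<omega>] _ _ _ z _ _ _ _ u, of x])
    show "2 * real (card V) * R \<le> \<zeta> ^ k" using sz(4) \<zeta>k N by simp
    have kk: "(real k)\<^sup>2 \<le> l\<^sup>2" using kl by (intro power_mono) auto
    have "2 * (1 + L) * (L\<^sup>2 * (real k)\<^sup>2 * t * R) \<le> 2 * (1 + L) * (L\<^sup>2 * l\<^sup>2 * t * R)"
      using kk pos by (intro mult_left_mono mult_right_mono) auto
    then show "2 * (1 + L) * (L\<^sup>2 * (real k)\<^sup>2 * t * R) \<le> 1" using sz(5) by linarith
    have "4 * real k * L * R * (1 + L) * (1 + S) * (L * S * real (card V) * R)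
       \<le> 4 * l * L * R * (1 + L) * (1 + S) * (L * S * N * R)"
      unfolding N using kl pos N0 by (intro mult_right_mono mult_left_mono) auto
    then show "4 * real k * L * R * (1 + L) * (1 + S) * (L * S * real (card V) * R) < \<zeta> ^ k"
      using sz(6) \<zeta>k by linarith
  qed (use pos \<zeta> eig in auto)
  with Bad pr show ?thesis unfolding \<epsilon>_def y_def by blast
qed

section \<open>The cyclic block matrix of a product\<close>

lemma complex_root_exists:
  fixes z :: complex assumes "0 < m" shows "\<exists>w. w ^ m = z"
proof -
  have "(rcis (root m (cmod z)) (Arg z / m)) ^ m = z"
    using assms by (simp add: DeMoivre2 real_root_pow_pos2 rcis_cmod_Arg)
  then show ?thesis by blast
qed

lemma sum_nat_below_le_square:
  fixes Y :: real assumes "0 \<le> Y"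
  shows "(\<Sum>n<B. real n * of_bool (real n < Y)) \<le> Y\<^sup>2"
proof -
  have "(\<Sum>n<B. real n * of_bool (real n < Y)) \<le> (\<Sum>n\<in>{1..nat \<lfloor>Y\<rfloor>}. Y)"
  proof -
    have "(\<Sum>n<B. real n * of_bool (real n < Y)) = (\<Sum>n\<in>{n. n < B \<and> 1 \<le> n \<and> real n < Y}. real n)"
      by (intro sum.mono_neutral_cong_right) auto
    also have "\<dots> \<le> (\<Sum>n\<in>{n. n < B \<and> 1 \<le> n \<and> real n < Y}. Y)" by (intro sum_mono) auto
    also have "\<dots> \<le> (\<Sum>n\<in>{1..nat \<lfloor>Y\<rfloor>}. Y)"
    proof (rule sum_mono2)
      show "{n. n < B \<and> 1 \<le> n \<and> real n < Y} \<subseteq> {1..nat \<lfloor>Y\<rfloor>}"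
        by (auto simp: le_nat_floor)
    qed (use assms in auto)
    finally show ?thesis .
  qed
  also have "\<dots> = real (nat \<lfloor>Y\<rfloor>) * Y" by simp
  also have "\<dots> \<le> Y * Y" using assms by (intro mult_right_mono) auto
  finally show ?thesis by (simp add: power2_eq_square)
qed

text \<open>
  Pointwise, the sum of all \<open>n < Y\<close> is at most \<open>Y\<^sup>2\<close>.
\<close>

lemma (in prob_space) summable_weighted_tail:
  fixes Y :: "'a \<Rightarrow> real"
  assumes m [measurable]: "Y \<in> borel_measurable M" and nn: "\<And>\<omega>. 0 \<le> Y \<omega>"
    and i: "integrable M (\<lambda>\<omega>. (Y \<omega>)\<^sup>2)"
  shows "summable (\<lambda>n. real n * prob {\<omega> \<in> space M. real n < Y \<omega>})"
proof (rule summableI_nonneg_bounded)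
  fix B :: nat
  have ind: "integrable M (\<lambda>\<omega>. real n * of_bool (real n < Y \<omega>))" for n
    by (rule integrable_const_bound[of _ "real n"]) auto
  have "(\<Sum>n<B. real n * prob {\<omega> \<in> space M. real n < Y \<omega>})
      = (\<Sum>n<B. expectation (\<lambda>\<omega>. real n * of_bool (real n < Y \<omega>)))"
  proof (rule sum.cong)
    fix n
    have "expectation (\<lambda>\<omega>. of_bool (real n < Y \<omega>)) = expectation (indicator {\<omega> \<in> space M. real n < Y \<omega>})"
      by (intro Bochner_Integration.integral_cong) (auto simp: indicator_def)
    also have "\<dots> = prob {\<omega> \<in> space M. real n < Y \<omega>}"
    proof -
      have "{\<omega> \<in> space M. real n < Y \<omega>} \<in> events" by measurable
      then show ?thesis by simp
    qed
    finally show "real n * prob {\<omega> \<in> space M. real n < Y \<omega>} = expectation (\<lambda>\<omega>. real n * of_bool (real n < Y \<omega>))"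
      by (subst integral_mult_right_zero) simp
  qed simp
  also have "\<dots> = expectation (\<lambda>\<omega>. \<Sum>n<B. real n * of_bool (real n < Y \<omega>))"
    using ind by (intro Bochner_Integration.integral_sum[symmetric])
  also have "\<dots> \<le> expectation (\<lambda>\<omega>. (Y \<omega>)\<^sup>2)"
    using ind i nn sum_nat_below_le_square by (intro integral_mono Bochner_Integration.integrable_sum) auto
  finally show "(\<Sum>n<B. real n * prob {\<omega> \<in> space M. real n < Y \<omega>}) \<le> expectation (\<lambda>\<omega>. (Y \<omega>)\<^sup>2)" .
qed simp

locale iid_product =
  M: prob_space M + N: prob_space N
  for M :: "'a measure" and N :: "'b measure" +
  fixes m :: nat and \<xi> :: "nat \<Rightarrow> 'b \<Rightarrow> complex" and X :: "nat \<Rightarrow> nat \<Rightarrow> 'a \<Rightarrow> complex mat"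
  assumes m_ge_1: "m \<ge> 1"
    and \<xi>_measurable: "\<And>k. k \<in> {1..m} \<Longrightarrow> \<xi> k \<in> borel_measurable N"
    and \<xi>_mean: "\<And>k. k \<in> {1..m} \<Longrightarrow> integrable N (\<xi> k) \<and> (\<integral>\<omega>. \<xi> k \<omega> \<partial>N) = 0"
    and \<xi>_fourth: "\<And>k. k \<in> {1..m} \<Longrightarrow> integrable N (\<lambda>\<omega>. cmod (\<xi> k \<omega>) ^ 4)"
    and \<xi>_var: "\<And>k. k \<in> {1..m} \<Longrightarrow> complex_variance N (\<xi> k) \<noteq> 0"
    and X_iid: "\<And>n k. n \<ge> 1 \<Longrightarrow> k \<in> {1..m} \<Longrightarrow> iid_random_matrix M n N (\<xi> k) (X n k)"
    and X_indep: "\<And>n. n \<ge> 1 \<Longrightarrow> M.indep_vars (\<lambda>_. mat_borel n) (X n) {1..m}"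
begin

abbreviation sd :: "nat \<Rightarrow> real" where "sd k \<equiv> std_dev N (\<xi> k)"

definition next_layer :: "nat \<Rightarrow> nat" where
  "next_layer k = (if k = m then 1 else Suc k)"

text \<open>
  The vertex \<open>(k, i)\<close> is the index \<open>i\<close> in layer \<open>k\<close>.
\<close>

definition verts :: "nat \<Rightarrow> (nat \<times> nat) set" where
  "verts n = {1..m} \<times> {..<n}"

definition is_edge :: "nat \<Rightarrow> (nat \<times> nat) \<times> (nat \<times> nat) \<Rightarrow> bool" where
  "is_edge n e \<longleftrightarrow> fst (fst e) \<in> {1..m} \<and> snd (fst e) < n \<and> snd (snd e) < n \<and> fst (snd e) = next_layer (fst (fst e))"

definition entry :: "nat \<Rightarrow> (nat \<times> nat) \<times> (nat \<times> nat) \<Rightarrow> 'a \<Rightarrow> complex" where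
  "entry n e \<omega> = (if is_edge n e
     then X n (fst (fst e)) \<omega> $$ (snd (fst e), snd (snd e)) / complex_of_real (sd (fst (fst e)) * sqrt (real n)) else 0)"

definition edge_var :: "nat \<Rightarrow> (nat \<times> nat) \<times> (nat \<times> nat) \<Rightarrow> real" where
  "edge_var n e = (if is_edge n e then 1 / real n else 0)"

text \<open>
  A common bound for the fourth moments of the normalized atom variables, made at least 1.
\<close>

definition kurt :: real where
  "kurt = 1 + (\<Sum>k\<in>{1..m}. (\<integral>\<omega>. cmod (\<xi> k \<omega>) ^ 4 \<partial>N) / sd k ^ 4)"

lemma next_layer: "k \<in> {1..m} \<Longrightarrow> next_layer k \<in> {1..m}"
  by (auto simp: next_layer_def)

lemma sd_sq: "k \<in> {1..m} \<Longrightarrow> sd k ^ 2 = (\<integral>\<omega>. cmod (\<xi> k \<omega>) ^ 2 \<partial>N)"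
  and sd_pos: "k \<in> {1..m} \<Longrightarrow> 0 < sd k"
proof -
  assume k: "k \<in> {1..m}"
  have v: "complex_variance N (\<xi> k) = (\<integral>\<omega>. cmod (\<xi> k \<omega>) ^ 2 \<partial>N)"
    using \<xi>_mean[OF k] by (simp add: complex_variance_def)
  moreover have nn: "0 \<le> (\<integral>\<omega>. cmod (\<xi> k \<omega>) ^ 2 \<partial>N)" by (intro Bochner_Integration.integral_nonneg) auto
  ultimately show "sd k ^ 2 = (\<integral>\<omega>. cmod (\<xi> k \<omega>) ^ 2 \<partial>N)" by (simp add: std_dev_def)
  have "0 < complex_variance N (\<xi> k)" using nn \<xi>_var[OF k] unfolding v by linarith
  then show "0 < sd k" by (simp add: std_dev_def)
qed

lemma \<xi>_second: "k \<in> {1..m} \<Longrightarrow> integrable N (\<lambda>\<omega>. cmod (\<xi> k \<omega>) ^ 2)"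
proof -
  assume k: "k \<in> {1..m}"
  note [measurable] = \<xi>_measurable[OF k]
  have le: "y ^ 2 \<le> 1 + y ^ 4" for y :: real
  proof -
    have "0 \<le> (y\<^sup>2 - 1)\<^sup>2 + y\<^sup>2 + y\<^sup>2" by simp
    also have "\<dots> = 1 + y ^ 4" by (simp add: power2_eq_square power4_eq_xxxx algebra_simps)
    finally have "0 \<le> 1 + y ^ 4" .
    have "(y\<^sup>2 - 1)\<^sup>2 = y ^ 4 - 2 * y\<^sup>2 + 1" by (simp add: power2_eq_square power4_eq_xxxx algebra_simps)
    moreover have "0 \<le> (y\<^sup>2 - 1)\<^sup>2" "0 \<le> y\<^sup>2" by simp_all
    ultimately show ?thesis by linarith
  qed
  show ?thesis
    by (rule Bochner_Integration.integrable_bound[of N "\<lambda>\<omega>. 1 + cmod (\<xi> k \<omega>) ^ 4"])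
       (use \<xi>_fourth[OF k] le in auto)
qed

lemma X_entry:
  assumes n: "n \<ge> 1" and k: "k \<in> {1..m}" and ij: "i < n" "j < n"
  shows X_measurable: "(\<lambda>\<omega>. X n k \<omega> $$ (i, j)) \<in> borel_measurable M"
    and X_distr: "distr M borel (\<lambda>\<omega>. X n k \<omega> $$ (i, j)) = distr N borel (\<xi> k)"
  using X_iid[OF n k] ij by (auto simp: iid_random_matrix_def measurable_mat_borel_iff)

lemma X_integral:
  fixes f :: "complex \<Rightarrow> 'c :: {banach, second_countable_topology}"
  assumes "n \<ge> 1" "k \<in> {1..m}" "i < n" "j < n" and f: "f \<in> borel_measurable borel"
  shows "(\<integral>\<omega>. f (X n k \<omega> $$ (i, j)) \<partial>M) = (\<integral>\<omega>. f (\<xi> k \<omega>) \<partial>N)"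
    and "integrable N (\<lambda>\<omega>. f (\<xi> k \<omega>)) \<Longrightarrow> integrable M (\<lambda>\<omega>. f (X n k \<omega> $$ (i, j)))"
proof -
  note m = X_measurable[OF assms(1-4)] and d = X_distr[OF assms(1-4)] and \<xi> = \<xi>_measurable[OF assms(2)]
  show "(\<integral>\<omega>. f (X n k \<omega> $$ (i, j)) \<partial>M) = (\<integral>\<omega>. f (\<xi> k \<omega>) \<partial>N)"
    using integral_distr[OF m f] integral_distr[OF \<xi> f] d by simp
  assume "integrable N (\<lambda>\<omega>. f (\<xi> k \<omega>))"
  then show "integrable M (\<lambda>\<omega>. f (X n k \<omega> $$ (i, j)))"
    using integrable_distr_eq[OF m f] integrable_distr_eq[OF \<xi> f] d by simp
qed

text \<open>
  Independence of the matrices, applied to functions of whole matrices, reduces the claim to one matrix,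
  where independence of the entries applies.
\<close>

lemma matrix_factorize:
  fixes F :: "nat \<Rightarrow> nat \<times> nat \<Rightarrow> complex \<Rightarrow> complex"
  assumes n: "n \<ge> 1"
    and m: "\<And>k p. F k p \<in> borel_measurable borel" and b: "\<And>k p. \<exists>C. \<forall>z. cmod (F k p z) \<le> C"
  shows "M.expectation (\<lambda>\<omega>. \<Prod>k\<in>{1..m}. \<Prod>p\<in>{..<n} \<times> {..<n}. F k p (X n k \<omega> $$ p))
     = (\<Prod>k\<in>{1..m}. \<Prod>p\<in>{..<n} \<times> {..<n}. M.expectation (\<lambda>\<omega>. F k p (X n k \<omega> $$ p)))"
proof -
  let ?I = "{..<n} \<times> {..<n}"
  let ?h = "\<lambda>k A. \<Prod>p\<in>?I. F k p (A $$ p)"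
  have entry: "(\<lambda>A. A $$ p) \<in> borel_measurable (mat_borel n)" if "p \<in> ?I" for p
    using measurable_mat_borel_iff[of "\<lambda>A. A" "mat_borel n" n] that measurable_ident by (auto simp: id_def)
  have hm: "?h k \<in> borel_measurable (mat_borel n)" for k
    by (intro borel_measurable_prod measurable_compose[OF entry m])
  have bd: "bounded_rv M (\<lambda>\<omega>. F k p (X n k \<omega> $$ p))" if kp: "k \<in> {1..m}" "p \<in> ?I" for k p
  proof -
    obtain i j where p: "p = (i, j)" "i < n" "j < n" using kp(2) by auto
    show ?thesis unfolding bounded_rv_def p(1)
      using measurable_compose[OF X_measurable[OF n kp(1) p(2,3)] m] b[of k p] p(1) by blast
  qed
  have int: "integrable M (\<lambda>\<omega>. ?h k (X n k \<omega>))" if "k \<in> {1..m}" for k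
    using that bd by (intro M.bounded_rv_integrable bounded_rv_prod)
  have "M.indep_vars (\<lambda>_. borel) (\<lambda>k \<omega>. ?h k (X n k \<omega>)) {1..m}"
    using hm by (intro M.indep_vars_compose2[OF X_indep[OF n]])
  then have "M.expectation (\<lambda>\<omega>. \<Prod>k\<in>{1..m}. ?h k (X n k \<omega>)) = (\<Prod>k\<in>{1..m}. M.expectation (\<lambda>\<omega>. ?h k (X n k \<omega>)))"
    using int by (intro M.indep_vars_lebesgue_integral) auto
  also have "\<dots> = (\<Prod>k\<in>{1..m}. \<Prod>p\<in>?I. M.expectation (\<lambda>\<omega>. F k p (X n k \<omega> $$ p)))"
  proof (rule prod.cong)
    fix k assume k: "k \<in> {1..m}"
    have "M.indep_vars (\<lambda>_. borel) (\<lambda>p \<omega>. X n k \<omega> $$ p) ?I"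
      using X_iid[OF n k] by (simp add: iid_random_matrix_def)
    then have iv: "M.indep_vars (\<lambda>_. borel) (\<lambda>p \<omega>. F k p (X n k \<omega> $$ p)) ?I"
      by (rule M.indep_vars_compose2) (rule m)
    show "M.expectation (\<lambda>\<omega>. ?h k (X n k \<omega>)) = (\<Prod>p\<in>?I. M.expectation (\<lambda>\<omega>. F k p (X n k \<omega> $$ p)))"
      by (rule M.indep_vars_lebesgue_integral[OF _ iv M.bounded_rv_integrable[OF bd[OF k]]]) simp_all
  qed simp
  finally show ?thesis .
qed

lemma entry_factorize:
  assumes n: "n \<ge> 1"
    and f: "\<And>e. f e \<in> borel_measurable borel" and b: "\<And>e. \<exists>C. \<forall>z. cmod (f e z) \<le> C"
  shows "M.expectation (\<lambda>\<omega>. \<Prod>e\<in>verts n \<times> verts n. f e (entry n e \<omega>))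
     = (\<Prod>e\<in>verts n \<times> verts n. M.expectation (\<lambda>\<omega>. f e (entry n e \<omega>)))"
proof -
  let ?I = "{..<n} \<times> {..<n}"
  define \<iota> where "\<iota> = (\<lambda>(k, p). ((k, fst p), (next_layer k, snd p)) :: (nat \<times> nat) \<times> (nat \<times> nat))"
  define E where "E = \<iota> ` ({1..m} \<times> ?I)"
  have inj: "inj_on \<iota> ({1..m} \<times> ?I)" by (auto simp: \<iota>_def inj_on_def)
  have fin: "finite (verts n \<times> verts n)" by (simp add: verts_def)
  have sub: "E \<subseteq> verts n \<times> verts n" using next_layer by (auto simp: E_def \<iota>_def verts_def)
  have edge: "is_edge n e \<longleftrightarrow> e \<in> E" for e
    by (cases e) (force simp: is_edge_def E_def \<iota>_def)
  have split: "(\<Prod>e\<in>verts n \<times> verts n. G e) = (\<Prod>e\<in>verts n \<times> verts n - E. G e) * (\<Prod>k\<in>{1..m}. \<Prod>p\<in>?I. G (\<iota> (k, p)))"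
    for G :: "(nat \<times> nat) \<times> (nat \<times> nat) \<Rightarrow> complex"
  proof -
    have "(\<Prod>e\<in>E. G e) = (\<Prod>x\<in>{1..m} \<times> ?I. G (\<iota> x))"
      unfolding E_def by (subst prod.reindex[OF inj]) simp
    also have "\<dots> = (\<Prod>k\<in>{1..m}. \<Prod>p\<in>?I. G (\<iota> (k, p)))"
      by (simp add: prod.cartesian_product)
    finally show ?thesis using prod.subset_diff[OF sub fin, of G] by simp
  qed
  define F where "F k p z = f (\<iota> (k, p)) (z / complex_of_real (sd k * sqrt (real n)))" for k p z
  have Fe: "f (\<iota> (k, p)) (entry n (\<iota> (k, p)) \<omega>) = F k p (X n k \<omega> $$ p)" if "k \<in> {1..m}" "p \<in> ?I" for k p \<omega>
  proof -
    have "is_edge n (\<iota> (k, p))" using that by (auto simp: edge E_def)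
    then show ?thesis by (simp add: entry_def F_def \<iota>_def)
  qed
  have off: "f e (entry n e \<omega>) = f e 0" if "e \<notin> E" for e \<omega> using that by (simp add: entry_def edge)
  have Fm: "F k p \<in> borel_measurable borel" for k p
    unfolding F_def by (intro measurable_compose[OF _ f]) simp
  have Fb: "\<exists>C. \<forall>z. cmod (F k p z) \<le> C" for k p
    unfolding F_def using b[of "\<iota> (k, p)"] by blast
  let ?c = "\<Prod>e\<in>verts n \<times> verts n - E. f e 0"
  have "M.expectation (\<lambda>\<omega>. \<Prod>e\<in>verts n \<times> verts n. f e (entry n e \<omega>))
     = M.expectation (\<lambda>\<omega>. ?c * (\<Prod>k\<in>{1..m}. \<Prod>p\<in>?I. F k p (X n k \<omega> $$ p)))"
    unfolding split
    by (intro Bochner_Integration.integral_cong arg_cong2[where f = "(*)"] prod.cong refl) (auto simp: off Fe)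
  also have "\<dots> = ?c * (\<Prod>k\<in>{1..m}. \<Prod>p\<in>?I. M.expectation (\<lambda>\<omega>. F k p (X n k \<omega> $$ p)))"
    by (simp only: integral_mult_right_zero matrix_factorize[OF n Fm Fb])
  also have "\<dots> = (\<Prod>e\<in>verts n \<times> verts n. M.expectation (\<lambda>\<omega>. f e (entry n e \<omega>)))"
    unfolding split
    by (intro arg_cong2[where f = "(*)"] prod.cong refl) (auto simp: off Fe M.prob_space)
  finally show ?thesis .
qed

lemma card_verts: "card (verts n) = m * n"
  by (simp add: verts_def card_cartesian_product)

lemma edge_var_row:
  assumes n: "n \<ge> 1" and u: "u \<in> verts n"
  shows "(\<Sum>v\<in>verts n. edge_var n (u, v)) \<le> 1"
proof -
  obtain k i where u': "u = (k, i)" "k \<in> {1..m}" "i < n" using u by (auto simp: verts_def)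
  have "(\<Sum>v\<in>verts n. edge_var n (u, v)) = (\<Sum>v\<in>Pair (next_layer k) ` {..<n}. 1 / real n)"
    using u' next_layer[OF u'(2)]
    by (intro sum.mono_neutral_cong_right) (auto simp: verts_def edge_var_def is_edge_def)
  also have "\<dots> = 1" using n by (subst sum.reindex) (auto simp: inj_on_def)
  finally show ?thesis by simp
qed

lemma entry_moments_conj:
  assumes n: "n \<ge> 1"
  shows "entry n e \<in> borel_measurable M \<and> integrable M (entry n e) \<and> M.expectation (entry n e) = 0 \<and>
    integrable M (\<lambda>\<omega>. cmod (entry n e \<omega>) ^ 2) \<and> integrable M (\<lambda>\<omega>. cmod (entry n e \<omega>) ^ 4) \<and>
    M.expectation (\<lambda>\<omega>. cmod (entry n e \<omega>) ^ 2) \<le> edge_var n e \<and>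
    M.expectation (\<lambda>\<omega>. cmod (entry n e \<omega>) ^ 4) \<le> kurt * (1 / real n) * edge_var n e"
proof (cases "is_edge n e")
    case False
    then have "entry n e = (\<lambda>_. 0)" by (auto simp: entry_def)
    then show ?thesis using False by (simp add: edge_var_def)
  next
    case True
    obtain k i k' j where e: "e = ((k, i), (k', j))" by (metis prod.exhaust)
    have k: "k \<in> {1..m}" and ij: "i < n" "j < n" using True by (auto simp: is_edge_def e)
    define c where "c = sd k * sqrt (real n)"
    have c0: "0 < c" using sd_pos[OF k] n by (simp add: c_def)
    have c2: "c ^ 2 = sd k ^ 2 * real n" using n by (simp add: c_def power_mult_distrib)
    have c4: "c ^ 4 = sd k ^ 4 * (real n)\<^sup>2"
      using n by (simp add: c_def power_mult_distrib power4_eq_xxxx power2_eq_square)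
    have ent: "entry n e = (\<lambda>\<omega>. X n k \<omega> $$ (i, j) / complex_of_real c)"
      using True by (auto simp: entry_def e c_def)
    have nrm: "cmod (entry n e \<omega>) ^ r = cmod (X n k \<omega> $$ (i, j)) ^ r / c ^ r" for \<omega> r
      using c0 by (simp add: ent norm_divide power_divide)
    note XI = X_integral[OF n k ij]
    have 1: "entry n e \<in> borel_measurable M" unfolding ent using X_measurable[OF n k ij] by simp
    have 2: "integrable M (entry n e)" "M.expectation (entry n e) = 0"
      unfolding ent using XI[of "\<lambda>z. z"] \<xi>_mean[OF k] by auto
    have 3: "integrable M (\<lambda>\<omega>. cmod (entry n e \<omega>) ^ 2)" "integrable M (\<lambda>\<omega>. cmod (entry n e \<omega>) ^ 4)"
      unfolding nrm using XI(2)[of "\<lambda>z. cmod z ^ 2"] XI(2)[of "\<lambda>z. cmod z ^ 4"] \<xi>_second[OF k] \<xi>_fourth[OF k] by auto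
    have "M.expectation (\<lambda>\<omega>. cmod (entry n e \<omega>) ^ 2) = sd k ^ 2 / c ^ 2"
      unfolding nrm using XI(1)[of "\<lambda>z. cmod z ^ 2"] sd_sq[OF k] by simp
    also have "\<dots> = edge_var n e" using sd_pos[OF k] True by (simp add: c2 edge_var_def)
    finally have 4: "M.expectation (\<lambda>\<omega>. cmod (entry n e \<omega>) ^ 2) \<le> edge_var n e" by simp
    have kurt: "(\<integral>\<omega>. cmod (\<xi> k \<omega>) ^ 4 \<partial>N) / sd k ^ 4 \<le> kurt"
    proof -
      have "(\<integral>\<omega>. cmod (\<xi> k \<omega>) ^ 4 \<partial>N) / sd k ^ 4 \<le> (\<Sum>k\<in>{1..m}. (\<integral>\<omega>. cmod (\<xi> k \<omega>) ^ 4 \<partial>N) / sd k ^ 4)"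
        using k by (intro member_le_sum) auto
      then show ?thesis by (simp add: kurt_def)
    qed
    have "M.expectation (\<lambda>\<omega>. cmod (entry n e \<omega>) ^ 4) = (\<integral>\<omega>. cmod (\<xi> k \<omega>) ^ 4 \<partial>N) / sd k ^ 4 * (1 / (real n)\<^sup>2)"
      unfolding nrm using XI(1)[of "\<lambda>z. cmod z ^ 4"] by (simp add: c4)
    also have "\<dots> \<le> kurt * (1 / (real n)\<^sup>2)" using kurt by (intro mult_right_mono) auto
    also have "\<dots> = kurt * (1 / real n) * edge_var n e" using True by (simp add: edge_var_def power2_eq_square)
    finally show ?thesis using 1 2 3 4 by blast
  qed

lemmas entry_moments = entry_moments_conj[THEN conjunct1] entry_moments_conj[THEN conjunct2, THEN conjunct1]
  entry_moments_conj[THEN conjunct2, THEN conjunct2]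

lemma kurt_ge_1: "1 \<le> kurt"
  unfolding kurt_def by (auto intro!: sum_nonneg divide_nonneg_nonneg simp: zero_le_even_power' Bochner_Integration.integral_nonneg)

lemma edge_family_entry:
  assumes n: "n \<ge> 1" and "real n powr (-1/200) \<le> \<delta>" "\<delta> \<le> 1" "kurt * (1 / real n) \<le> (real n powr (-1/200)) ^ 3"
  shows "edge_family M (verts n) (entry n) (edge_var n) (1 / real n) kurt (real n powr (-1/200)) \<delta>"
  using assms entry_moments[OF n] entry_factorize[OF n] edge_var_row[OF n] kurt_ge_1
  by unfold_locales (auto simp: edge_var_def verts_def)

lemma loop_prob_le:
  assumes n: "n \<ge> 1" and \<delta>: "0 < \<delta>"
  shows "(\<Sum>u\<in>verts n. M.prob {\<omega> \<in> space M. \<delta> < cmod (entry n (u, u) \<omega>)})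
     \<le> (\<Sum>k\<in>{1..m}. real n * N.prob {\<omega> \<in> space N. real n < (cmod (\<xi> k \<omega>) / (\<delta> * sd k))\<^sup>2})"
proof -
  have each: "M.prob {\<omega> \<in> space M. \<delta> < cmod (entry n ((k, i), (k, i)) \<omega>)}
     \<le> N.prob {\<omega> \<in> space N. real n < (cmod (\<xi> k \<omega>) / (\<delta> * sd k))\<^sup>2}" if k: "k \<in> {1..m}" and i: "i < n" for k i
  proof (cases "is_edge n ((k, i), (k, i))")
    case False
    then have "{\<omega> \<in> space M. \<delta> < cmod (entry n ((k, i), (k, i)) \<omega>)} = {}" using \<delta> by (auto simp: entry_def)
    then show ?thesis by (simp only: measure_empty measure_nonneg)
  next
    case True
    note X = X_measurable[OF n k i i] and \<xi> = \<xi>_measurable[OF k]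
    have sd: "0 < sd k" using sd_pos[OF k] .
    let ?T = "{z. \<delta> < cmod z / (sd k * sqrt (real n))}"
    have T: "?T \<in> sets borel" by measurable
    have "{\<omega> \<in> space M. \<delta> < cmod (entry n ((k, i), (k, i)) \<omega>)} = (\<lambda>\<omega>. X n k \<omega> $$ (i, i)) -` ?T \<inter> space M"
      using True sd by (auto simp: entry_def norm_divide norm_mult)
    then have "M.prob {\<omega> \<in> space M. \<delta> < cmod (entry n ((k, i), (k, i)) \<omega>)}
       = measure (distr M borel (\<lambda>\<omega>. X n k \<omega> $$ (i, i))) ?T"
      by (simp add: measure_distr[OF X T])
    also have "\<dots> = N.prob (\<xi> k -` ?T \<inter> space N)"
      unfolding X_distr[OF n k i i] by (simp add: measure_distr[OF \<xi> T])
    also have "\<xi> k -` ?T \<inter> space N = {\<omega> \<in> space N. real n < (cmod (\<xi> k \<omega>) / (\<delta> * sd k))\<^sup>2}"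
    proof -
      have "\<delta> < r / (sd k * sqrt (real n)) \<longleftrightarrow> real n < (r / (\<delta> * sd k))\<^sup>2" if r: "0 \<le> r" for r
      proof -
        have "\<delta> < r / (sd k * sqrt (real n)) \<longleftrightarrow> sqrt (real n) < r / (\<delta> * sd k)"
          using sd \<delta> n by (simp add: field_simps)
        also have "\<dots> \<longleftrightarrow> sqrt (real n) < sqrt ((r / (\<delta> * sd k))\<^sup>2)"
          using sd \<delta> r by simp
        finally show ?thesis by (simp only: real_sqrt_less_iff)
      qed
      then show ?thesis by auto
    qed
    finally show ?thesis by simp
  qed
  have "(\<Sum>u\<in>verts n. M.prob {\<omega> \<in> space M. \<delta> < cmod (entry n (u, u) \<omega>)})
     = (\<Sum>k\<in>{1..m}. \<Sum>i<n. M.prob {\<omega> \<in> space M. \<delta> < cmod (entry n ((k, i), (k, i)) \<omega>)})"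
    by (simp add: verts_def sum.cartesian_product case_prod_unfold)
  also have "\<dots> \<le> (\<Sum>k\<in>{1..m}. \<Sum>i<n. N.prob {\<omega> \<in> space N. real n < (cmod (\<xi> k \<omega>) / (\<delta> * sd k))\<^sup>2})"
    using each by (intro sum_mono) auto
  finally show ?thesis by simp
qed

lemma loop_prob_summable:
  assumes \<delta>: "0 < \<delta>"
  shows "summable (\<lambda>n. \<Sum>k\<in>{1..m}. real n * N.prob {\<omega> \<in> space N. real n < (cmod (\<xi> k \<omega>) / (\<delta> * sd k))\<^sup>2})"
proof (rule summable_sum)
  fix k assume k: "k \<in> {1..m}"
  note [measurable] = \<xi>_measurable[OF k]
  have "integrable N (\<lambda>\<omega>. cmod (\<xi> k \<omega>) ^ 4 / (\<delta> * sd k) ^ 4)" using \<xi>_fourth[OF k] by simp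
  then have "integrable N (\<lambda>\<omega>. ((cmod (\<xi> k \<omega>) / (\<delta> * sd k))\<^sup>2)\<^sup>2)"
    by (simp add: power_divide)
  then show "summable (\<lambda>n. real n * N.prob {\<omega> \<in> space N. real n < (cmod (\<xi> k \<omega>) / (\<delta> * sd k))\<^sup>2})"
    by (intro N.summable_weighted_tail) auto
qed

end

section \<open>Eigenvalues of the product\<close>

context iid_product
begin

lemma X_carrier: "n \<ge> 1 \<Longrightarrow> k \<in> {1..m} \<Longrightarrow> \<omega> \<in> space M \<Longrightarrow> X n k \<omega> \<in> carrier_mat n n"
  using X_iid[of n k] by (simp add: iid_random_matrix_def measurable_mat_borel_iff)

text \<open>
  The product \<open>A k * (\<dots> * (A m * 1))\<close>, which carries an eigenvector of the full product to layer \<open>k\<close>.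
\<close>

definition tail_product :: "nat \<Rightarrow> 'a \<Rightarrow> nat \<Rightarrow> complex mat" where
  "tail_product n \<omega> k = foldr (\<lambda>j B. X n j \<omega> * B) [k..<Suc m] (1\<^sub>m n)"

lemma tail_product_end: "tail_product n \<omega> (Suc m) = 1\<^sub>m n"
  by (simp add: tail_product_def)

lemma tail_product_step: "k \<le> m \<Longrightarrow> tail_product n \<omega> k = X n k \<omega> * tail_product n \<omega> (Suc k)"
  unfolding tail_product_def by (subst upt_conv_Cons) auto

lemma tail_product_carrier:
  assumes "n \<ge> 1" "\<omega> \<in> space M" "1 \<le> k" "k \<le> Suc m"
  shows "tail_product n \<omega> k \<in> carrier_mat n n"
  using assms(4,3)
proof (induction k rule: inc_induct)
  case base
  then show ?case by (simp add: tail_product_end)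
next
  case (step k)
  then show ?case using X_carrier[OF assms(1) _ assms(2), of k] by (simp add: tail_product_step)
qed

abbreviation sigma :: real where "sigma \<equiv> \<Prod>k=1..m. sd k"

abbreviation norm_prod :: "nat \<Rightarrow> 'a \<Rightarrow> complex mat" where
  "norm_prod n \<omega> \<equiv> normalized_product n m (\<lambda>k. X n k \<omega>)"

lemma norm_prod_eq: "norm_prod n \<omega> = complex_of_real (real n powr (- (real m / 2))) \<cdot>\<^sub>m tail_product n \<omega> 1"
  by (simp add: normalized_product_def mat_product_def tail_product_def)

lemma norm_prod_carrier: "n \<ge> 1 \<Longrightarrow> \<omega> \<in> space M \<Longrightarrow> norm_prod n \<omega> \<in> carrier_mat n n"
  unfolding norm_prod_eq using tail_product_carrier[of n \<omega> 1] by auto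

lemma sigma_pos: "0 < sigma"
  using sd_pos by (intro prod_pos) auto

text \<open>
  For \<open>P v = z v\<close> and \<open>w ^ m = z / \<sigma>\<close> the vector with value \<open>A\<^sub>k \<cdots> A\<^sub>m v / w ^ (m + 1 - k)\<close> on layer \<open>k\<close>,
  with normalized blocks \<open>A\<^sub>k\<close>, is multiplied by \<open>w\<close> when the block from layer \<open>k\<close> to the next one is
  applied. The choice of \<open>w\<close> makes the first layer equal to \<open>v\<close>, so that the cycle closes.
\<close>

lemma eigenvector_lift:
  assumes n: "n \<ge> 1" and \<omega>: "\<omega> \<in> space M" and ev: "eigenvalue (norm_prod n \<omega>) z"
    and \<zeta>: "0 < \<zeta>" and z: "sigma * \<zeta> ^ m \<le> cmod z"
  obtains w x u where "\<zeta> \<le> cmod w" "u \<in> verts n" "x u \<noteq> 0"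
    "\<And>u. u \<in> verts n \<Longrightarrow> (\<Sum>v\<in>verts n. entry n (u, v) \<omega> * x v) = w * x u"
proof -
  have m0: "0 < m" using m_ge_1 by simp
  obtain w where w: "w ^ m = z / complex_of_real sigma" using complex_root_exists[OF m0] by blast
  have "\<zeta> ^ m \<le> cmod z / sigma" using z sigma_pos by (simp add: field_simps)
  also have "\<dots> = cmod w ^ m" 
    by (simp only: norm_power[symmetric] w norm_divide norm_of_real abs_of_pos[OF sigma_pos])
  finally have wz: "\<zeta> \<le> cmod w" using m0 by (simp add: power_mono_iff \<zeta> less_imp_le)
  then have w0: "w \<noteq> 0" using \<zeta> by auto
  let ?A = "\<lambda>k. X n k \<omega>"
  obtain v where v: "v \<in> carrier_vec n" "v \<noteq> 0\<^sub>v n" "norm_prod n \<omega> *\<^sub>v v = z \<cdot>\<^sub>v v"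
    using ev norm_prod_carrier[OF n \<omega>] by (auto simp: eigenvalue_def eigenvector_def)
  define y where "y k = tail_product n \<omega> k *\<^sub>v v" for k
  define s where "s k = complex_of_real (sd k * sqrt (real n))" for k
  define q where "q k = (\<Prod>j\<in>{k..m}. s j)" for k
  have s0: "s k \<noteq> 0" if "k \<in> {1..m}" for k using sd_pos[OF that] n by (simp add: s_def)
  have q0: "q k \<noteq> 0" if "1 \<le> k" for k unfolding q_def using s0 that by auto
  have qs: "q k = s k * q (Suc k)" if "k \<le> m" for k
    unfolding q_def using that by (subst atLeastAtMost_insertL[symmetric]) auto
  have yc: "y k \<in> carrier_vec n" if "1 \<le> k" "k \<le> Suc m" for k
    unfolding y_def using tail_product_carrier[OF n \<omega> that] v(1) by (rule mult_mat_vec_carrier)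
  have y_end: "y (Suc m) = v" using v(1) by (simp add: y_def tail_product_end)
  have y_step: "y k $ i = (\<Sum>j<n. ?A k $$ (i, j) * y (Suc k) $ j)" if k: "k \<in> {1..m}" and i: "i < n" for k i
  proof -
    have A: "?A k \<in> carrier_mat n n" using X_carrier[OF n k \<omega>] .
    have T: "tail_product n \<omega> (Suc k) \<in> carrier_mat n n" using tail_product_carrier[OF n \<omega>] k by auto
    have "y k = ?A k *\<^sub>v y (Suc k)"
      unfolding y_def using k by (simp add: tail_product_step assoc_mult_mat_vec[OF A T v(1)])
    moreover have "y (Suc k) \<in> carrier_vec n" using yc k by auto
    ultimately show ?thesis using A i by (simp add: scalar_prod_def lessThan_atLeast0)
  qed
  have q1: "q 1 = complex_of_real (sigma * real n powr (real m / 2))"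
  proof -
    have "sqrt (real n) ^ m = real n powr (real m / 2)"
      using n by (simp add: powr_half_sqrt[symmetric] powr_realpow[symmetric] powr_powr)
    moreover have "q 1 = complex_of_real (\<Prod>k=1..m. sd k * sqrt (real n))"
      by (simp add: q_def s_def)
    ultimately show ?thesis by (simp add: prod.distrib)
  qed
  have y1: "y 1 $ i = w ^ m * q 1 * v $ i" if i: "i < n" for i
  proof -
    have "(norm_prod n \<omega> *\<^sub>v v) $ i = complex_of_real (real n powr (- (real m / 2))) * y 1 $ i"
      unfolding norm_prod_eq y_def using tail_product_carrier[OF n \<omega>, of 1] v(1) i
      by (simp add: scalar_prod_def sum_distrib_left mult.assoc)
    then have "complex_of_real (real n powr (- (real m / 2))) * y 1 $ i = z * v $ i"
      using v i by simp
    then have "y 1 $ i = complex_of_real (real n powr (real m / 2)) * (z * v $ i)"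
      using n by (simp add: powr_minus field_simps)
    moreover have "z = w ^ m * complex_of_real sigma"
    proof -
      have "complex_of_real sigma \<noteq> 0" using sigma_pos by (metis less_irrefl of_real_eq_0_iff)
      then show ?thesis by (metis w nonzero_eq_divide_eq)
    qed
    ultimately show ?thesis unfolding q1 by (simp add: mult_ac)
  qed
  define x where "x u = y (fst u) $ snd u / (w ^ (Suc m - fst u) * q (fst u))" for u
  have x1: "x (1, j) = v $ j" if "j < n" for j
    unfolding x_def using y1[OF that] w0 q0[of 1] by simp
  have xn: "x (next_layer k, j) = y (Suc k) $ j / (w ^ (m - k) * q (Suc k))" if k: "k \<in> {1..m}" and j: "j < n" for k j
  proof (cases "k = m")
    case True
    then show ?thesis using x1[OF j] y_end by (simp add: next_layer_def q_def)
  qed (simp add: next_layer_def x_def)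
  have eq: "(\<Sum>v\<in>verts n. entry n (u, v) \<omega> * x v) = w * x u" if u: "u \<in> verts n" for u
  proof -
    obtain k i where ki: "u = (k, i)" "k \<in> {1..m}" "i < n" using u by (auto simp: verts_def)
    have "(\<Sum>v\<in>verts n. entry n (u, v) \<omega> * x v) = (\<Sum>v\<in>Pair (next_layer k) ` {..<n}. entry n (u, v) \<omega> * x v)"
      using ki next_layer[OF ki(2)]
      by (intro sum.mono_neutral_right) (auto simp: verts_def entry_def is_edge_def)
    also have "\<dots> = (\<Sum>j<n. entry n (u, (next_layer k, j)) \<omega> * x (next_layer k, j))"
      by (subst sum.reindex) (auto simp: inj_on_def)
    also have "\<dots> = (\<Sum>j<n. ?A k $$ (i, j) * y (Suc k) $ j / (s k * (w ^ (m - k) * q (Suc k))))"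
      using ki xn by (intro sum.cong) (auto simp: entry_def is_edge_def s_def)
    also have "\<dots> = y k $ i / (s k * (w ^ (m - k) * q (Suc k)))"
      unfolding y_step[OF ki(2,3)] sum_divide_distrib ..
    also have "\<dots> = y k $ i / (w ^ (m - k) * q k)" using qs[of k] ki(2) by (simp add: mult_ac)
    also have "\<dots> = w * x u"
    proof -
      have "Suc m - k = Suc (m - k)" using ki(2) by auto
      then show ?thesis using w0 by (simp add: x_def ki(1))
    qed
    finally show ?thesis .
  qed
  obtain i where i: "i < n" "v $ i \<noteq> 0"
  proof -
    have "\<exists>i<n. v $ i \<noteq> 0"
    proof (rule ccontr)
      assume "\<not> ?thesis"
      then have "v = 0\<^sub>v n" using v(1) by (intro eq_vecI) auto
      with v(2) show False by simp
    qed
    with that show thesis by blast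
  qed
  have "(1, i) \<in> verts n" "x (1, i) \<noteq> 0" using i x1 m_ge_1 by (auto simp: verts_def)
  with wz eq show thesis using that by blast
qed

text \<open>
  The order of the choices is \<open>\<zeta>\<close>, then \<open>C\<close> large in terms of \<open>\<zeta>\<close>, then \<open>\<delta>\<close> small in terms of \<open>C\<close>.
\<close>

lemma eventually_in_disk:
  assumes \<epsilon>: "0 < \<epsilon>"
  shows "AE \<omega> in M. \<forall>\<^sub>F n in sequentially. \<forall>z. eigenvalue (norm_prod n \<omega>) z \<longrightarrow> cmod z < sigma + \<epsilon>"
proof -
  \<comment> \<open>\<open>\<sigma> \<zeta> ^ m = \<sigma> + \<epsilon>\<close>, so that eigenvalues outside the disk lift to modulus at least \<open>\<zeta>\<close>.\<close>
  define \<zeta> where "\<zeta> = root m (1 + \<epsilon> / sigma)"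
  have m0: "0 < m" using m_ge_1 by simp
  have base: "1 < 1 + \<epsilon> / sigma" using \<epsilon> sigma_pos by simp
  have \<zeta>m: "sigma * \<zeta> ^ m = sigma + \<epsilon>"
  proof -
    have "\<zeta> ^ m = 1 + \<epsilon> / sigma" unfolding \<zeta>_def using m0 base by (intro real_root_pow_pos2) auto
    moreover have "sigma \<noteq> 0" using sigma_pos by linarith
    moreover have "r * (1 + \<epsilon> / r) = r + \<epsilon>" if "r \<noteq> 0" for r :: real
      using that by (simp add: distrib_left)
    ultimately show ?thesis by metis
  qed
  have \<zeta>: "1 < \<zeta>" unfolding \<zeta>_def using m0 base by simp
  define C where "C = 20 / ln \<zeta>"
  have C: "0 < C" "20 \<le> C * ln \<zeta>" using \<zeta> by (simp_all add: C_def)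
  define \<delta> where "\<delta> = min 1 (1 / (6400 * C))"
  have \<delta>: "0 < \<delta>" "\<delta> \<le> 1" using C by (auto simp: \<delta>_def)
  have "\<delta> * C \<le> 1 / (6400 * C) * C" using C by (intro mult_right_mono) (auto simp: \<delta>_def)
  then have \<delta>C: "2 * \<delta> * C \<le> 1/3200" using C by simp
  obtain n\<^sub>0 where n\<^sub>0: "\<And>n. n \<ge> n\<^sub>0 \<Longrightarrow> suitable_size kurt C \<delta> (real m) n"
    using eventually_suitable_size[OF kurt_ge_1 C(1) \<delta>(1), of "real m"] m_ge_1
    unfolding eventually_sequentially by auto
  let ?lp = "\<lambda>n. \<Sum>k\<in>{1..m}. real n * N.prob {\<omega> \<in> space N. real n < (cmod (\<xi> k \<omega>) / (\<delta> * sd k))\<^sup>2}"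
  define b where "b n = ?lp n + 8 * real n powr (-5/4)" for n
  define bounded_spectrum where "bounded_spectrum n \<omega> \<longleftrightarrow> (\<forall>z x. \<zeta> \<le> cmod z \<longrightarrow>
      (\<forall>u\<in>verts n. (\<Sum>v\<in>verts n. entry n (u, v) \<omega> * x v) = z * x u) \<longrightarrow> (\<forall>u\<in>verts n. x u = 0))" for n \<omega>
  have "\<exists>Bad. Bad \<in> M.events \<and> M.prob Bad \<le> b n \<and> (n \<ge> n\<^sub>0 \<longrightarrow> (\<forall>\<omega>\<in>space M - Bad. bounded_spectrum n \<omega>))" for n
  proof (cases "n \<ge> n\<^sub>0")
    case True
    note size = n\<^sub>0[OF True]
    have sz: "n \<ge> 1" "real n powr (-1/200) \<le> \<delta>" "kurt * (1 / real n) \<le> (real n powr (-1/200)) ^ 3"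
      using size by (auto simp: suitable_size_def Let_def)
    interpret edge_family M "verts n" "entry n" "edge_var n" "1 / real n" kurt "real n powr (-1/200)" \<delta>
      by (rule edge_family_entry) (use sz \<delta> in auto)
    obtain Bad where Bad: "Bad \<in> M.events"
        "M.prob Bad \<le> (\<Sum>u\<in>verts n. M.prob {\<omega> \<in> space M. \<delta> < cmod (entry n (u, u) \<omega>)}) + 8 * real n powr (-5/4)"
      and good: "\<forall>\<omega>\<in>space M - Bad. bounded_spectrum n \<omega>"
      using eigenvalue_event[OF size refl refl card_verts C \<delta>C \<zeta>] unfolding bounded_spectrum_def[symmetric] by blast
    have "M.prob Bad \<le> b n" using Bad(2) loop_prob_le[OF sz(1) \<delta>(1)] unfolding b_def by linarith
    with Bad(1) good show ?thesis by blast
  next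
    case False
    have "0 \<le> b n" unfolding b_def by (intro add_nonneg_nonneg sum_nonneg) auto
    then show ?thesis using False by (intro exI[of _ "{}"]) auto
  qed
  then obtain Bad where Bad: "\<And>n. Bad n \<in> M.events" "\<And>n. M.prob (Bad n) \<le> b n"
    and good: "\<And>n \<omega>. n \<ge> n\<^sub>0 \<Longrightarrow> \<omega> \<in> space M - Bad n \<Longrightarrow> bounded_spectrum n \<omega>"
    by metis
  have "summable (\<lambda>n. real n powr (-5/4))" by (simp add: summable_real_powr_iff)
  then have "summable b"
    unfolding b_def using loop_prob_summable[OF \<delta>(1)] by (intro summable_add summable_mult)
  then have "summable (\<lambda>n. M.prob (Bad n))"
    by (rule summable_comparison_test'[where N = 0]) (use Bad in auto)
  then have "AE \<omega> in M. \<forall>\<^sub>F n in sequentially. \<omega> \<in> space M - Bad n"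
    using Bad by (intro borel_cantelli_AE1) (auto simp: M.emeasure_eq_measure)
  then show ?thesis
  proof eventually_elim
    case (elim \<omega>)
    from elim eventually_ge_at_top[of "max 1 n\<^sub>0"] show ?case
    proof eventually_elim
      case (elim n)
      show ?case
      proof (intro allI impI)
        fix z assume ev: "eigenvalue (norm_prod n \<omega>) z"
        show "cmod z < sigma + \<epsilon>"
        proof (rule ccontr)
          assume "\<not> cmod z < sigma + \<epsilon>"
          then have z: "sigma * \<zeta> ^ m \<le> cmod z" using \<zeta>m by simp
          have n: "n \<ge> 1" "n \<ge> n\<^sub>0" and \<omega>: "\<omega> \<in> space M" "\<omega> \<in> space M - Bad n" using elim by auto
          have "0 < \<zeta>" using \<zeta> by simp
          show False
          proof (rule eigenvector_lift[OF n(1) \<omega>(1) ev \<open>0 < \<zeta>\<close> z])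
            fix w x u assume "\<zeta> \<le> cmod w" "u \<in> verts n" "x u \<noteq> 0"
              "\<And>u. u \<in> verts n \<Longrightarrow> (\<Sum>v\<in>verts n. entry n (u, v) \<omega> * x v) = w * x u"
            with good[OF n(2) \<omega>(2)] show False unfolding bounded_spectrum_def by blast
          qed
        qed
      qed
    qed
  qed
qed

lemma spectral_radius_bound:
  "AE \<omega> in M. \<exists>\<delta> :: nat \<Rightarrow> real. \<delta> \<longlonglongrightarrow> 0 \<and> (\<forall>n\<ge>1. spectral_radius (norm_prod n \<omega>) \<le> sigma + \<delta> n)"
proof -
  have "AE \<omega> in M. \<forall>i::nat. \<forall>\<^sub>F n in sequentially. \<forall>z. eigenvalue (norm_prod n \<omega>) z
       \<longrightarrow> cmod z < sigma + inverse (real (Suc i))"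
    unfolding AE_all_countable by (intro allI eventually_in_disk) simp
  then show ?thesis
    using AE_space
  proof eventually_elim
    case (elim \<omega>)
    define d where "d n = max 0 (spectral_radius (norm_prod n \<omega>) - sigma)" for n
    have "d \<longlonglongrightarrow> 0"
    proof (rule tendstoI)
      fix e :: real assume "0 < e"
      then obtain i where i: "inverse (real (Suc i)) < e" using reals_Archimedean by blast
      from elim(1) have "\<forall>\<^sub>F n in sequentially. \<forall>z. eigenvalue (norm_prod n \<omega>) z
         \<longrightarrow> cmod z < sigma + inverse (real (Suc i))" by blast
      with eventually_ge_at_top[of 1] show "\<forall>\<^sub>F n in sequentially. dist (d n) 0 < e"
      proof eventually_elim
        case (elim n)
        have "spectral_radius (norm_prod n \<omega>) \<in> cmod ` spectrum (norm_prod n \<omega>)"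
          using spectral_radius_mem_max(1)[OF norm_prod_carrier[OF elim(1) \<open>\<omega> \<in> space M\<close>]] elim(1) by simp
        then obtain z where "eigenvalue (norm_prod n \<omega>) z" "spectral_radius (norm_prod n \<omega>) = cmod z"
          by (auto simp: spectrum_def)
        with elim(2) have "spectral_radius (norm_prod n \<omega>) < sigma + inverse (real (Suc i))" by auto
        with i \<open>0 < e\<close> show ?case by (simp add: d_def)
      qed
    qed
    moreover have "spectral_radius (norm_prod n \<omega>) \<le> sigma + d n" for n by (simp add: d_def)
    ultimately show ?case by blast
  qed
qed

end

theorem theorem2p2:
  fixes m :: nat
    and N :: "'b measure" and \<xi> :: "nat \<Rightarrow> 'b \<Rightarrow> complex"
    and M :: "'a measure" and X :: "nat \<Rightarrow> nat \<Rightarrow> 'a \<Rightarrow> complex mat"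
  assumes "m \<ge> 1"
    and "prob_space N" and "prob_space M"
    and "\<And>k. k \<in> {1..m} \<Longrightarrow> \<xi> k \<in> borel_measurable N"
    and "\<And>k. k \<in> {1..m} \<Longrightarrow>
           prob_space.indep_var N borel (\<lambda>\<omega>. Re (\<xi> k \<omega>)) borel (\<lambda>\<omega>. Im (\<xi> k \<omega>))"
    and "\<And>k. k \<in> {1..m} \<Longrightarrow> integrable N (\<xi> k) \<and> (\<integral>\<omega>. \<xi> k \<omega> \<partial>N) = 0"
    and "\<And>k. k \<in> {1..m} \<Longrightarrow> integrable N (\<lambda>\<omega>. cmod (\<xi> k \<omega>) ^ 4)"
    and "\<And>k. k \<in> {1..m} \<Longrightarrow> complex_variance N (\<xi> k) \<noteq> 0"
    and "\<And>n k. n \<ge> 1 \<Longrightarrow> k \<in> {1..m} \<Longrightarrow> iid_random_matrix M n N (\<xi> k) (X n k)"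
    and "\<And>n. n \<ge> 1 \<Longrightarrow> prob_space.indep_vars M (\<lambda>_. mat_borel n) (X n) {1..m}"
  shows "(AE \<omega> in M. \<exists>\<delta> :: nat \<Rightarrow> real. \<delta> \<longlonglongrightarrow> 0 \<and>
            (\<forall>n\<ge>1. spectral_radius (normalized_product n m (\<lambda>k. X n k \<omega>))
                     \<le> (\<Prod>k=1..m. std_dev N (\<xi> k)) + \<delta> n)) \<and>
         (\<forall>\<epsilon>>0. AE \<omega> in M. \<forall>\<^sub>F n in sequentially.
            \<forall>z. eigenvalue (normalized_product n m (\<lambda>k. X n k \<omega>)) z \<longrightarrow>
                  z \<in> {z. cmod z < (\<Prod>k=1..m. std_dev N (\<xi> k)) + \<epsilon>})"
proof -
  have N: "prob_space N" and M: "prob_space M" by fact+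
  interpret iid_product M N m \<xi> X
    by (intro iid_product.intro N M iid_product_axioms.intro) (fact assms)+
  show ?thesis
    using spectral_radius_bound eventually_in_disk by simp
qed

end
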